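(* Let $I$ be a proper homogeneous geometrically vertex decomposable ideal in a polynomial ring $R=\mathbb{K}[x_1,\ldots,x_n]$ with $n\ge1$. If $I$ is $C$-saturated geometrically vertex decomposable, then $a(R/I)<0$. In particular, $I$ is Hilbertian.
   Context: $\mathbb{K}$ is an algebraically closed field of characteristic $0$ and $R=\mathbb{K}[x_1,\ldots,x_n]$ has the standard grading. Fix a variable $y=x_j$. A nonzero $f\in R$ is written $f=\sum_{i=0}^d\alpha_i y^i$ with $\alpha_i\in\mathbb{K}[x_1,\ldots,\widehat{x_j},\ldots,x_n]$ and $\alpha_d\ne0$; its initial $y$-form is $\mathrm{in}_y(f)=\alpha_d y^d$. For an ideal $J$, $\mathrm{in}_y(J)=\langle \mathrm{in}_y(f) : f\in J\rangle$. A monomial order $<$ is $y$-compatible if $\mathrm{in}_<(\mathrm{in}_y(f))=\mathrm{in}_<(f)$ for all $f\in R$. Given an ideal $I$ and a Gröbner basis $\{g_1,\ldots,g_m\}$ of $I$ with respect to a $y$-compatible order, write $g_i=y^{d_i}q_i+r_i$ with $\mathrm{in}_y(g_i)=y^{d_i}q_i$ and $y$ not dividing any term of $q_i$. Put $C_{y,I}=\langle q_1,\ldots,q_m\rangle$ and $N_{y,I}=\langle q_i : d_i=0\rangle$ (independent of choices). If $\mathrm{in}_y(I)=C_{y,I}\cap(N_{y,I}+\langle y\rangle)$, this is called a geometric vertex decomposition of $I$ with respect to $y$. It is degenerate if $\sqrt{C_{y,I}}=\sqrt{N_{y,I}}$ or $C_{y,I}=\langle1\rangle$, and nondegenerate otherwise.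 An ideal $I$ is unmixed if $\dim(R/I)=\dim(R/P)$ for all associated primes $P$ of $R/I$. An ideal $I\subseteq\mathbb{K}[x_1,\ldots,x_n]$ is geometrically vertex decomposable if $I$ is unmixed and either (1) $I=\langle1\rangle$ or $I$ is generated by a (possibly empty) subset of the variables, or (2) there is a variable $y=x_j$ and a $y$-compatible monomial order giving a geometric vertex decomposition $\mathrm{in}_y(I)=C_{y,I}\cap(N_{y,I}+\langle y\rangle)$ such that the contractions of $C_{y,I}$ and $N_{y,I}$ to $\mathbb{K}[x_1,\ldots,\widehat{x_j},\ldots,x_n]$ are geometrically vertex decomposable. A proper homogeneous ideal $I$ of $R=\mathbb{K}[x_1,\ldots,x_n]$ is $C$-saturated geometrically vertex decomposable if $I$ is saturated (with respect to the irrelevant ideal $\langle x_1,\ldots,x_n\rangle$) and unmixed and one of the following holds: (1) $I$ is generated by a (possibly empty) subset of the variables of $R$; (2) there is a variable $y=x_j$ and a $y$-compatible monomial order giving a degenerate geometric vertex decomposition of $I$ for which the contraction of $N_{y,I}$ to $\mathbb{K}[x_1,\ldots,\widehat{x_j},\ldots,x_n]$ is $C$-saturated geometrically vertex decomposable; (3) there is a variable $y=x_j$ and a $y$-compatible monomial order giving a nondegenerate geometric vertex decomposition of $I$ for which the contractions of both $C_{y,I}$ and $N_{y,I}$ to $\mathbb{K}[x_1,\ldots,\widehat{x_j},\ldots,x_n]$ are $C$-saturated geometrically vertex decomposable. The $a$-invariant of a finitely generated graded module $M$ of dimension $d$ with Hilbert series $h_M(t)/(1-t)^d$ is $a(M)=\deg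 h_M(t)-d$. A homogeneous ideal $I$ is Hilbertian if the Hilbert polynomial and Hilbert function of $R/I$ satisfy $HP_{R/I}(t)=HF_{R/I}(t)$ for all integers $t\ge0$. *)

theory Defs
  imports
    "HOL-Library.Poly_Mapping"
    "HOL-Library.Extended_Nat"
    "HOL-Computational_Algebra.Polynomial_FPS"
    "HOL-Algebra.QuotRing"
    "HOL-Algebra.Ideal_Product"
    "HOL-Algebra.Embedded_Algebras"
begin

section \<open>Notions for commutative rings\<close>

text \<open>Supremum of the lengths of chains of prime ideals. The zero ring gets the value 0 instead
  of the more customary minus infinity; below, dimensions are only taken of quotients by
  proper ideals.\<close>

definition krull_dim :: "('a, 'b) ring_scheme \<Rightarrow> enat" where
  "krull_dim A = Sup {enat k | k. \<exists>P :: nat \<Rightarrow> 'a set.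
      (\<forall>i\<le>k. primeideal (P i) A) \<and> (\<forall>i<k. P i \<subset> P (Suc i))}"

definition ideal_radical :: "('a, 'b) ring_scheme \<Rightarrow> 'a set \<Rightarrow> 'a set" where
  "ideal_radical A I = {a \<in> carrier A. \<exists>k::nat. a [^]\<^bsub>A\<^esub> k \<in> I}"

text \<open>The associated primes of the module \<open>A/I\<close>: the primes that are the annihilator of the
  class of some \<open>f\<close>.\<close>

definition associated_primes :: "('a, 'b) ring_scheme \<Rightarrow> 'a set \<Rightarrow> 'a set set" where
  "associated_primes A I = {P. primeideal P A \<and>
      (\<exists>f \<in> carrier A. P = {a \<in> carrier A. a \<otimes>\<^bsub>A\<^esub> f \<in> I})}"

definition unmixed :: "('a, 'b) ring_scheme \<Rightarrow> 'a set \<Rightarrow> bool" where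
  "unmixed A I \<longleftrightarrow> (\<forall>P \<in> associated_primes A I. krull_dim (A Quot I) = krull_dim (A Quot P))"

text \<open>The union over all \<open>k\<close> of the colon ideals of \<open>I\<close> by the \<open>k\<close>-th power of \<open>M\<close>;
  the power is taken in the monoid of ideals, so the 0-th power is the whole ring.\<close>

definition saturation :: "('a, 'b) ring_scheme \<Rightarrow> 'a set \<Rightarrow> 'a set \<Rightarrow> 'a set" where
  "saturation A M I = {f \<in> carrier A.
      \<exists>k::nat. \<forall>g \<in> M [^]\<^bsub>ideals_set A\<^esub> k. f \<otimes>\<^bsub>A\<^esub> g \<in> I}"


section \<open>Polynomial rings\<close>

text \<open>Exponent vectors are finitely supported functions from variable indices to exponents.
  The polynomial ring in the variables with indices in \<open>V\<close> is carved out of the polynomials in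
  countably many variables, so that dropping a variable is literally passing to a subring.\<close>

type_synonym mon = "nat \<Rightarrow>\<^sub>0 nat"
type_synonym 'k mpoly = "mon \<Rightarrow>\<^sub>0 'k"

definition monomials :: "nat set \<Rightarrow> mon set" where
  "monomials V = {m. Poly_Mapping.keys m \<subseteq> V}"

definition mpoly_ring :: "nat set \<Rightarrow> 'k::comm_ring_1 mpoly ring" where
  "mpoly_ring V = \<lparr>carrier = {p. Poly_Mapping.keys p \<subseteq> monomials V},
     mult = (*), one = 1, zero = 0, add = (+)\<rparr>"

lemma keys_mult_monomials:
  fixes p q :: "'k::comm_ring_1 mpoly"
  assumes "Poly_Mapping.keys p \<subseteq> monomials V" "Poly_Mapping.keys q \<subseteq> monomials V"
  shows "Poly_Mapping.keys (p * q) \<subseteq> monomials V"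
proof
  fix m assume "m \<in> Poly_Mapping.keys (p * q)"
  then obtain a b where ab: "a \<in> Poly_Mapping.keys p" "b \<in> Poly_Mapping.keys q" "m = a + b"
    using keys_mult[of p q] by blast
  then show "m \<in> monomials V"
    using assms keys_add[of a b] unfolding monomials_def by blast
qed

lemma cring_mpoly_ring: "cring (mpoly_ring V :: 'k::comm_ring_1 mpoly ring)"
proof (rule cringI)
  show "abelian_group (mpoly_ring V :: 'k mpoly ring)"
  proof (rule abelian_groupI)
    fix x :: "'k mpoly" assume "x \<in> carrier (mpoly_ring V)"
    then show "\<exists>y\<in>carrier (mpoly_ring V). y \<oplus>\<^bsub>mpoly_ring V\<^esub> x = \<zero>\<^bsub>mpoly_ring V\<^esub>"
      by (intro bexI[of _ "- x"]) (auto simp: mpoly_ring_def)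
  next
    fix x y :: "'k mpoly"
    assume "x \<in> carrier (mpoly_ring V)" "y \<in> carrier (mpoly_ring V)"
    then show "x \<oplus>\<^bsub>mpoly_ring V\<^esub> y \<in> carrier (mpoly_ring V)"
      using keys_add[of x y] by (auto simp: mpoly_ring_def)
  qed (auto simp: mpoly_ring_def algebra_simps)
  show "comm_monoid (mpoly_ring V :: 'k mpoly ring)"
  proof (rule comm_monoidI)
    fix x y :: "'k mpoly"
    assume "x \<in> carrier (mpoly_ring V)" "y \<in> carrier (mpoly_ring V)"
    then show "x \<otimes>\<^bsub>mpoly_ring V\<^esub> y \<in> carrier (mpoly_ring V)"
      using keys_mult_monomials[of x V y] by (simp add: mpoly_ring_def)
  qed (auto simp: mpoly_ring_def algebra_simps monomials_def)
qed (auto simp: mpoly_ring_def algebra_simps)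

definition var :: "nat \<Rightarrow> 'k::comm_ring_1 mpoly" where
  "var i = Poly_Mapping.single (Poly_Mapping.single i 1) 1"

definition const :: "'k::comm_ring_1 \<Rightarrow> 'k mpoly" where
  "const c = Poly_Mapping.single 0 c"

definition mon_degree :: "mon \<Rightarrow> nat" where
  "mon_degree m = (\<Sum>i\<in>Poly_Mapping.keys m. Poly_Mapping.lookup m i)"

definition hom_component :: "nat \<Rightarrow> 'k::comm_ring_1 mpoly \<Rightarrow> 'k mpoly" where
  "hom_component t f =
     (\<Sum>m\<in>{m \<in> Poly_Mapping.keys f. mon_degree m = t}. Poly_Mapping.single m (Poly_Mapping.lookup f m))"

definition graded_piece :: "nat set \<Rightarrow> nat \<Rightarrow> 'k::comm_ring_1 mpoly set" where
  "graded_piece V t = {f \<in> carrier (mpoly_ring V). \<forall>m\<in>Poly_Mapping.keys f. mon_degree m = t}"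

definition homogeneous_ideal :: "nat set \<Rightarrow> 'k::comm_ring_1 mpoly set \<Rightarrow> bool" where
  "homogeneous_ideal V I \<longleftrightarrow> ideal I (mpoly_ring V) \<and> (\<forall>f\<in>I. \<forall>t. hom_component t f \<in> I)"

definition irrelevant_ideal :: "nat set \<Rightarrow> 'k::comm_ring_1 mpoly set" where
  "irrelevant_ideal V = Idl\<^bsub>mpoly_ring V\<^esub> (var ` V)"

definition saturated :: "nat set \<Rightarrow> 'k::comm_ring_1 mpoly set \<Rightarrow> bool" where
  "saturated V I \<longleftrightarrow> saturation (mpoly_ring V) (irrelevant_ideal V) I = I"

definition variable_ideal :: "nat set \<Rightarrow> 'k::comm_ring_1 mpoly set \<Rightarrow> bool" where
  "variable_ideal V I \<longleftrightarrow> (\<exists>S \<subseteq> V. I = Idl\<^bsub>mpoly_ring V\<^esub> (var ` S))"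


section \<open>Initial forms and Groebner bases\<close>

text \<open>In \<open>y_degree\<close> the inserted 0 only matters for the zero polynomial. For \<open>y = var j\<close>,
  \<open>f\<close> is the sum of all \<open>y_coeff j i f * y ^ i\<close> with \<open>i \<le> y_degree j f\<close>, and \<open>y_lead_coeff j f\<close>
  is the leading coefficient in this expansion.\<close>

definition y_degree :: "nat \<Rightarrow> 'k::comm_ring_1 mpoly \<Rightarrow> nat" where
  "y_degree j f = Max (insert 0 ((\<lambda>m. Poly_Mapping.lookup m j) ` Poly_Mapping.keys f))"

definition y_coeff :: "nat \<Rightarrow> nat \<Rightarrow> 'k::comm_ring_1 mpoly \<Rightarrow> 'k mpoly" where
  "y_coeff j i f = (\<Sum>m\<in>{m \<in> Poly_Mapping.keys f. Poly_Mapping.lookup m j = i}.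
      Poly_Mapping.single (m - Poly_Mapping.single j i) (Poly_Mapping.lookup f m))"

lemma y_expansion:
  fixes f :: "'k::comm_ring_1 mpoly"
  shows "f = (\<Sum>i\<le>y_degree j f. y_coeff j i f * var j ^ i)"
proof -
  have pow: "var j ^ i = Poly_Mapping.single (Poly_Mapping.single j i) (1::'k)" for i
    by (induction i) (auto simp: var_def mult_single simp flip: single_add)
  have *: "y_coeff j i f * var j ^ i =
      (\<Sum>m\<in>{m \<in> Poly_Mapping.keys f. Poly_Mapping.lookup m j = i}.
         Poly_Mapping.single m (Poly_Mapping.lookup f m))" for i
  proof -
    have "m - Poly_Mapping.single j i + Poly_Mapping.single j i = m"
      if "Poly_Mapping.lookup m j = i" for m :: mon
      using that by (intro poly_mapping_eqI) (auto simp: lookup_add lookup_minus lookup_single when_def)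
    then show ?thesis
      by (simp add: y_coeff_def pow sum_distrib_right mult_single)
  qed
  have le: "Poly_Mapping.lookup m j \<le> y_degree j f" if "m \<in> Poly_Mapping.keys f" for m
    using that by (auto simp: y_degree_def intro!: Max_ge)
  have "(\<Sum>i\<le>y_degree j f. y_coeff j i f * var j ^ i) =
      (\<Sum>m\<in>Poly_Mapping.keys f. Poly_Mapping.single m (Poly_Mapping.lookup f m))"
    unfolding * by (rule sum.group) (use le in auto)
  also have "\<dots> = f"
    by (rule poly_mapping_eqI)
       (auto simp: lookup_sum lookup_single when_def sum.delta in_keys_iff)
  finally show ?thesis by simp
qed

definition y_lead_coeff :: "nat \<Rightarrow> 'k::comm_ring_1 mpoly \<Rightarrow> 'k mpoly" where
  "y_lead_coeff j f = y_coeff j (y_degree j f) f"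

definition in_y :: "nat \<Rightarrow> 'k::comm_ring_1 mpoly \<Rightarrow> 'k mpoly" where
  "in_y j f = y_lead_coeff j f * var j ^ y_degree j f"

definition in_y_ideal :: "nat set \<Rightarrow> nat \<Rightarrow> 'k::comm_ring_1 mpoly set \<Rightarrow> 'k mpoly set" where
  "in_y_ideal V j J = Idl\<^bsub>mpoly_ring V\<^esub> (in_y j ` J)"

text \<open>A pair \<open>(a, b)\<close> in the relation means that \<open>a\<close> is less than or equal to \<open>b\<close>.\<close>

definition monomial_order :: "nat set \<Rightarrow> mon rel \<Rightarrow> bool" where
  "monomial_order V r \<longleftrightarrow> linear_order_on (monomials V) r \<and>
     (\<forall>a \<in> monomials V. (0, a) \<in> r) \<and>
     (\<forall>a b. \<forall>c \<in> monomials V. (a, b) \<in> r \<longrightarrow> (a + c, b + c) \<in> r)"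

definition lead_monomial :: "mon rel \<Rightarrow> 'k::comm_ring_1 mpoly \<Rightarrow> mon" where
  "lead_monomial r f = (THE m. m \<in> Poly_Mapping.keys f \<and> (\<forall>m' \<in> Poly_Mapping.keys f. (m', m) \<in> r))"

definition initial_term :: "mon rel \<Rightarrow> 'k::comm_ring_1 mpoly \<Rightarrow> 'k mpoly" where
  "initial_term r f = (if f = 0 then 0
     else Poly_Mapping.single (lead_monomial r f) (Poly_Mapping.lookup f (lead_monomial r f)))"

definition y_compatible :: "nat set \<Rightarrow> nat \<Rightarrow> 'k::comm_ring_1 itself \<Rightarrow> mon rel \<Rightarrow> bool" where
  "y_compatible V j K r \<longleftrightarrow>
     (\<forall>f :: 'k mpoly. f \<in> carrier (mpoly_ring V) \<longrightarrow>
        initial_term r (in_y j f) = initial_term r f)"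

definition groebner_basis ::
    "nat set \<Rightarrow> mon rel \<Rightarrow> 'k::comm_ring_1 mpoly set \<Rightarrow> 'k mpoly set \<Rightarrow> bool" where
  "groebner_basis V r G I \<longleftrightarrow> finite G \<and> G \<subseteq> I \<and> 0 \<notin> G \<and>
     Idl\<^bsub>mpoly_ring V\<^esub> (initial_term r ` G) = Idl\<^bsub>mpoly_ring V\<^esub> (initial_term r ` I)"


section \<open>Geometric vertex decomposition\<close>

text \<open>Here \<open>G\<close> is a Groebner basis of the ideal in question. For \<open>g \<in> G\<close> with
  \<open>in_y(g) = y\<^sup>d q\<close>, \<open>q\<close> is \<open>y_lead_coeff j g\<close> and \<open>d\<close> is \<open>y_degree j g\<close>.\<close>

definition C_ideal :: "nat set \<Rightarrow> nat \<Rightarrow> 'k::comm_ring_1 mpoly set \<Rightarrow> 'k mpoly set" where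
  "C_ideal V j G = Idl\<^bsub>mpoly_ring V\<^esub> (y_lead_coeff j ` G)"

definition N_ideal :: "nat set \<Rightarrow> nat \<Rightarrow> 'k::comm_ring_1 mpoly set \<Rightarrow> 'k mpoly set" where
  "N_ideal V j G = Idl\<^bsub>mpoly_ring V\<^esub> (y_lead_coeff j ` {g \<in> G. y_degree j g = 0})"

definition geometric_vertex_decomposition ::
    "nat set \<Rightarrow> nat \<Rightarrow> mon rel \<Rightarrow> 'k::comm_ring_1 mpoly set \<Rightarrow> 'k mpoly set \<Rightarrow> bool" where
  "geometric_vertex_decomposition V j r G I \<longleftrightarrow>
     j \<in> V \<and> monomial_order V r \<and> y_compatible V j TYPE('k) r \<and> groebner_basis V r G I \<and>
     in_y_ideal V j I =
       C_ideal V j G \<inter> (N_ideal V j G <+>\<^bsub>mpoly_ring V\<^esub> Idl\<^bsub>mpoly_ring V\<^esub> {var j})"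

definition degenerate :: "nat set \<Rightarrow> nat \<Rightarrow> 'k::comm_ring_1 mpoly set \<Rightarrow> bool" where
  "degenerate V j G \<longleftrightarrow>
     ideal_radical (mpoly_ring V) (C_ideal V j G) = ideal_radical (mpoly_ring V) (N_ideal V j G) \<or>
     C_ideal V j G = carrier (mpoly_ring V)"

definition contraction :: "nat set \<Rightarrow> nat \<Rightarrow> 'k::comm_ring_1 mpoly set \<Rightarrow> 'k mpoly set" where
  "contraction V j J = J \<inter> carrier (mpoly_ring (V - {j}))"

inductive gvd :: "nat set \<Rightarrow> 'k::comm_ring_1 mpoly set \<Rightarrow> bool" where
  unit: "unmixed (mpoly_ring V) I \<Longrightarrow> I = carrier (mpoly_ring V) \<Longrightarrow> gvd V I"
| variables: "unmixed (mpoly_ring V) I \<Longrightarrow> variable_ideal V I \<Longrightarrow> gvd V I"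
| decomp: "ideal I (mpoly_ring V) \<Longrightarrow> unmixed (mpoly_ring V) I \<Longrightarrow>
    geometric_vertex_decomposition V j r G I \<Longrightarrow>
    gvd (V - {j}) (contraction V j (C_ideal V j G)) \<Longrightarrow>
    gvd (V - {j}) (contraction V j (N_ideal V j G)) \<Longrightarrow> gvd V I"

definition csat_base :: "nat set \<Rightarrow> 'k::comm_ring_1 mpoly set \<Rightarrow> bool" where
  "csat_base V I \<longleftrightarrow> homogeneous_ideal V I \<and> I \<noteq> carrier (mpoly_ring V) \<and>
     saturated V I \<and> unmixed (mpoly_ring V) I"

inductive csat_gvd :: "nat set \<Rightarrow> 'k::comm_ring_1 mpoly set \<Rightarrow> bool" where
  variables: "csat_base V I \<Longrightarrow> variable_ideal V I \<Longrightarrow> csat_gvd V I"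
| degenerate: "csat_base V I \<Longrightarrow>
    geometric_vertex_decomposition V j r G I \<Longrightarrow> degenerate V j G \<Longrightarrow>
    csat_gvd (V - {j}) (contraction V j (N_ideal V j G)) \<Longrightarrow> csat_gvd V I"
| nondegenerate: "csat_base V I \<Longrightarrow>
    geometric_vertex_decomposition V j r G I \<Longrightarrow> \<not> degenerate V j G \<Longrightarrow>
    csat_gvd (V - {j}) (contraction V j (C_ideal V j G)) \<Longrightarrow>
    csat_gvd (V - {j}) (contraction V j (N_ideal V j G)) \<Longrightarrow> csat_gvd V I"


section \<open>Hilbert functions\<close>

text \<open>The dimension of the degree \<open>t\<close> part of the quotient ring over the image of the
  constants. That image is a field when \<open>I\<close> is proper.\<close>

definition hilbert_function :: "nat set \<Rightarrow> 'k::comm_ring_1 mpoly set \<Rightarrow> nat \<Rightarrow> nat" where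
  "hilbert_function V I t =
     ring.dim (mpoly_ring V Quot I)
       ((\<lambda>c. I +>\<^bsub>mpoly_ring V\<^esub> const c) ` UNIV)
       ((\<lambda>f. I +>\<^bsub>mpoly_ring V\<^esub> f) ` graded_piece V t)"

definition hilbert_series :: "nat set \<Rightarrow> 'k::comm_ring_1 mpoly set \<Rightarrow> int fps" where
  "hilbert_series V I = Abs_fps (\<lambda>t. int (hilbert_function V I t))"

definition hilbert_polynomial :: "nat set \<Rightarrow> 'k::comm_ring_1 mpoly set \<Rightarrow> rat poly" where
  "hilbert_polynomial V I =
     (THE p. \<forall>\<^sub>F t in sequentially. poly p (of_nat t) = of_nat (hilbert_function V I t))"

definition quotient_dim :: "nat set \<Rightarrow> 'k::comm_ring_1 mpoly set \<Rightarrow> nat" where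
  "quotient_dim V I = the_enat (krull_dim (mpoly_ring V Quot I))"

text \<open>The numerator \<open>h\<close> of the Hilbert series \<open>h(t) / (1 - t)^d\<close> of \<open>R/I\<close>, where \<open>d\<close> is the
  dimension of \<open>R/I\<close>.\<close>

definition h_polynomial :: "nat set \<Rightarrow> 'k::comm_ring_1 mpoly set \<Rightarrow> int poly" where
  "h_polynomial V I =
     (THE h. hilbert_series V I * (1 - fps_X) ^ quotient_dim V I = fps_of_poly h)"

definition a_invariant :: "nat set \<Rightarrow> 'k::comm_ring_1 mpoly set \<Rightarrow> int" where
  "a_invariant V I = int (Polynomial.degree (h_polynomial V I)) - int (quotient_dim V I)"

definition hilbertian :: "nat set \<Rightarrow> 'k::comm_ring_1 mpoly set \<Rightarrow> bool" where
  "hilbertian V I \<longleftrightarrow> homogeneous_ideal V I \<and>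
     (\<forall>t::nat. poly (hilbert_polynomial V I) (of_nat t) = of_nat (hilbert_function V I t))"

end

theory Submission
  imports Defs
begin

text \<open>For an ideal \<open>I\<close> of \<open>K[V]\<close> and a variable \<open>y\<close>, let \<open>L i\<close> be the ideal of coefficients of
  \<open>y ^ i\<close> in the elements of \<open>I\<close> of \<open>y\<close>-degree at most \<open>i\<close>. A geometric vertex decomposition yields
  that \<open>L 0\<close> is the contraction of \<open>N\<close>, and \<open>L i\<close> for \<open>i > 0\<close> that of \<open>C\<close>. Since the Hilbert function
  of \<open>I\<close> at \<open>t\<close> is the sum of those of \<open>L i\<close> at \<open>t - i\<close> over \<open>i \<le> t\<close>, it is the Hilbert function of
  \<open>N\<close> at \<open>t\<close> plus the sum of that of \<open>C\<close> over all \<open>i < t\<close>. By induction, the ideal \<open>I\<close> is radical (so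
  that \<open>C = N\<close> whenever \<open>C\<close> and \<open>N\<close> have the same radical), and its Hilbert function is, for all
  \<open>t \<ge> 0\<close>, a combination of binomial coefficients \<open>t choose k\<close> with natural coefficients \<open>a k\<close>.
  Saturatedness excludes the irrelevant ideal as a base case.

  As \<open>t choose k\<close> has the generating function \<open>X ^ k / (1 - X) ^ (k + 1)\<close>, it remains to see that
  \<open>a k = 0\<close> unless \<open>k\<close> is less than the dimension \<open>d\<close> of the quotient. Otherwise the cumulative
  Hilbert function would grow faster than \<open>t ^ d\<close>. A homogeneous ideal that is maximal with this
  growth is prime, and adding to it a variable outside it lowers the growth by at most one degree;
  hence there would be a chain of \<open>d + 2\<close> primes over \<open>I\<close>. That \<open>d\<close> is finite follows from the algebraic
  dependence of more than \<open>card V\<close> polynomials.\<close>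

section \<open>Ideals of polynomial rings and coefficient extraction\<close>

text \<open>A degenerate decomposition gives recursive information about \<open>N\<close> only. This
  is why radicality travels along the induction: it yields that \<open>C\<close> lies in the radical
  of \<open>C\<close>, which is that of \<open>N\<close>, which is \<open>N\<close>. Binomial
  coefficients fit the recursion because summing over \<open>i < t\<close> sends
  \<open>t choose k\<close> to \<open>t choose Suc k\<close>; and a combination of them agrees with
  one polynomial from \<open>t = 0\<close> on. The dimension is a supremum of lengths of prime
  chains, with no built-in link to Hilbert functions. Only a lower bound on \<open>d\<close> is
  needed, and explicit chains supply it; the upper bound merely makes the supremum finite, since
  \<open>the_enat\<close> is informative only on finite values. The lower bound passes through
  auxiliary ideals whose Hilbert functions have no known closed form, so it measures growth of
  cumulative sums instead of degrees of polynomials. The ideals \<open>L i\<close> serve several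
  times: nested ideals with the same \<open>L i\<close> are equal, which drives the Hilbert function
  recursion and the radicality proof in spirit, and literally the ascending chain condition behind
  the choice of maximal ideals.\<close>

abbreviation polys :: "nat set \<Rightarrow> 'k::comm_ring_1 mpoly set" where
  "polys V \<equiv> carrier (mpoly_ring V)"

lemma polys_iff: "f \<in> polys V \<longleftrightarrow> (\<forall>m\<in>Poly_Mapping.keys f. Poly_Mapping.keys m \<subseteq> V)"
  by (auto simp: mpoly_ring_def monomials_def)

lemma polys_add: "f \<in> polys V \<Longrightarrow> g \<in> polys V \<Longrightarrow> f + g \<in> polys V"
  using keys_add[of f g] by (auto simp: polys_iff)

lemma polys_uminus: "f \<in> polys V \<Longrightarrow> - f \<in> polys V"
  for f :: "'k::comm_ring_1 mpoly"
  by (auto simp: polys_iff in_keys_iff)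

lemma polys_diff: "f \<in> polys V \<Longrightarrow> g \<in> polys V \<Longrightarrow> f - g \<in> polys V"
  for f g :: "'k::comm_ring_1 mpoly"
  using polys_add[of f V "- g"] polys_uminus[of g V] by simp

lemma polys_mult: "f \<in> polys V \<Longrightarrow> g \<in> polys V \<Longrightarrow> f * g \<in> polys V"
  using keys_mult_monomials[of f V g] by (simp add: mpoly_ring_def)

lemma polys_single: "Poly_Mapping.keys m \<subseteq> V \<Longrightarrow> Poly_Mapping.single m c \<in> polys V"
  by (auto simp: polys_iff)

lemma polys_zero: "0 \<in> polys V"
  by (simp add: polys_iff)

lemma polys_one: "1 \<in> polys V"
  by (simp add: polys_iff)

lemma polys_const: "const c \<in> polys V"
  by (simp add: const_def polys_single)

lemma polys_var: "i \<in> V \<Longrightarrow> var i \<in> polys V"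
  by (simp add: var_def polys_single)

lemma polys_power: "f \<in> polys V \<Longrightarrow> f ^ k \<in> polys V"
  by (induction k) (auto intro: polys_one polys_mult)

lemma polys_sum: "(\<And>i. i \<in> A \<Longrightarrow> f i \<in> polys V) \<Longrightarrow> sum f A \<in> polys V"
  by (induction A rule: infinite_finite_induct) (auto intro: polys_zero polys_add)

lemma polys_mono: "V \<subseteq> W \<Longrightarrow> polys V \<subseteq> polys W"
  by (fastforce simp: polys_iff)

lemmas polys_closed = polys_add polys_uminus polys_diff polys_mult polys_zero polys_one polys_const
  polys_var polys_power polys_sum

lemma mpoly_ring_pow: "a [^]\<^bsub>mpoly_ring V\<^esub> (k::nat) = a ^ k"
  by (induction k) (auto simp: mpoly_ring_def nat_pow_def)

lemma ideal_mpolyI: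
  fixes I :: "'k::comm_ring_1 mpoly set"
  assumes "I \<subseteq> polys V" "0 \<in> I" "\<And>a b. a \<in> I \<Longrightarrow> b \<in> I \<Longrightarrow> a + b \<in> I"
    "\<And>p a. p \<in> polys V \<Longrightarrow> a \<in> I \<Longrightarrow> p * a \<in> I"
  shows "ideal I (mpoly_ring V)"
proof -
  interpret cring "mpoly_ring V :: 'k mpoly ring" by (rule cring_mpoly_ring)
  \<comment> \<open>Negation is multiplication by the polynomial \<open>-1\<close>, so the closure
    conditions need not mention it.\<close>
  have neg: "- a \<in> I" if "a \<in> I" for a
    using assms(4)[of "-1" a] that by (simp add: polys_closed)
  show ?thesis
  proof (rule idealI)
    show "subgroup I (add_monoid (mpoly_ring V))"
    proof (rule add.subgroupI)
      fix a assume a: "a \<in> I"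
      have "\<ominus>\<^bsub>mpoly_ring V\<^esub> a = - a"
        by (rule minus_equality) (use a assms(1) polys_uminus[of a V] in \<open>auto simp: mpoly_ring_def\<close>)
      then show "\<ominus>\<^bsub>mpoly_ring V\<^esub> a \<in> I"
        using neg[OF a] by simp
    qed (use assms in \<open>auto simp: mpoly_ring_def\<close>)
  next
    fix a x :: "'k mpoly" assume ax: "a \<in> I" "x \<in> polys V"
    then show "x \<otimes>\<^bsub>mpoly_ring V\<^esub> a \<in> I" "a \<otimes>\<^bsub>mpoly_ring V\<^esub> x \<in> I"
      using assms(4)[of x a] by (auto simp: mpoly_ring_def mult.commute)
  qed (rule ring_axioms)
qed

lemma ideal_mpolyD:
  fixes I :: "'k::comm_ring_1 mpoly set"
  assumes "ideal I (mpoly_ring V)"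
  shows "I \<subseteq> polys V" "0 \<in> I" "\<And>a b. a \<in> I \<Longrightarrow> b \<in> I \<Longrightarrow> a + b \<in> I"
    "\<And>p a. p \<in> polys V \<Longrightarrow> a \<in> I \<Longrightarrow> p * a \<in> I"
    "\<And>p a. p \<in> polys V \<Longrightarrow> a \<in> I \<Longrightarrow> a * p \<in> I"
    "\<And>a. a \<in> I \<Longrightarrow> - a \<in> I" "\<And>a b. a \<in> I \<Longrightarrow> b \<in> I \<Longrightarrow> a - b \<in> I"
    "\<And>A f. (\<And>i. i \<in> A \<Longrightarrow> f i \<in> I) \<Longrightarrow> sum f (A :: 'i set) \<in> I"
proof -
  interpret ideal I "mpoly_ring V" by fact
  show sub: "I \<subseteq> polys V" by (rule a_subset)
  show z: "0 \<in> I" using additive_subgroup.zero_closed[OF is_additive_subgroup] by (simp add: mpoly_ring_def)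
  show add: "\<And>a b. a \<in> I \<Longrightarrow> b \<in> I \<Longrightarrow> a + b \<in> I"
    using additive_subgroup.a_closed[OF is_additive_subgroup] by (simp add: mpoly_ring_def)
  show mult: "\<And>p a. p \<in> polys V \<Longrightarrow> a \<in> I \<Longrightarrow> p * a \<in> I"
    using I_l_closed by (simp add: mpoly_ring_def)
  then show "\<And>p a. p \<in> polys V \<Longrightarrow> a \<in> I \<Longrightarrow> a * p \<in> I"
    by (simp add: mult.commute)
  show neg: "- a \<in> I" if "a \<in> I" for a
    using mult[of "-1" a] that by (simp add: polys_closed)
  show "a - b \<in> I" if "a \<in> I" "b \<in> I" for a b
    using add[of a "- b"] neg that by simp
  show "\<And>A f. (\<And>i. i \<in> A \<Longrightarrow> f i \<in> I) \<Longrightarrow> sum f (A :: 'i set) \<in> I"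
    subgoal for A f by (induction A rule: infinite_finite_induct) (auto simp: z intro: add)
    done
qed

lemma ideal_eq_polys_iff:
  fixes I :: "'k::comm_ring_1 mpoly set"
  assumes "ideal I (mpoly_ring V)"
  shows "I = polys V \<longleftrightarrow> 1 \<in> I"
  using ideal_mpolyD(1)[OF assms] ideal_mpolyD(4)[OF assms, of _ 1] polys_one[of V] by auto

lemma genideal_mpoly_subset:
  fixes J :: "'k::comm_ring_1 mpoly set"
  assumes "ideal J (mpoly_ring V)" "S \<subseteq> J"
  shows "Idl\<^bsub>mpoly_ring V\<^esub> S \<subseteq> J"
  using assms ring.genideal_minimal[OF cring.axioms(1)[OF cring_mpoly_ring]] by blast

lemma genideal_mpoly:
  fixes S :: "'k::comm_ring_1 mpoly set"
  assumes "S \<subseteq> polys V"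
  shows "ideal (Idl\<^bsub>mpoly_ring V\<^esub> S) (mpoly_ring V)" "S \<subseteq> Idl\<^bsub>mpoly_ring V\<^esub> S"
  using ring.genideal_ideal[OF cring.axioms(1)[OF cring_mpoly_ring] assms]
    ring.genideal_self[OF cring.axioms(1)[OF cring_mpoly_ring] assms] by auto

lemma ideal_add_principal:
  fixes J :: "'k::comm_ring_1 mpoly set"
  assumes "ideal J (mpoly_ring V)" "a \<in> polys V"
  shows "ideal {j + a * r | j r. j \<in> J \<and> r \<in> polys V} (mpoly_ring V)"
proof (rule ideal_mpolyI)
  show "0 \<in> {j + a * r | j r. j \<in> J \<and> r \<in> polys V}"
    using ideal_mpolyD(2)[OF assms(1)] polys_zero by force
  show "{j + a * r | j r. j \<in> J \<and> r \<in> polys V} \<subseteq> polys V"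
    using ideal_mpolyD(1)[OF assms(1)] assms(2) by (auto intro!: polys_closed)
next
  fix x y assume "x \<in> {j + a * r | j r. j \<in> J \<and> r \<in> polys V}"
    "y \<in> {j + a * r | j r. j \<in> J \<and> r \<in> polys V}"
  then obtain j r k s where "x = j + a * r" "y = k + a * s" "j \<in> J" "k \<in> J" "r \<in> polys V" "s \<in> polys V"
    by blast
  then show "x + y \<in> {j + a * r | j r. j \<in> J \<and> r \<in> polys V}"
    by (intro CollectI exI[of _ "j + k"] exI[of _ "r + s"])
      (auto simp: algebra_simps intro: ideal_mpolyD[OF assms(1)] polys_closed)
next
  fix p x :: "'k mpoly" assume p: "p \<in> polys V" and "x \<in> {j + a * r | j r. j \<in> J \<and> r \<in> polys V}"
  then obtain j r where "x = j + a * r" "j \<in> J" "r \<in> polys V"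
    by blast
  with p show "p * x \<in> {j + a * r | j r. j \<in> J \<and> r \<in> polys V}"
    by (intro CollectI exI[of _ "p * j"] exI[of _ "p * r"])
      (auto simp: algebra_simps intro: ideal_mpolyD[OF assms(1)] polys_closed)
qed

section \<open>Homogeneous components and coefficients with respect to one variable\<close>

lemma poly_mapping_sum_single:
  fixes f :: "'a \<Rightarrow>\<^sub>0 'b::comm_monoid_add"
  assumes "finite A" "Poly_Mapping.keys f \<subseteq> A"
  shows "f = (\<Sum>m\<in>A. Poly_Mapping.single m (Poly_Mapping.lookup f m))"
  using assms
  by (intro poly_mapping_eqI) (auto simp: lookup_sum lookup_single when_def sum.delta in_keys_iff)

text \<open>Reduces identities that are additive in a polynomial to the case of a single
  term.\<close>

lemma poly_mapping_additive_induct [case_names zero single add]: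
  fixes f :: "'a \<Rightarrow>\<^sub>0 'b::comm_monoid_add"
  assumes "P 0" "\<And>m c. P (Poly_Mapping.single m c)" "\<And>f g. P f \<Longrightarrow> P g \<Longrightarrow> P (f + g)"
  shows "P f"
proof -
  have "P (\<Sum>m\<in>A. Poly_Mapping.single m (Poly_Mapping.lookup f m))" for A
    by (induction A rule: infinite_finite_induct) (use assms in auto)
  then show ?thesis
    using poly_mapping_sum_single[of "Poly_Mapping.keys f" f] by (metis finite_keys order_refl)
qed

lemma lookup_hom_component:
  "Poly_Mapping.lookup (hom_component t f) m = (Poly_Mapping.lookup f m when mon_degree m = t)"
  by (auto simp: hom_component_def lookup_sum lookup_single when_def sum.delta in_keys_iff)

text \<open>Subtraction of exponents is truncated; removing \<open>y ^ i\<close> can be undone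
  exactly because the exponent of \<open>y\<close> is required to equal \<open>i\<close>.\<close>

lemma minus_single_eq_iff:
  fixes x m :: mon
  shows "Poly_Mapping.lookup x j = i \<and> x - Poly_Mapping.single j i = m \<longleftrightarrow>
    Poly_Mapping.lookup m j = 0 \<and> x = m + Poly_Mapping.single j i"
proof safe
  show "x = x - Poly_Mapping.single j (Poly_Mapping.lookup x j) + Poly_Mapping.single j (Poly_Mapping.lookup x j)"
    by (rule poly_mapping_eqI) (auto simp: lookup_add lookup_minus lookup_single when_def)
qed (auto simp: lookup_add lookup_minus lookup_single)

lemma lookup_y_coeff:
  "Poly_Mapping.lookup (y_coeff j i f) m =
     (Poly_Mapping.lookup f (m + Poly_Mapping.single j i) when Poly_Mapping.lookup m j = 0)"
proof -
  have eq: "x - Poly_Mapping.single j i = m \<longleftrightarrow>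
      Poly_Mapping.lookup m j = 0 \<and> x = m + Poly_Mapping.single j i"
    if "Poly_Mapping.lookup x j = i" for x
    using that minus_single_eq_iff[of x j i m] by simp
  have fin: "finite {m \<in> Poly_Mapping.keys f. Poly_Mapping.lookup m j = i}"
    by simp
  have "Poly_Mapping.lookup (y_coeff j i f) m =
      (\<Sum>x\<in>{x \<in> Poly_Mapping.keys f. Poly_Mapping.lookup x j = i}.
        if m + Poly_Mapping.single j i = x then
          (Poly_Mapping.lookup f x when Poly_Mapping.lookup m j = 0) else 0)"
    unfolding y_coeff_def lookup_sum
    by (rule sum.cong) (auto simp: lookup_single when_def eq)
  also have "\<dots> = (Poly_Mapping.lookup f (m + Poly_Mapping.single j i) when Poly_Mapping.lookup m j = 0)"
    unfolding sum.delta'[OF fin]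
    by (auto simp: when_def in_keys_iff lookup_add)
  finally show ?thesis .
qed

lemma mon_degree_alt: "finite A \<Longrightarrow> Poly_Mapping.keys m \<subseteq> A \<Longrightarrow> mon_degree m = (\<Sum>i\<in>A. Poly_Mapping.lookup m i)"
  unfolding mon_degree_def by (rule sum.mono_neutral_left) (auto simp: in_keys_iff)

lemma mon_degree_add: "mon_degree (a + b) = mon_degree a + mon_degree b"
proof -
  let ?A = "Poly_Mapping.keys a \<union> Poly_Mapping.keys b"
  have "Poly_Mapping.keys (a + b) \<subseteq> ?A" by (rule keys_add)
  then show ?thesis
    using mon_degree_alt[of ?A a] mon_degree_alt[of ?A b] mon_degree_alt[of ?A "a + b"]
    by (simp add: lookup_add sum.distrib)
qed

lemma mon_degree_single [simp]: "mon_degree (Poly_Mapping.single j i) = i"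
  by (cases "i = 0") (auto simp: mon_degree_def)

lemma mon_degree_zero [simp]: "mon_degree 0 = 0"
  by (simp add: mon_degree_def)

lemma mon_degree_eq_0_iff: "mon_degree m = 0 \<longleftrightarrow> m = 0"
  by (auto simp: mon_degree_def in_keys_iff intro!: poly_mapping_eqI)

lemma hom_component_add: "hom_component t (f + g) = hom_component t f + hom_component t g"
  by (rule poly_mapping_eqI) (auto simp: lookup_hom_component lookup_add when_def)

lemma hom_component_diff: "hom_component t (f - g) = hom_component t f - hom_component t g"
  for f g :: "'k::comm_ring_1 mpoly"
  by (rule poly_mapping_eqI) (auto simp: lookup_hom_component lookup_minus when_def)

lemma hom_component_zero [simp]: "hom_component t 0 = 0"
  by (rule poly_mapping_eqI) (auto simp: lookup_hom_component)

lemma hom_component_single: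
  "hom_component t (Poly_Mapping.single m c) = (if mon_degree m = t then Poly_Mapping.single m c else 0)"
  by (rule poly_mapping_eqI) (auto simp: lookup_hom_component lookup_single when_def)

lemma y_coeff_add: "y_coeff j i (f + g) = y_coeff j i f + y_coeff j i g"
  by (rule poly_mapping_eqI) (auto simp: lookup_y_coeff lookup_add when_def)

lemma y_coeff_diff: "y_coeff j i (f - g) = y_coeff j i f - y_coeff j i g"
  for f g :: "'k::comm_ring_1 mpoly"
  by (rule poly_mapping_eqI) (auto simp: lookup_y_coeff lookup_minus when_def)

lemma y_coeff_zero [simp]: "y_coeff j i 0 = 0"
  by (rule poly_mapping_eqI) (auto simp: lookup_y_coeff)

lemma y_coeff_single:
  "y_coeff j i (Poly_Mapping.single m c) =
     (if Poly_Mapping.lookup m j = i then Poly_Mapping.single (m - Poly_Mapping.single j i) c else 0)"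
proof (rule poly_mapping_eqI)
  fix x
  have eq: "m = x + Poly_Mapping.single j i \<and> Poly_Mapping.lookup x j = 0 \<longleftrightarrow>
     Poly_Mapping.lookup m j = i \<and> m - Poly_Mapping.single j i = x"
    using minus_single_eq_iff[of m j i x] by blast
  show "Poly_Mapping.lookup (y_coeff j i (Poly_Mapping.single m c)) x = Poly_Mapping.lookup
     (if Poly_Mapping.lookup m j = i then Poly_Mapping.single (m - Poly_Mapping.single j i) c else 0) x"
    using eq by (auto simp: lookup_y_coeff lookup_single when_def)
qed

text \<open>Both sides are additive in \<open>f\<close> and in \<open>g\<close>, and for two single
  terms at most one summand is nonzero.\<close>

lemma hom_component_mult:
  "hom_component t (f * g) = (\<Sum>a\<le>t. hom_component a f * hom_component (t - a) g)"
proof (induction f rule: poly_mapping_additive_induct)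
  case (single m c)
  show ?case
  proof (induction g rule: poly_mapping_additive_induct)
    case (single n d)
    have "(\<Sum>a\<le>t. hom_component a (Poly_Mapping.single m c) * hom_component (t - a) (Poly_Mapping.single n d))
      = (\<Sum>a\<le>t. if mon_degree m = a then
          (if mon_degree n = t - a then Poly_Mapping.single (m + n) (c * d) else 0) else 0)"
      by (rule sum.cong) (auto simp: hom_component_single mult_single)
    then show ?case
      by (auto simp: hom_component_single mult_single mon_degree_add)
  qed (auto simp: hom_component_add algebra_simps sum.distrib)
qed (auto simp: hom_component_add algebra_simps sum.distrib)

lemma y_coeff_mult:
  "y_coeff j t (f * g) = (\<Sum>a\<le>t. y_coeff j a f * y_coeff j (t - a) g)"
proof (induction f rule: poly_mapping_additive_induct)
  case (single m c)
  show ?case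
  proof (induction g rule: poly_mapping_additive_induct)
    case (single n d)
    have minus: "m + n - Poly_Mapping.single j t =
        m - Poly_Mapping.single j (Poly_Mapping.lookup m j) + (n - Poly_Mapping.single j (Poly_Mapping.lookup n j))"
      if "t = Poly_Mapping.lookup m j + Poly_Mapping.lookup n j"
      using that by (intro poly_mapping_eqI) (auto simp: lookup_add lookup_minus lookup_single when_def)
    have "(\<Sum>a\<le>t. y_coeff j a (Poly_Mapping.single m c) * y_coeff j (t - a) (Poly_Mapping.single n d))
      = (\<Sum>a\<le>t. if Poly_Mapping.lookup m j = a then
          (if Poly_Mapping.lookup n j = t - a then
            Poly_Mapping.single (m - Poly_Mapping.single j a + (n - Poly_Mapping.single j (t - a))) (c * d)
          else 0) else 0)"
      by (rule sum.cong) (auto simp: y_coeff_single mult_single)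
    then show ?case
      using minus by (auto simp: y_coeff_single mult_single lookup_add)
  qed (auto simp: y_coeff_add algebra_simps sum.distrib)
qed (auto simp: y_coeff_add algebra_simps sum.distrib)

lemma var_power: "var j ^ i = Poly_Mapping.single (Poly_Mapping.single j i) 1"
  by (induction i) (auto simp: var_def mult_single simp flip: single_add)

lemma lookup_mon_notin: "Poly_Mapping.keys m \<subseteq> V - {j} \<Longrightarrow> Poly_Mapping.lookup m j = 0"
  by (auto simp: in_keys_iff)

lemma y_coeff_polys_without:
  assumes "f \<in> polys (V - {j})"
  shows "y_coeff j i f = (if i = 0 then f else 0)"
proof (rule poly_mapping_eqI)
  fix m
  have "Poly_Mapping.lookup f x = 0" if "Poly_Mapping.lookup x j \<noteq> 0" for x
    using assms lookup_mon_notin[of x V j] that unfolding polys_iff by (meson in_keys_iff)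
  then show "Poly_Mapping.lookup (y_coeff j i f) m = Poly_Mapping.lookup (if i = 0 then f else 0) m"
    by (auto simp: lookup_y_coeff when_def lookup_add)
qed

lemma y_coeff_var_power: "y_coeff j i (var j ^ n) = (if i = n then 1 else 0)"
  by (auto simp: var_power y_coeff_single)

lemma y_coeff_mult_var_power:
  assumes "f \<in> polys (V - {j})"
  shows "y_coeff j i (f * var j ^ n) = (if i = n then f else 0)"
proof -
  have "y_coeff j i (f * var j ^ n) = (\<Sum>a\<le>i. if 0 = a then (if i - a = n then f else 0) else 0)"
    unfolding y_coeff_mult
    by (rule sum.cong) (auto simp: y_coeff_polys_without[OF assms] y_coeff_var_power)
  then show ?thesis
    by simp
qed

lemma y_coeff_in_polys:
  assumes "f \<in> polys V" shows "y_coeff j i f \<in> polys (V - {j})"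
  unfolding polys_iff
proof
  fix m assume "m \<in> Poly_Mapping.keys (y_coeff j i f)"
  then have m: "Poly_Mapping.lookup m j = 0" "m + Poly_Mapping.single j i \<in> Poly_Mapping.keys f"
    by (auto simp: in_keys_iff lookup_y_coeff)
  then have *: "Poly_Mapping.keys (m + Poly_Mapping.single j i) \<subseteq> V"
    using assms by (auto simp: polys_iff)
  have "Poly_Mapping.keys m \<subseteq> Poly_Mapping.keys (m + Poly_Mapping.single j i)"
    by (auto simp: in_keys_iff lookup_add)
  with * m(1) show "Poly_Mapping.keys m \<subseteq> V - {j}"
    by (auto simp: in_keys_iff)
qed

lemma hom_component_in_polys: "f \<in> polys V \<Longrightarrow> hom_component t f \<in> polys V"
  by (auto simp: polys_iff in_keys_iff lookup_hom_component)

lemma hom_component_in_graded_piece: "f \<in> polys V \<Longrightarrow> hom_component t f \<in> graded_piece V t"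
  by (auto simp: graded_piece_def hom_component_in_polys in_keys_iff lookup_hom_component)

lemma hom_component_graded_piece:
  assumes "f \<in> graded_piece V t"
  shows "hom_component s f = (if s = t then f else 0)"
  using assms by (intro poly_mapping_eqI) (auto simp: graded_piece_def lookup_hom_component when_def in_keys_iff)

lemma sum_hom_components:
  assumes "\<And>m. m \<in> Poly_Mapping.keys f \<Longrightarrow> mon_degree m \<le> N"
  shows "f = (\<Sum>t\<le>N. hom_component t f)"
  using assms by (intro poly_mapping_eqI) (auto simp: lookup_sum lookup_hom_component when_def in_keys_iff)

lemma exists_degree_bound: "\<exists>N. \<forall>m\<in>Poly_Mapping.keys f. mon_degree m \<le> N"
  by (rule exI[of _ "Max (mon_degree ` Poly_Mapping.keys f)"]) auto

lemma graded_piece_closed: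
  fixes f g :: "'k::comm_ring_1 mpoly"
  assumes "f \<in> graded_piece V t" "g \<in> graded_piece V t"
  shows "f + g \<in> graded_piece V t" "f - g \<in> graded_piece V t"
proof -
  have "Poly_Mapping.keys (f - g) \<subseteq> Poly_Mapping.keys f \<union> Poly_Mapping.keys g"
    by (auto simp: in_keys_iff lookup_minus)
  with assms keys_add[of f g] show "f + g \<in> graded_piece V t" "f - g \<in> graded_piece V t"
    by (auto simp: graded_piece_def intro: polys_add polys_diff)
qed

lemma graded_piece_mult:
  fixes f g :: "'k::comm_ring_1 mpoly"
  assumes "f \<in> graded_piece V t" "g \<in> graded_piece V s"
  shows "f * g \<in> graded_piece V (t + s)"
proof -
  have "mon_degree m = t + s" if m: "m \<in> Poly_Mapping.keys (f * g)" for m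
  proof -
    obtain a b where "a \<in> Poly_Mapping.keys f" "b \<in> Poly_Mapping.keys g" "m = a + b"
      using m keys_mult[of f g] by blast
    then show ?thesis using assms by (simp add: graded_piece_def mon_degree_add)
  qed
  then show ?thesis using assms by (simp add: graded_piece_def polys_mult)
qed

lemma hom_component_mult_graded:
  assumes "a \<in> graded_piece V d" "d \<le> t"
  shows "hom_component t (a * r) = a * hom_component (t - d) r"
proof -
  have "hom_component t (a * r) = (\<Sum>i\<le>t. if d = i then a * hom_component (t - i) r else 0)"
    unfolding hom_component_mult
    by (rule sum.cong) (auto simp: hom_component_graded_piece[OF assms(1)])
  then show ?thesis using assms(2) by simp
qed

text \<open>Extracting the coefficient of \<open>y ^ i\<close> lowers the degree by
  \<open>i\<close>; this is the source of the shift \<open>t - i\<close> in the Hilbert function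
  recursion.\<close>

lemma y_coeff_hom_component:
  "y_coeff j i (hom_component t f) = (if i \<le> t then hom_component (t - i) (y_coeff j i f) else 0)"
  by (rule poly_mapping_eqI)
    (auto simp: lookup_y_coeff lookup_hom_component when_def mon_degree_add)

section \<open>Leading coefficient ideals\<close>

text \<open>The degree in \<open>y\<close> is bounded by \<open>i\<close> instead of being equal to
  it, so that 0 belongs to the set and sums of leading coefficients may cancel.\<close>

definition y_leading :: "nat \<Rightarrow> 'k::comm_ring_1 mpoly set \<Rightarrow> nat \<Rightarrow> 'k mpoly set" where
  "y_leading j I i = {y_coeff j i f | f. f \<in> I \<and> (\<forall>l>i. y_coeff j l f = 0)}"

lemma y_coeff_above_degree: "y_degree j f < l \<Longrightarrow> y_coeff j l f = 0"
proof (rule poly_mapping_eqI)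
  fix m assume l: "y_degree j f < l"
  have "x \<notin> Poly_Mapping.keys f" if "Poly_Mapping.lookup x j = l" for x
  proof
    assume "x \<in> Poly_Mapping.keys f"
    then have "l \<le> y_degree j f"
      unfolding y_degree_def using that by (intro Max_ge) auto
    then show False using l by simp
  qed
  then show "Poly_Mapping.lookup (y_coeff j l f) m = Poly_Mapping.lookup 0 m"
    by (auto simp: lookup_y_coeff when_def in_keys_iff lookup_add)
qed

lemma y_coeffs_eq_zero: "(\<And>i. y_coeff j i f = 0) \<Longrightarrow> f = 0"
  using y_expansion[of f j] by simp

lemma y_degree_eqI:
  assumes "y_coeff j i f \<noteq> 0" "\<And>l. l > i \<Longrightarrow> y_coeff j l f = 0"
  shows "y_degree j f = i"
proof (rule antisym)
  show "i \<le> y_degree j f"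
    using assms(1) y_coeff_above_degree[of j f i] by force
  have "Poly_Mapping.lookup x j \<le> i" if x: "x \<in> Poly_Mapping.keys f" for x
  proof (rule ccontr)
    assume "\<not> ?thesis"
    then have "y_coeff j (Poly_Mapping.lookup x j) f = 0"
      using assms(2) by simp
    then have "Poly_Mapping.lookup (y_coeff j (Poly_Mapping.lookup x j) f)
        (x - Poly_Mapping.single j (Poly_Mapping.lookup x j)) = 0"
      by simp
    then show False
      using x minus_single_eq_iff[of x j "Poly_Mapping.lookup x j" "x - Poly_Mapping.single j (Poly_Mapping.lookup x j)"]
      by (auto simp: lookup_y_coeff in_keys_iff)
  qed
  then show "y_degree j f \<le> i"
    unfolding y_degree_def by (intro Max.boundedI) auto
qed

lemma y_coeff_y_degree_nonzero:
  assumes "f \<noteq> 0"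
  shows "y_coeff j (y_degree j f) f \<noteq> 0"
proof -
  let ?P = "\<lambda>i. y_coeff j i f \<noteq> 0"
  have bound: "\<And>i. ?P i \<Longrightarrow> i \<le> y_degree j f"
    using y_coeff_above_degree[of j f] by (meson not_le)
  have ex: "\<exists>i. ?P i"
    using y_coeffs_eq_zero[of j f] assms by blast
  have "?P (Greatest ?P)"
    using ex bound by (rule GreatestI_ex_nat)
  moreover have "y_coeff j l f = 0" if "l > Greatest ?P" for l
    using Greatest_le_nat[of ?P l, OF _ bound] that by (meson not_le)
  ultimately show ?thesis
    using y_degree_eqI[of j "Greatest ?P" f] by simp
qed

lemma y_coeff_mult_without:
  assumes "p \<in> polys (V - {j})"
  shows "y_coeff j i (p * f) = p * y_coeff j i f"
proof -
  have "y_coeff j i (p * f) = (\<Sum>a\<le>i. if 0 = a then p * y_coeff j (i - a) f else 0)"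
    unfolding y_coeff_mult by (rule sum.cong) (auto simp: y_coeff_polys_without[OF assms])
  then show ?thesis by simp
qed

lemma y_coeff_shift:
  "y_coeff j i (f * var j ^ n) = (if n \<le> i then y_coeff j (i - n) f else 0)"
proof -
  have "y_coeff j i (f * var j ^ n) = (\<Sum>a\<le>i. if i - n = a then (if n \<le> i then y_coeff j a f else 0) else 0)"
    unfolding y_coeff_mult by (rule sum.cong) (auto simp: y_coeff_var_power)
  then show ?thesis by simp
qed

lemma y_coeff_mult_top:
  assumes "\<And>l. l > a \<Longrightarrow> y_coeff j l f = 0" "\<And>l. l > b \<Longrightarrow> y_coeff j l g = 0"
  shows "y_coeff j (a + b) (f * g) = y_coeff j a f * y_coeff j b g"
    and "l > a + b \<Longrightarrow> y_coeff j l (f * g) = 0"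
proof -
  have "y_coeff j (a + b) (f * g) = (\<Sum>i\<le>a + b. if a = i then y_coeff j i f * y_coeff j (a + b - i) g else 0)"
    unfolding y_coeff_mult
  proof (rule sum.cong)
    fix i
    have "y_coeff j i f = 0 \<or> y_coeff j (a + b - i) g = 0" if "i \<noteq> a"
      using that assms(1)[of i] assms(2)[of "a + b - i"] by (cases "i > a") auto
    then show "y_coeff j i f * y_coeff j (a + b - i) g =
        (if a = i then y_coeff j i f * y_coeff j (a + b - i) g else 0)"
      by auto
  qed simp
  then show "y_coeff j (a + b) (f * g) = y_coeff j a f * y_coeff j b g"
    by simp
  show "y_coeff j l (f * g) = 0" if "l > a + b"
    unfolding y_coeff_mult
  proof (rule sum.neutral, rule ballI)
    fix i
    have "y_coeff j i f = 0 \<or> y_coeff j (l - i) g = 0"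
      using that assms(1)[of i] assms(2)[of "l - i"] by (cases "i > a") auto
    then show "y_coeff j i f * y_coeff j (l - i) g = 0"
      by auto
  qed
qed

lemma y_coeff_power_top:
  assumes "\<And>l. l > b \<Longrightarrow> y_coeff j l f = 0"
  shows "y_coeff j (b * k) (f ^ k) = y_coeff j b f ^ k \<and> (\<forall>l>b * k. y_coeff j l (f ^ k) = 0)"
proof (induction k)
  case 0
  show ?case
    using y_coeff_var_power[of j _ 0, where 'a = 'a] by auto
next
  case (Suc k)
  then show ?case
    using y_coeff_mult_top[of b j f "b * k" "f ^ k"] assms by auto
qed

lemma ideal_y_leading:
  assumes "ideal I (mpoly_ring V)"
  shows "ideal (y_leading j I i) (mpoly_ring (V - {j}))"
proof (rule ideal_mpolyI)
  show "y_leading j I i \<subseteq> polys (V - {j})"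
    using ideal_mpolyD(1)[OF assms] y_coeff_in_polys by (fastforce simp: y_leading_def)
  show "0 \<in> y_leading j I i"
    unfolding y_leading_def using ideal_mpolyD(2)[OF assms] by (intro CollectI exI[of _ 0]) simp
next
  fix a b assume "a \<in> y_leading j I i" "b \<in> y_leading j I i"
  then obtain f g where "a = y_coeff j i f" "b = y_coeff j i g" "f \<in> I" "g \<in> I"
    "\<forall>l>i. y_coeff j l f = 0" "\<forall>l>i. y_coeff j l g = 0"
    unfolding y_leading_def by blast
  then show "a + b \<in> y_leading j I i"
    unfolding y_leading_def using ideal_mpolyD(3)[OF assms]
    by (intro CollectI exI[of _ "f + g"]) (simp add: y_coeff_add)
next
  fix p a :: "'a mpoly" assume p: "p \<in> polys (V - {j})" and "a \<in> y_leading j I i"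
  then obtain f where "a = y_coeff j i f" "f \<in> I" "\<forall>l>i. y_coeff j l f = 0"
    unfolding y_leading_def by blast
  moreover have "p \<in> polys V"
    using p polys_mono[of "V - {j}" V] by blast
  ultimately show "p * a \<in> y_leading j I i"
    unfolding y_leading_def using ideal_mpolyD(4)[OF assms]
    by (intro CollectI exI[of _ "p * f"]) (simp add: y_coeff_mult_without[OF p])
qed

text \<open>Multiplying a witness by \<open>y\<close> keeps its leading coefficient and raises the
  index by one.\<close>

lemma y_leading_Suc:
  assumes "ideal I (mpoly_ring V)" "j \<in> V"
  shows "y_leading j I i \<subseteq> y_leading j I (Suc i)"
proof
  fix a assume "a \<in> y_leading j I i"
  then obtain f where "a = y_coeff j i f" "f \<in> I" "\<forall>l>i. y_coeff j l f = 0"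
    unfolding y_leading_def by blast
  then show "a \<in> y_leading j I (Suc i)"
    unfolding y_leading_def using ideal_mpolyD(5)[OF assms(1) polys_var[OF assms(2)]]
      y_coeff_shift[of j _ f 1]
    by (intro CollectI exI[of _ "f * var j"]) simp
qed

lemma y_leading_mono_index:
  assumes "ideal I (mpoly_ring V)" "j \<in> V" "a \<le> b"
  shows "y_leading j I a \<subseteq> y_leading j I b"
  using assms(3) y_leading_Suc[OF assms(1,2)] by (rule lift_Suc_mono_le[rotated])

lemma y_leading_mono: "I \<subseteq> J \<Longrightarrow> y_leading j I i \<subseteq> y_leading j J i"
  by (auto simp: y_leading_def)

text \<open>Induction on a bound for the \<open>y\<close>-degree: the leading coefficient of an
  element of \<open>J\<close> is also that of some element of \<open>I\<close>, and subtracting the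
  latter lowers the bound.\<close>

lemma ideal_eqI_y_leading:
  assumes I: "ideal I (mpoly_ring V)" and J: "ideal J (mpoly_ring V)"
    and "I \<subseteq> J" and L: "\<And>i. y_leading j J i \<subseteq> y_leading j I i"
  shows "I = J"
proof -
  have "f \<in> I" if "f \<in> J" "\<forall>l\<ge>b. y_coeff j l f = 0" for f b
    using that
  proof (induction b arbitrary: f)
    case 0
    then show ?case using y_coeffs_eq_zero[of j f] ideal_mpolyD(2)[OF I] by simp
  next
    case (Suc b)
    then have "y_coeff j b f \<in> y_leading j J b"
      unfolding y_leading_def by (intro CollectI exI[of _ f]) simp
    then obtain g where g: "y_coeff j b f = y_coeff j b g" "g \<in> I" "\<forall>l>b. y_coeff j l g = 0"
      using L[of b] unfolding y_leading_def by blast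
    have "y_coeff j l (f - g) = 0" if "b \<le> l" for l
      using g Suc.prems that by (cases "l = b") (auto simp: y_coeff_diff)
    moreover have "f - g \<in> J"
      using Suc.prems(1) g(2) assms(3) ideal_mpolyD(7)[OF J] by blast
    ultimately have "f - g \<in> I"
      using Suc.IH by blast
    then show ?case
      using ideal_mpolyD(3)[OF I, of "f - g" g] g(2) by simp
  qed
  moreover have "\<forall>l\<ge>Suc (y_degree j f). y_coeff j l f = 0" for f :: "'a mpoly"
    using y_coeff_above_degree[of j f] by simp
  ultimately show ?thesis using assms(3) by blast
qed

text \<open>Monotonicity of \<open>D\<close> is what closes the set under multiplication by powers
  of \<open>y\<close>. The lemma serves to bound a generated ideal coefficientwise by inspecting its
  generators only.\<close>

lemma ideal_y_coeffs:
  fixes D :: "nat \<Rightarrow> 'k::comm_ring_1 mpoly set"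
  assumes D: "\<And>i. ideal (D i) (mpoly_ring (V - {j}))" and mono: "\<And>a b. a \<le> b \<Longrightarrow> D a \<subseteq> D b"
  shows "ideal {h \<in> polys V. \<forall>i. y_coeff j i h \<in> D i} (mpoly_ring V)"
proof (rule ideal_mpolyI)
  fix p h :: "'k mpoly" assume p: "p \<in> polys V" and h: "h \<in> {h \<in> polys V. \<forall>i. y_coeff j i h \<in> D i}"
  have "y_coeff j a p * y_coeff j (i - a) h \<in> D i" for i a
  proof (rule ideal_mpolyD(4)[OF D y_coeff_in_polys[OF p]])
    show "y_coeff j (i - a) h \<in> D i"
      using h mono[of "i - a" i] by auto
  qed
  then show "p * h \<in> {h \<in> polys V. \<forall>i. y_coeff j i h \<in> D i}"
    using p h by (auto simp: y_coeff_mult intro!: polys_mult ideal_mpolyD(8)[OF D])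
qed (auto intro: polys_closed ideal_mpolyD[OF D] simp: y_coeff_add)

text \<open>The equation for the ideal of initial \<open>y\<close>-forms is read off coefficient by
  coefficient. On its left side the coefficients of \<open>y ^ i\<close> are the elements of
  \<open>L i\<close>. On its right side, \<open>C\<close> and \<open>N\<close> have
  \<open>y\<close>-free generators, so all coefficients of their elements lie in the contractions,
  while \<open>y\<close> itself generates everything except coefficients of \<open>y ^ 0\<close>.
  Thus only \<open>N\<close> is visible at \<open>i = 0\<close> and only \<open>C\<close> at
  \<open>i > 0\<close>.\<close>

lemma gvd_y_leading:
  fixes I :: "'k::comm_ring_1 mpoly set"
  assumes I: "ideal I (mpoly_ring V)" and gvd: "geometric_vertex_decomposition V j r G I"
  shows "ideal (contraction V j (C_ideal V j G)) (mpoly_ring (V - {j}))" (is "ideal ?C _")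
    and "ideal (contraction V j (N_ideal V j G)) (mpoly_ring (V - {j}))" (is "ideal ?N _")
    and "contraction V j (N_ideal V j G) \<subseteq> contraction V j (C_ideal V j G)"
    and "y_leading j I 0 = contraction V j (N_ideal V j G)"
    and "i > 0 \<Longrightarrow> y_leading j I i = contraction V j (C_ideal V j G)"
proof -
  note gvd' = gvd[unfolded geometric_vertex_decomposition_def groebner_basis_def]
  have jV: "j \<in> V" and G: "G \<subseteq> polys V"
    and eq: "in_y_ideal V j I =
       C_ideal V j G \<inter> (N_ideal V j G <+>\<^bsub>mpoly_ring V\<^esub> Idl\<^bsub>mpoly_ring V\<^esub> {var j})"
    using gvd' ideal_mpolyD(1)[OF I] by auto
  let ?Y = "Idl\<^bsub>mpoly_ring V\<^esub> {var j :: 'k mpoly}"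
  have VV: "polys (V - {j}) \<subseteq> polys V"
    by (rule polys_mono) auto
  have contr: "ideal (contraction V j J) (mpoly_ring (V - {j}))"
    if J: "ideal J (mpoly_ring V)" for J :: "'k mpoly set"
    unfolding contraction_def using VV
    by (intro ideal_mpolyI) (auto intro: ideal_mpolyD[OF J] polys_closed)
  have lc: "y_lead_coeff j ` G \<subseteq> polys (V - {j})"
    using G y_coeff_in_polys by (fastforce simp: y_lead_coeff_def)
  have gens: "ideal (Idl\<^bsub>mpoly_ring V\<^esub> (y_lead_coeff j ` H)) (mpoly_ring V)"
      "y_lead_coeff j ` H \<subseteq> Idl\<^bsub>mpoly_ring V\<^esub> (y_lead_coeff j ` H)" if "H \<subseteq> G" for H
    using genideal_mpoly[of "y_lead_coeff j ` H" V] lc VV that by blast+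
  have coeffs: "y_coeff j i h \<in> contraction V j (Idl\<^bsub>mpoly_ring V\<^esub> (y_lead_coeff j ` H))"
    if "H \<subseteq> G" "h \<in> Idl\<^bsub>mpoly_ring V\<^esub> (y_lead_coeff j ` H)" for H h i
  proof -
    let ?D = "contraction V j (Idl\<^bsub>mpoly_ring V\<^esub> (y_lead_coeff j ` H))"
    have D: "ideal ?D (mpoly_ring (V - {j}))"
      by (rule contr[OF gens(1)[OF that(1)]])
    have "Idl\<^bsub>mpoly_ring V\<^esub> (y_lead_coeff j ` H) \<subseteq> {h \<in> polys V. \<forall>i. y_coeff j i h \<in> ?D}"
    proof (rule genideal_mpoly_subset[OF ideal_y_coeffs], rule D)
      show "y_lead_coeff j ` H \<subseteq> {h \<in> polys V. \<forall>i. y_coeff j i h \<in> ?D}"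
      proof
        fix q assume q: "q \<in> y_lead_coeff j ` H"
        then have "q \<in> polys (V - {j})" "q \<in> ?D"
          using lc that(1) gens(2)[OF that(1)] by (auto simp: contraction_def)
        then show "q \<in> {h \<in> polys V. \<forall>i. y_coeff j i h \<in> ?D}"
          using VV ideal_mpolyD(2)[OF D] y_coeff_polys_without[of q V j] by auto
      qed
    qed simp
    then show ?thesis using that(2) by blast
  qed
  have C: "ideal (C_ideal V j G) (mpoly_ring V)" and N: "ideal (N_ideal V j G) (mpoly_ring V)"
    unfolding C_ideal_def N_ideal_def by (rule gens(1), simp)+
  show C': "ideal ?C (mpoly_ring (V - {j}))" and N': "ideal ?N (mpoly_ring (V - {j}))"
    using contr C N by auto
  have NC: "N_ideal V j G \<subseteq> C_ideal V j G"
    unfolding N_ideal_def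
    by (rule genideal_mpoly_subset[OF C]) (use gens(2)[of G] in \<open>auto simp: C_ideal_def\<close>)
  then show NC': "?N \<subseteq> ?C"
    by (auto simp: contraction_def)
  have Y: "ideal ?Y (mpoly_ring V)" "var j \<in> ?Y"
    using genideal_mpoly[of "{var j}" V] polys_var[OF jV] by auto
  have Y0: "y_coeff j 0 h = 0" if "h \<in> ?Y" for h
  proof -
    \<comment> \<open>A multiple of \<open>y\<close> has no constant coefficient and arbitrary other
      ones; these coefficient ideals are increasing.\<close>
    let ?D = "\<lambda>i::nat. if i = 0 then {0} else polys (V - {j}) :: 'k mpoly set"
    have "?Y \<subseteq> {h \<in> polys V. \<forall>i. y_coeff j i h \<in> ?D i}"
    proof (rule genideal_mpoly_subset[OF ideal_y_coeffs])
      show "ideal (?D i) (mpoly_ring (V - {j}))" for i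
        by (auto intro!: ideal_mpolyI polys_closed)
      show "{var j} \<subseteq> {h \<in> polys V. \<forall>i. y_coeff j i h \<in> ?D i}"
        using polys_var[OF jV] y_coeff_var_power[of j _ 1, where 'a = 'k] by (auto intro: polys_closed)
    qed (auto intro: polys_closed)
    from subsetD[OF this that] have "\<forall>i. y_coeff j i h \<in> ?D i"
      by simp
    then have "y_coeff j 0 h \<in> ?D 0" by (rule spec)
    then show ?thesis by simp
  qed
  have set_add: "x \<in> N_ideal V j G <+>\<^bsub>mpoly_ring V\<^esub> ?Y \<longleftrightarrow>
      (\<exists>a\<in>N_ideal V j G. \<exists>b\<in>?Y. x = a + b)" for x
    by (auto simp: set_add_def' mpoly_ring_def)
  have in_y: "in_y_ideal V j I \<subseteq> {h \<in> polys V. \<forall>i. y_coeff j i h \<in> y_leading j I i}"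
    unfolding in_y_ideal_def
  proof (rule genideal_mpoly_subset[OF ideal_y_coeffs])
    show "in_y j ` I \<subseteq> {h \<in> polys V. \<forall>i. y_coeff j i h \<in> y_leading j I i}"
    proof safe
      fix f i assume f: "f \<in> I"
      then have q: "y_lead_coeff j f \<in> polys (V - {j})"
        using ideal_mpolyD(1)[OF I] y_coeff_in_polys unfolding y_lead_coeff_def by blast
      then show "in_y j f \<in> polys V"
        unfolding in_y_def using VV jV by (auto intro!: polys_closed)
      have "y_lead_coeff j f \<in> y_leading j I (y_degree j f)"
        using f y_coeff_above_degree[of j f] unfolding y_leading_def y_lead_coeff_def by auto
      then show "y_coeff j i (in_y j f) \<in> y_leading j I i"
        unfolding in_y_def y_coeff_mult_var_power[OF q]
        using ideal_mpolyD(2)[OF ideal_y_leading[OF I]] by auto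
    qed
  qed (use ideal_y_leading[OF I] y_leading_mono_index[OF I jV] in auto)
  have in_y_genI: "in_y j f \<in> in_y_ideal V j I" if "f \<in> I" for f
  proof -
    have "in_y j f \<in> polys V" if "f \<in> I" for f
      unfolding in_y_def y_lead_coeff_def using ideal_mpolyD(1)[OF I] VV that y_coeff_in_polys[of f V j] jV
      by (intro polys_mult polys_power polys_var) auto
    then show ?thesis
      unfolding in_y_ideal_def using genideal_mpoly(2)[of "in_y j ` I" V] that by blast
  qed
  have lead: "\<alpha> * var j ^ i \<in> in_y_ideal V j I" if \<alpha>: "\<alpha> \<in> y_leading j I i" for \<alpha> i
  \<comment> \<open>A witness for \<open>\<alpha> = 0\<close> may have \<open>y\<close>-degree below
    \<open>i\<close>, so its initial form says nothing about
    \<open>\<alpha> * var j ^ i\<close>.\<close>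
  proof (cases "\<alpha> = 0")
    case True
    have "ideal (in_y_ideal V j I) (mpoly_ring V)"
      unfolding in_y_ideal_def
    proof (rule genideal_mpoly(1))
      show "in_y j ` I \<subseteq> polys V"
        unfolding in_y_def y_lead_coeff_def using ideal_mpolyD(1)[OF I] VV y_coeff_in_polys[of _ V j] jV
        by (auto intro!: polys_mult polys_power polys_var)
    qed
    then show ?thesis using True ideal_mpolyD(2) by auto
  next
    case False
    obtain f where f: "f \<in> I" "\<alpha> = y_coeff j i f" "\<forall>l>i. y_coeff j l f = 0"
      using \<alpha> unfolding y_leading_def by blast
    then have "y_degree j f = i" using False y_degree_eqI[of j i f] by auto
    then have "in_y j f = \<alpha> * var j ^ i" using f by (simp add: in_y_def y_lead_coeff_def)
    then show ?thesis using in_y_genI[OF f(1)] by simp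
  qed
  have \<alpha>V: "y_leading j I i \<subseteq> polys (V - {j})" for i
    by (rule ideal_mpolyD(1)[OF ideal_y_leading[OF I]])
  show "y_leading j I 0 = ?N"
  proof safe
    fix \<alpha> assume \<alpha>: "\<alpha> \<in> y_leading j I 0"
    have "\<alpha> \<in> N_ideal V j G <+>\<^bsub>mpoly_ring V\<^esub> ?Y"
      using lead[OF \<alpha>] eq by auto
    then obtain a b where "a \<in> N_ideal V j G" "b \<in> ?Y" "\<alpha> = a + b"
      using set_add by blast
    then have "y_coeff j 0 \<alpha> = y_coeff j 0 a" "y_coeff j 0 a \<in> ?N"
      using Y0 coeffs[of "{g \<in> G. y_degree j g = 0}"] by (auto simp: y_coeff_add N_ideal_def)
    then show "\<alpha> \<in> ?N"
      using y_coeff_polys_without[of \<alpha> V j 0] subsetD[OF \<alpha>V \<alpha>] by simp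
  next
    fix \<alpha> assume \<alpha>: "\<alpha> \<in> ?N"
    then have "\<alpha> \<in> in_y_ideal V j I"
      unfolding eq using NC set_add ideal_mpolyD(2)[OF Y(1)] by (force simp: contraction_def)
    then have "y_coeff j 0 \<alpha> \<in> y_leading j I 0"
      using in_y by auto
    then show "\<alpha> \<in> y_leading j I 0"
      using y_coeff_polys_without[of \<alpha> V j 0] \<alpha> by (auto simp: contraction_def)
  qed
  show "y_leading j I i = ?C" if i: "i > 0"
  proof safe
    fix \<alpha> assume \<alpha>: "\<alpha> \<in> y_leading j I i"
    have "\<alpha> * var j ^ i \<in> C_ideal V j G"
      using lead[OF \<alpha>] eq by auto
    then have "y_coeff j i (\<alpha> * var j ^ i) \<in> ?C"
      using coeffs[of G] by (simp add: C_ideal_def)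
    then show "\<alpha> \<in> ?C"
      using y_coeff_mult_var_power[of \<alpha> V j i i] subsetD[OF \<alpha>V \<alpha>] by simp
  next
    fix \<alpha> assume \<alpha>: "\<alpha> \<in> ?C"
    then have \<alpha>': "\<alpha> \<in> polys (V - {j})" "\<alpha> \<in> C_ideal V j G"
      by (auto simp: contraction_def)
    have "\<alpha> * var j ^ i \<in> ?Y"
      using ideal_mpolyD(4)[OF Y(1) _ Y(2), of "\<alpha> * var j ^ (i - 1)"] \<alpha>'(1) VV jV i
      by (cases i) (auto intro!: polys_closed simp: mult_ac)
    then have "\<alpha> * var j ^ i \<in> N_ideal V j G <+>\<^bsub>mpoly_ring V\<^esub> ?Y"
      unfolding set_add using ideal_mpolyD(2)[OF N] by force
    moreover have "\<alpha> * var j ^ i \<in> C_ideal V j G"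
      using ideal_mpolyD(5)[OF C _ \<alpha>'(2)] polys_power[OF polys_var[OF jV]] by blast
    ultimately have "\<alpha> * var j ^ i \<in> in_y_ideal V j I"
      unfolding eq by blast
    then have "y_coeff j i (\<alpha> * var j ^ i) \<in> y_leading j I i"
      using in_y by auto
    then show "\<alpha> \<in> y_leading j I i"
      using y_coeff_mult_var_power[OF \<alpha>'(1), of i i] by simp
  qed
qed

section \<open>Radicality from the leading coefficient ideals\<close>

definition radical_ideal :: "nat set \<Rightarrow> 'k::comm_ring_1 mpoly set \<Rightarrow> bool" where
  "radical_ideal V I \<longleftrightarrow> (\<forall>f\<in>polys V. \<forall>k. f ^ k \<in> I \<longrightarrow> f \<in> I)"

lemma diff_power_mem_ideal:
  fixes I :: "'k::comm_ring_1 mpoly set"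
  assumes I: "ideal I (mpoly_ring V)" and "f \<in> polys V" "g \<in> I"
  shows "(f - g) ^ k - f ^ k \<in> I"
proof (induction k)
  case 0
  show ?case using ideal_mpolyD(2)[OF I] by simp
next
  case (Suc k)
  have "f - g \<in> polys V"
    using assms ideal_mpolyD(1)[OF I] by (auto intro: polys_diff)
  then have "((f - g) ^ k - f ^ k) * (f - g) - f ^ k * g \<in> I"
    using ideal_mpolyD(7)[OF I ideal_mpolyD(5)[OF I _ Suc] ideal_mpolyD(4)[OF I polys_power]] assms(2,3)
    by blast
  then show ?case by (simp add: algebra_simps)
qed

text \<open>If \<open>f ^ k\<close> lies in \<open>I\<close>, then the \<open>k\<close>-th power of
  the leading coefficient of \<open>f\<close> is a leading coefficient of \<open>I\<close>.
  Radicality of \<open>L b\<close> gives an element of \<open>I\<close> that agrees with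
  \<open>f\<close> in its top coefficient. Subtracting it keeps the \<open>k\<close>-th power in
  \<open>I\<close> and lowers the \<open>y\<close>-degree.\<close>

lemma radical_ideal_y_leading:
  fixes I :: "'k::comm_ring_1 mpoly set"
  assumes I: "ideal I (mpoly_ring V)"
    and rad: "\<And>i. radical_ideal (V - {j}) (y_leading j I i)"
    and const: "\<And>i. i > 0 \<Longrightarrow> y_leading j I i = y_leading j I 1"
  shows "radical_ideal V I"
  unfolding radical_ideal_def
proof safe
  fix f :: "'k mpoly" and k assume f: "f \<in> polys V" "f ^ k \<in> I"
  show "f \<in> I"
  \<comment> \<open>For \<open>k = 0\<close> the assumption says that 1 lies in
    \<open>I\<close>.\<close>
  proof (cases "k = 0")
    case True
    then show ?thesis using f ideal_eq_polys_iff[OF I] by simp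
  next
    case k: False
    have "f \<in> I" if "f \<in> polys V" "f ^ k \<in> I" "\<forall>l\<ge>b. y_coeff j l f = 0" for f b
      using that
    proof (induction b arbitrary: f)
      case 0
      then show ?case using y_coeffs_eq_zero[of j f] ideal_mpolyD(2)[OF I] by simp
    next
      case (Suc b)
      have "y_coeff j b f ^ k \<in> y_leading j I (b * k)"
        unfolding y_leading_def using Suc.prems y_coeff_power_top[of b j f]
        by (intro CollectI exI[of _ "f ^ k"]) auto
      \<comment> \<open>The indices \<open>b * k\<close> and \<open>b\<close> are both zero or both
        positive because \<open>k > 0\<close>, so the two leading coefficient ideals
        coincide.\<close>
      then have "y_coeff j b f ^ k \<in> y_leading j I b"
        using k const[of b] const[of "b * k"] by (cases "b = 0") auto
      then have "y_coeff j b f \<in> y_leading j I b"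
        using rad[of b] y_coeff_in_polys[OF Suc.prems(1)] unfolding radical_ideal_def by blast
      then obtain g where g: "y_coeff j b f = y_coeff j b g" "g \<in> I" "\<forall>l>b. y_coeff j l g = 0"
        unfolding y_leading_def by blast
      have "y_coeff j l (f - g) = 0" if "b \<le> l" for l
        using g Suc.prems that by (cases "l = b") (auto simp: y_coeff_diff)
      moreover have "(f - g) ^ k \<in> I"
        using ideal_mpolyD(3)[OF I diff_power_mem_ideal[OF I Suc.prems(1) g(2), of k] Suc.prems(2)] by simp
      moreover have "f - g \<in> polys V"
        using Suc.prems(1) g(2) ideal_mpolyD(1)[OF I] by (auto intro: polys_diff)
      ultimately have "f - g \<in> I"
        using Suc.IH by blast
      then show ?case
        using ideal_mpolyD(3)[OF I, of "f - g" g] g(2) by simp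
    qed
    moreover have "\<forall>l\<ge>Suc (y_degree j f). y_coeff j l f = 0"
      using y_coeff_above_degree[of j f] by simp
    ultimately show ?thesis using f by blast
  qed
qed

section \<open>Monomial bases and Hilbert functions\<close>

lemma lookup_const_mult: "Poly_Mapping.lookup (const c * f) m = c * Poly_Mapping.lookup f m"
proof (induction f rule: poly_mapping_additive_induct)
  case (single n d)
  then show ?case by (auto simp: const_def mult_single lookup_single when_def)
qed (auto simp: algebra_simps lookup_add)

text \<open>Scalars act through constant polynomials; this gives access to the exchange bound on
  independent sets.\<close>

interpretation mpoly_vs: vector_space "\<lambda>(c::'k::field) (p::'k mpoly). const c * p"
  by unfold_locales (auto simp: const_def mult_single single_add algebra_simps simp flip: mult.assoc)

definition degree_monomials :: "nat set \<Rightarrow> nat \<Rightarrow> mon set" where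
  "degree_monomials V t = {m \<in> monomials V. mon_degree m = t}"

text \<open>The classes of the monomials in \<open>S\<close> form a basis of the image of the degree
  \<open>t\<close> part in the quotient by \<open>I\<close>. Bases made of monomials can be recorded
  as finite sets of exponents and shifted by powers of a variable.\<close>

definition mon_basis :: "nat set \<Rightarrow> 'k::comm_ring_1 mpoly set \<Rightarrow> nat \<Rightarrow> mon set \<Rightarrow> bool" where
  "mon_basis V I t S \<longleftrightarrow> S \<subseteq> degree_monomials V t \<and>
     (\<forall>f\<in>I. Poly_Mapping.keys f \<subseteq> S \<longrightarrow> f = 0) \<and>
     (\<forall>f\<in>graded_piece V t. \<exists>g. Poly_Mapping.keys g \<subseteq> S \<and> f - g \<in> I)"

definition hf :: "nat set \<Rightarrow> 'k::field mpoly set \<Rightarrow> nat \<Rightarrow> nat" where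
  "hf V I t = card (SOME S. mon_basis V I t S)"

text \<open>A monomial in the variables \<open>V\<close> is determined by its restricted exponent
  function, of which there are \<open>N ^ card V\<close> below the bound.\<close>

lemma bounded_monomials:
  assumes "finite V"
  shows "finite {m \<in> monomials V. \<forall>i\<in>V. Poly_Mapping.lookup m i < N}"
    and "card {m \<in> monomials V. \<forall>i\<in>V. Poly_Mapping.lookup m i < N} \<le> N ^ card V"
proof -
  let ?M = "{m \<in> monomials V. \<forall>i\<in>V. Poly_Mapping.lookup m i < N}"
  let ?F = "Pi\<^sub>E V (\<lambda>_. {..<N})"
  have inj: "inj_on (\<lambda>m. restrict (Poly_Mapping.lookup m) V) ?M"
  proof (rule inj_onI, rule poly_mapping_eqI)
    fix a b i assume ab: "a \<in> ?M" "b \<in> ?M"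
      "restrict (Poly_Mapping.lookup a) V = restrict (Poly_Mapping.lookup b) V"
    show "Poly_Mapping.lookup a i = Poly_Mapping.lookup b i"
    proof (cases "i \<in> V")
      case True
      then show ?thesis using fun_cong[OF ab(3), of i] by simp
    next
      case False
      then have "i \<notin> Poly_Mapping.keys a" "i \<notin> Poly_Mapping.keys b"
        using ab by (auto simp: monomials_def)
      then show ?thesis by (simp add: in_keys_iff)
    qed
  qed
  have sub: "(\<lambda>m. restrict (Poly_Mapping.lookup m) V) ` ?M \<subseteq> ?F"
    by auto
  have fin: "finite ?F"
    using assms by (intro finite_PiE) auto
  show "finite ?M"
    by (rule inj_on_finite[OF inj sub fin])
  have "card ?M \<le> card ?F"
    by (rule card_inj_on_le[OF inj sub fin])
  then show "card ?M \<le> N ^ card V"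
    using assms by (simp add: card_PiE)
qed

lemma lookup_le_mon_degree: "Poly_Mapping.lookup m i \<le> mon_degree m"
proof (cases "i \<in> Poly_Mapping.keys m")
  case True
  then show ?thesis unfolding mon_degree_def by (rule member_le_sum) auto
qed (simp add: in_keys_iff)

lemma finite_degree_monomials: "finite V \<Longrightarrow> finite (degree_monomials V t)"
  by (rule finite_subset[OF _ bounded_monomials(1)[of V "Suc t"]])
    (auto simp: degree_monomials_def less_Suc_eq_le lookup_le_mon_degree)

lemma graded_piece_iff: "f \<in> graded_piece V t \<longleftrightarrow> Poly_Mapping.keys f \<subseteq> degree_monomials V t"
  by (auto simp: graded_piece_def degree_monomials_def mpoly_ring_def)

lemma mon_basisD:
  assumes "mon_basis V I t S"
  shows "S \<subseteq> degree_monomials V t" "\<And>f. f \<in> I \<Longrightarrow> Poly_Mapping.keys f \<subseteq> S \<Longrightarrow> f = 0"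
    "\<And>f. f \<in> graded_piece V t \<Longrightarrow> \<exists>g. Poly_Mapping.keys g \<subseteq> S \<and> f - g \<in> I"
  using assms by (auto simp: mon_basis_def)

lemma keys_const_mult: "Poly_Mapping.keys (const c * f) \<subseteq> Poly_Mapping.keys f"
  by (auto simp: in_keys_iff lookup_const_mult)

lemma keys_sum_subset:
  assumes "\<And>i. i \<in> A \<Longrightarrow> Poly_Mapping.keys (f i) \<subseteq> S"
  shows "Poly_Mapping.keys (sum f A) \<subseteq> S"
  using assms
proof (induction A rule: infinite_finite_induct)
  case (insert x A)
  then show ?case using keys_add[of "f x" "sum f A"] by auto
qed auto

lemma keys_diff_subset:
  fixes f g :: "'k::comm_ring_1 mpoly"
  shows "Poly_Mapping.keys f \<subseteq> S \<Longrightarrow> Poly_Mapping.keys g \<subseteq> S \<Longrightarrow> Poly_Mapping.keys (f - g) \<subseteq> S"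
  by (auto simp: in_keys_iff lookup_minus) (metis in_keys_iff subsetD diff_0_right)

lemma single_eq_const_mult: "Poly_Mapping.single m c = const c * Poly_Mapping.single m 1"
  by (simp add: const_def mult_single)

lemma inj_single_one: "inj_on (\<lambda>m. Poly_Mapping.single m (1::'k::field)) S"
  by (rule inj_onI) (metis lookup_single_eq lookup_single_not_eq zero_neq_one)

text \<open>A maximal set of degree \<open>t\<close> monomials that is independent modulo
  \<open>I\<close> also spans, since a further monomial would create a relation involving
  it.\<close>

lemma ex_mon_basis:
  fixes I :: "'k::field mpoly set"
  assumes V: "finite V" and I: "ideal I (mpoly_ring V)"
  shows "\<exists>S. mon_basis V I t S"
proof -
  define indep where "indep S \<longleftrightarrow> (\<forall>f\<in>I. Poly_Mapping.keys f \<subseteq> S \<longrightarrow> f = 0)" for S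
  let ?F = "{S. S \<subseteq> degree_monomials V t \<and> indep S}"
  have ne: "?F \<noteq> {}"
    by (auto simp: indep_def intro!: exI[of _ "{}"])
  have "finite ?F"
    using finite_degree_monomials[OF V] by simp
  from finite_has_maximal[OF this ne] obtain S where S: "S \<in> ?F" and max: "\<forall>T\<in>?F. S \<subseteq> T \<longrightarrow> S = T"
    by (elim bexE)
  have mon: "\<exists>g. Poly_Mapping.keys g \<subseteq> S \<and> Poly_Mapping.single m 1 - g \<in> I"
    if m: "m \<in> degree_monomials V t" for m
  proof (cases "m \<in> S")
    case True
    then show ?thesis using ideal_mpolyD(2)[OF I]
      by (intro exI[of _ "Poly_Mapping.single m 1"]) auto
  next
    case False
    then have "\<not> indep (insert m S)"
      using bspec[OF max, of "insert m S"] S m by blast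
    then obtain h where h: "h \<in> I" "Poly_Mapping.keys h \<subseteq> insert m S" "h \<noteq> 0"
      unfolding indep_def by blast
    let ?c = "Poly_Mapping.lookup h m"
    have c: "?c \<noteq> 0"
    proof
      assume "?c = 0"
      then have "Poly_Mapping.keys h \<subseteq> S"
        using h(2) by (auto simp: in_keys_iff)
      then show False using S h unfolding indep_def by blast
    qed
    \<comment> \<open>Normalising the relation to coefficient 1 at \<open>m\<close> and solving for
      that monomial.\<close>
    let ?g = "Poly_Mapping.single m 1 - const (inverse ?c) * h"
    have "Poly_Mapping.keys ?g \<subseteq> S"
    proof
      fix x assume "x \<in> Poly_Mapping.keys ?g"
      then have "Poly_Mapping.lookup ?g x \<noteq> 0" by (simp add: in_keys_iff)
      then have "x \<noteq> m" "x \<in> Poly_Mapping.keys h"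
        using c by (auto simp: lookup_minus lookup_const_mult lookup_single when_def in_keys_iff split: if_splits)
      then show "x \<in> S" using h(2) by blast
    qed
    moreover have "Poly_Mapping.single m 1 - ?g \<in> I"
      using ideal_mpolyD(4)[OF I polys_const h(1)] by simp
    ultimately show ?thesis by blast
  qed
  then obtain G where G: "\<And>m. m \<in> degree_monomials V t \<Longrightarrow>
      Poly_Mapping.keys (G m) \<subseteq> S \<and> Poly_Mapping.single m 1 - G m \<in> I"
    by metis
  have "\<exists>g. Poly_Mapping.keys g \<subseteq> S \<and> f - g \<in> I" if f: "f \<in> graded_piece V t" for f
  proof -
    let ?D = "degree_monomials V t"
    let ?g = "\<Sum>m\<in>?D. const (Poly_Mapping.lookup f m) * G m"
    have "f = (\<Sum>m\<in>?D. const (Poly_Mapping.lookup f m) * Poly_Mapping.single m 1)"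
      using poly_mapping_sum_single[OF finite_degree_monomials[OF V, of t], of f] f
      by (simp add: graded_piece_iff flip: single_eq_const_mult)
    then have "f - ?g = (\<Sum>m\<in>?D. const (Poly_Mapping.lookup f m) * (Poly_Mapping.single m 1 - G m))"
      by (metis (no_types, lifting) right_diff_distrib sum.cong sum_subtractf)
    also have "\<dots> \<in> I"
      using G by (intro ideal_mpolyD(8)[OF I] ideal_mpolyD(4)[OF I] polys_const) auto
    finally have "f - ?g \<in> I" .
    moreover have "Poly_Mapping.keys ?g \<subseteq> S"
      using G keys_const_mult by (intro keys_sum_subset) blast
    ultimately show ?thesis by blast
  qed
  then show ?thesis
    using S unfolding mon_basis_def indep_def by blast
qed

lemma independent_singles:
  "mpoly_vs.independent ((\<lambda>m. Poly_Mapping.single m (1::'k::field)) ` S)"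
  unfolding mpoly_vs.independent_explicit_module
proof (intro allI impI)
  fix T and u :: "'k mpoly \<Rightarrow> 'k" and v
  assume T: "finite T" "T \<subseteq> (\<lambda>m. Poly_Mapping.single m 1) ` S" "(\<Sum>v\<in>T. const (u v) * v) = 0" "v \<in> T"
  then obtain m where m: "v = Poly_Mapping.single m 1" by blast
  have "0 = Poly_Mapping.lookup (\<Sum>v\<in>T. const (u v) * v) m"
    using T by simp
  also have "\<dots> = (\<Sum>w\<in>T. if v = w then u w else 0)"
    unfolding lookup_sum
  proof (rule sum.cong)
    fix w assume "w \<in> T"
    then obtain x where x: "w = Poly_Mapping.single x 1" using T(2) by blast
    show "Poly_Mapping.lookup (const (u w) * w) m = (if v = w then u w else 0)"
      unfolding lookup_const_mult x m by (auto simp: lookup_single when_def)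
         (metis lookup_single_eq lookup_single_not_eq zero_neq_one)+
  qed simp
  also have "\<dots> = u v" using T by simp
  finally show "u v = 0" by simp
qed

text \<open>Replacing each \<open>b\<close> by a representative \<open>p b\<close> supported on
  \<open>S\<close> turns congruences modulo \<open>I\<close> into equations, since \<open>S\<close>
  is independent modulo \<open>I\<close>. The monomials in \<open>S\<close> then lie in the span of
  the \<open>p b\<close>, and the exchange bound applies.\<close>

lemma card_mon_basis_le:
  fixes I :: "'k::field mpoly set"
  assumes I: "ideal I (mpoly_ring V)" and S: "mon_basis V I t S" and B: "finite B" "B \<subseteq> graded_piece V t"
    and span: "\<And>f. f \<in> graded_piece V t \<Longrightarrow> \<exists>c. f - (\<Sum>b\<in>B. const (c b) * b) \<in> I"
  shows "card S \<le> card B"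
proof -
  obtain p where p: "\<And>b. b \<in> B \<Longrightarrow> Poly_Mapping.keys (p b) \<subseteq> S \<and> b - p b \<in> I"
    using mon_basisD(3)[OF S] B(2) by (metis subsetD)
  let ?s = "\<lambda>m. Poly_Mapping.single m (1::'k)"
  have sub: "?s ` S \<subseteq> mpoly_vs.span (p ` B)"
  proof safe
    fix m assume m: "m \<in> S"
    then have "?s m \<in> graded_piece V t"
      using mon_basisD(1)[OF S] by (auto simp: graded_piece_iff)
    then obtain c where c: "?s m - (\<Sum>b\<in>B. const (c b) * b) \<in> I"
      using span by blast
    have "(\<Sum>b\<in>B. const (c b) * (b - p b)) \<in> I"
      using p by (intro ideal_mpolyD(8)[OF I] ideal_mpolyD(4)[OF I] polys_const) auto
    with c have "?s m - (\<Sum>b\<in>B. const (c b) * p b) \<in> I"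
      using ideal_mpolyD(3)[OF I c, of "\<Sum>b\<in>B. const (c b) * (b - p b)"]
      by (simp add: algebra_simps sum_subtractf)
    moreover have "Poly_Mapping.keys (?s m - (\<Sum>b\<in>B. const (c b) * p b)) \<subseteq> S"
      using p keys_const_mult m by (intro keys_diff_subset keys_sum_subset) fastforce+
    ultimately have "?s m = (\<Sum>b\<in>B. const (c b) * p b)"
      using mon_basisD(2)[OF S] by fastforce
    then show "?s m \<in> mpoly_vs.span (p ` B)"
      by (simp only:) (intro mpoly_vs.span_sum mpoly_vs.span_scale mpoly_vs.span_base imageI)
  qed
  have "card S = card (?s ` S)"
    by (rule card_image[symmetric, OF inj_single_one])
  also have "\<dots> \<le> card (p ` B)"
    using mpoly_vs.independent_span_bound[OF _ independent_singles sub] B(1) by simp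
  also have "\<dots> \<le> card B"
    using B(1) by (rule card_image_le)
  finally show ?thesis .
qed

lemma mon_basis_imp_spanning:
  assumes V: "finite V" and S: "mon_basis V I t S" and f: "f \<in> graded_piece V t"
  shows "\<exists>c. f - (\<Sum>b\<in>(\<lambda>m. Poly_Mapping.single m (1::'k::field)) ` S. const (c b) * b) \<in> I"
proof -
  let ?s = "\<lambda>m. Poly_Mapping.single m (1::'k)"
  obtain g where g: "Poly_Mapping.keys g \<subseteq> S" "f - g \<in> I"
    using mon_basisD(3)[OF S f] by blast
  have "finite S"
    using mon_basisD(1)[OF S] finite_degree_monomials[OF V] finite_subset by blast
  then have "g = (\<Sum>m\<in>S. const (Poly_Mapping.lookup g m) * ?s m)"
    using poly_mapping_sum_single[of S g] g(1) by (simp flip: single_eq_const_mult)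
  also have "\<dots> = (\<Sum>m\<in>S. const (Poly_Mapping.lookup g (the_inv_into S ?s (?s m))) * ?s m)"
    by (intro sum.cong refl) (subst the_inv_into_f_f[OF inj_single_one], auto)
  also have "\<dots> = (\<Sum>b\<in>?s ` S. const (Poly_Mapping.lookup g (the_inv_into S ?s b)) * b)"
    by (subst sum.reindex[OF inj_single_one]) simp
  finally have eq: "g = (\<Sum>b\<in>?s ` S. const (Poly_Mapping.lookup g (the_inv_into S ?s b)) * b)" .
  show ?thesis
    by (rule exI, rule subst[where P = "\<lambda>x. f - x \<in> I", OF eq g(2)])
qed

lemma hf_eq_card:
  fixes I :: "'k::field mpoly set"
  assumes V: "finite V" and I: "ideal I (mpoly_ring V)" and S: "mon_basis V I t S"
  shows "hf V I t = card S"
proof -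
  let ?s = "\<lambda>m. Poly_Mapping.single m (1::'k)"
  have *: "card S \<le> card T" if S: "mon_basis V I t S" and T: "mon_basis V I t T" for S T
  proof -
    have fin: "finite T"
      using mon_basisD(1)[OF T] finite_degree_monomials[OF V] finite_subset by blast
    have "card S \<le> card (?s ` T)"
      by (rule card_mon_basis_le[OF I S])
        (use fin mon_basisD(1)[OF T] mon_basis_imp_spanning[OF V T] in \<open>auto simp: graded_piece_iff\<close>)
    then show ?thesis
      using card_image_le[OF fin, of ?s] by simp
  qed
  have "mon_basis V I t (SOME S. mon_basis V I t S)"
    using S by (rule someI)
  then show ?thesis
    unfolding hf_def using * S by (simp add: antisym)
qed

lemma hf_le:
  fixes I :: "'k::field mpoly set"
  assumes "finite V" "ideal I (mpoly_ring V)" "finite B" "B \<subseteq> graded_piece V t"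
    "\<And>f. f \<in> graded_piece V t \<Longrightarrow> \<exists>c. f - (\<Sum>b\<in>B. const (c b) * b) \<in> I"
  shows "hf V I t \<le> card B"
  using ex_mon_basis[OF assms(1,2), of t] hf_eq_card[OF assms(1,2)] card_mon_basis_le[OF assms(2) _ assms(3-5)]
  by metis

lemma hf_polys:
  assumes "finite V"
  shows "hf V (polys V :: 'k::field mpoly set) t = 0"
proof -
  have "ideal (polys V :: 'k mpoly set) (mpoly_ring V)"
    by (rule ring.oneideal[OF cring.axioms(1)[OF cring_mpoly_ring]])
  moreover have "mon_basis V (polys V :: 'k mpoly set) t {}"
    by (auto simp: mon_basis_def graded_piece_def intro!: exI[of _ 0])
  ultimately show ?thesis
    using hf_eq_card[OF assms, of "polys V" t "{}"] by simp
qed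

text \<open>Independence is checked on the top \<open>y\<close>-coefficient of an element of
  \<open>I\<close>, which lies in a leading coefficient ideal and is supported on the matching
  \<open>S i\<close>. Spanning follows by reducing the top coefficient modulo \<open>L b\<close> and
  descending in the \<open>y\<close>-degree.\<close>

lemma mon_basis_y_leading:
  fixes I :: "'k::field mpoly set"
  assumes I: "homogeneous_ideal V I" and j: "j \<in> V"
    and S: "\<And>i. i \<le> t \<Longrightarrow> mon_basis (V - {j}) (y_leading j I i) (t - i) (S i)"
  shows "mon_basis V I t (\<Union>i\<in>{..t}. (\<lambda>m. m + Poly_Mapping.single j i) ` S i)" (is "mon_basis V I t ?U")
proof -
  have I': "ideal I (mpoly_ring V)" and hom: "\<And>f s. f \<in> I \<Longrightarrow> hom_component s f \<in> I"
    using I by (auto simp: homogeneous_ideal_def)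
  note L = ideal_y_leading[OF I', of j]
  have Sj: "Poly_Mapping.lookup m j = 0" "mon_degree m = t - i" "Poly_Mapping.keys m \<subseteq> V - {j}"
    if "m \<in> S i" "i \<le> t" for m i
    using mon_basisD(1)[OF S[OF that(2)]] that(1)
    by (auto simp: degree_monomials_def monomials_def in_keys_iff subset_iff)
  have U: "?U \<subseteq> degree_monomials V t"
  proof safe
    fix m i assume "i \<le> t" "m \<in> S i"
    then show "m + Poly_Mapping.single j i \<in> degree_monomials V t"
      using Sj[of m i] keys_add[of m "Poly_Mapping.single j i"] j
      by (auto simp: degree_monomials_def monomials_def mon_degree_add split: if_splits)
  qed
  have indep: "f = 0" if f: "f \<in> I" "Poly_Mapping.keys f \<subseteq> ?U" for f
  proof (rule ccontr)
    assume "f \<noteq> 0"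
    let ?i = "y_degree j f"
    have "y_coeff j ?i f \<noteq> 0"
      by (rule y_coeff_y_degree_nonzero[OF \<open>f \<noteq> 0\<close>])
    have lead: "y_coeff j ?i f \<in> y_leading j I ?i"
      unfolding y_leading_def using f(1) y_coeff_above_degree[of j f] by blast
    have sub: "?i \<le> t \<and> Poly_Mapping.keys (y_coeff j ?i f) \<subseteq> S ?i"
    proof -
      have *: "?i \<le> t \<and> m \<in> S ?i" if m: "m \<in> Poly_Mapping.keys (y_coeff j ?i f)" for m
      proof -
        have m': "Poly_Mapping.lookup m j = 0" "m + Poly_Mapping.single j ?i \<in> Poly_Mapping.keys f"
          using m by (auto simp: in_keys_iff lookup_y_coeff)
        then obtain i x where x: "i \<le> t" "x \<in> S i" "m + Poly_Mapping.single j ?i = x + Poly_Mapping.single j i"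
          using f(2) by blast
        have "i = ?i"
          using arg_cong[OF x(3), of "\<lambda>m. Poly_Mapping.lookup m j"] m'(1) Sj(1)[OF x(2,1)]
          by (simp add: lookup_add)
        then show ?thesis using x by simp
      qed
      show ?thesis using * \<open>y_coeff j ?i f \<noteq> 0\<close> by (metis keys_eq_empty subsetI ex_in_conv)
    qed
    then have "y_coeff j ?i f = 0"
      using mon_basisD(2)[OF S lead] by blast
    then show False using \<open>y_coeff j ?i f \<noteq> 0\<close> by blast
  qed
  have spanning: "\<exists>g. Poly_Mapping.keys g \<subseteq> ?U \<and> f - g \<in> I" if "f \<in> graded_piece V t" for f
  proof -
    have "\<exists>g. Poly_Mapping.keys g \<subseteq> ?U \<and> f - g \<in> I"
      if "f \<in> graded_piece V t" "\<forall>l\<ge>b. y_coeff j l f = 0" for f b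
      using that
    proof (induction b arbitrary: f)
      case 0
      then have "f = 0" using y_coeffs_eq_zero[of j f] by simp
      then show ?case using ideal_mpolyD(2)[OF I'] by (intro exI[of _ 0]) simp
    next
      case (Suc b)
      let ?a = "y_coeff j b f"
      have f: "f \<in> polys V" "hom_component t f = f"
        using Suc.prems(1) hom_component_graded_piece[OF Suc.prems(1), of t] by (auto simp: graded_piece_def)
      have a: "?a = (if b \<le> t then hom_component (t - b) ?a else 0)"
        using y_coeff_hom_component[of j b t f] f(2) by simp
      show ?case
      proof (cases "b \<le> t")
        case False
        \<comment> \<open>A coefficient of \<open>y ^ b\<close> with \<open>b > t\<close> vanishes
          for degree reasons.\<close>
        then have "y_coeff j l f = 0" if "b \<le> l" for l
          using a Suc.prems(2) that by (cases "l = b") auto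
        then show ?thesis using Suc.IH Suc.prems(1) by blast
      next
        case True
        then have "?a \<in> graded_piece (V - {j}) (t - b)"
          using a hom_component_in_graded_piece[OF y_coeff_in_polys[OF f(1)], of "t - b" j b] by simp
        then obtain s where s: "Poly_Mapping.keys s \<subseteq> S b" "?a - s \<in> y_leading j I b"
          using mon_basisD(3)[OF S[OF True]] by blast
        have s': "s \<in> graded_piece (V - {j}) (t - b)"
          using s(1) mon_basisD(1)[OF S[OF True]] by (auto simp: graded_piece_iff)
        then have sV: "s \<in> polys (V - {j})" by (simp add: graded_piece_def)
        obtain h where h: "?a - s = y_coeff j b h" "h \<in> I" "\<forall>l>b. y_coeff j l h = 0"
          using s(2) unfolding y_leading_def by blast
        \<comment> \<open>The witness \<open>h\<close> need not be homogeneous. Its degree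
          \<open>t\<close> component is still in \<open>I\<close> and has the same coefficient of
          \<open>y ^ b\<close>, as that coefficient is homogeneous of degree
          \<open>t - b\<close>.\<close>
        let ?h = "hom_component t h" and ?s = "s * var j ^ b"
        have hh: "y_coeff j b ?h = ?a - s" "\<forall>l>b. y_coeff j l ?h = 0"
        proof -
          show "y_coeff j b ?h = ?a - s"
            using True h(1) a hom_component_graded_piece[OF s', of "t - b"]
            by (simp add: y_coeff_hom_component flip: h(1)) (simp add: hom_component_diff)
          show "\<forall>l>b. y_coeff j l ?h = 0"
            using h(3) by (simp add: y_coeff_hom_component)
        qed
        have keys_s: "Poly_Mapping.keys ?s \<subseteq> ?U"
        proof
          fix m assume "m \<in> Poly_Mapping.keys ?s"
          then obtain x y where "x \<in> Poly_Mapping.keys s" "y \<in> Poly_Mapping.keys (var j ^ b :: 'k mpoly)" "m = x + y"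
            using keys_mult[of s "var j ^ b"] by blast
          then show "m \<in> ?U" using s(1) True by (auto simp: var_power)
        qed
        have gs: "?s \<in> graded_piece V t"
          using keys_s U unfolding graded_piece_iff by blast
        have gh: "?h \<in> graded_piece V t"
          using h(2) ideal_mpolyD(1)[OF I'] hom_component_in_graded_piece by blast
        let ?f = "f - ?h - ?s"
        have "?f \<in> graded_piece V t"
          using Suc.prems(1) gs gh by (intro graded_piece_closed)
        moreover have "y_coeff j l ?f = 0" if "b \<le> l" for l
          using that hh Suc.prems(2)
          by (cases "l = b") (auto simp: y_coeff_diff y_coeff_mult_var_power[OF sV])
        ultimately obtain g where g: "Poly_Mapping.keys g \<subseteq> ?U" "?f - g \<in> I"
          using Suc.IH by blast
        have "f - (g + ?s) = (?f - g) + ?h"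
          by simp
        also have "\<dots> \<in> I"
          using g(2) hom[OF h(2)] by (rule ideal_mpolyD(3)[OF I'])
        finally show ?thesis
          using keys_add[of g ?s] g(1) keys_s by blast
      qed
    qed
    moreover have "\<forall>l\<ge>Suc (y_degree j f). y_coeff j l f = 0"
      using y_coeff_above_degree[of j f] by simp
    ultimately show ?thesis using that by blast
  qed
  show ?thesis
    unfolding mon_basis_def by (intro conjI ballI impI U) (rule indep spanning; assumption)+
qed

lemma hf_y_leading:
  fixes I :: "'k::field mpoly set"
  assumes V: "finite V" and I: "homogeneous_ideal V I" and j: "j \<in> V"
  shows "hf V I t = (\<Sum>i\<le>t. hf (V - {j}) (y_leading j I i) (t - i))"
proof -
  have I': "ideal I (mpoly_ring V)"
    using I by (simp add: homogeneous_ideal_def)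
  have V': "finite (V - {j})" using V by simp
  note L = ideal_y_leading[OF I', of j]
  obtain S where S: "\<And>i. mon_basis (V - {j}) (y_leading j I i) (t - i) (S i)"
    using choice[of "\<lambda>i S. mon_basis (V - {j}) (y_leading j I i) (t - i) S"] ex_mon_basis[OF V' L] by blast
  have lookup_S: "Poly_Mapping.lookup m j = 0" if "m \<in> S i" for m i
    using mon_basisD(1)[OF S] that by (auto simp: degree_monomials_def monomials_def in_keys_iff subset_iff)
  have fin: "finite (S i)" for i
    using mon_basisD(1)[OF S] finite_degree_monomials[OF V'] finite_subset by blast
  let ?T = "\<lambda>i. (\<lambda>m. m + Poly_Mapping.single j i) ` S i"
  have lookup_T: "Poly_Mapping.lookup m j = i" if "m \<in> ?T i" for m i
    using that lookup_S by (auto simp: lookup_add)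
  have "hf V I t = card (\<Union>i\<in>{..t}. ?T i)"
    by (rule hf_eq_card[OF V I' mon_basis_y_leading[OF I j]]) (rule S)
  also have "\<dots> = (\<Sum>i\<le>t. card (?T i))"
  \<comment> \<open>The exponent of \<open>y\<close> tells the blocks apart.\<close>
  proof (intro card_UN_disjoint ballI impI)
    fix a b :: nat assume "a \<noteq> b"
    show "?T a \<inter> ?T b = {}"
    proof (rule equals0I)
      fix m assume "m \<in> ?T a \<inter> ?T b"
      from IntD1[OF this] IntD2[OF this] show False
        using lookup_T[of m a] lookup_T[of m b] \<open>a \<noteq> b\<close> by simp
    qed
  qed (use fin in auto)
  also have "\<dots> = (\<Sum>i\<le>t. card (S i))"
    by (intro sum.cong refl card_image inj_onI) simp
  also have "\<dots> = (\<Sum>i\<le>t. hf (V - {j}) (y_leading j I i) (t - i))"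
    by (intro sum.cong refl hf_eq_card[symmetric, OF V' L S])
  finally show ?thesis .
qed

section \<open>Comparison with the Hilbert function of the quotient ring\<close>

lemma coset_mpoly: "I +>\<^bsub>mpoly_ring V\<^esub> f = (\<lambda>i. i + f) ` I"
  by (auto simp: a_r_coset_def' mpoly_ring_def)

lemma coset_eq_iff:
  fixes I :: "'k::comm_ring_1 mpoly set"
  assumes I: "ideal I (mpoly_ring V)"
  shows "I +>\<^bsub>mpoly_ring V\<^esub> f = I +>\<^bsub>mpoly_ring V\<^esub> g \<longleftrightarrow> f - g \<in> I"
proof
  assume "I +>\<^bsub>mpoly_ring V\<^esub> f = I +>\<^bsub>mpoly_ring V\<^esub> g"
  then have "0 + f \<in> (\<lambda>i. i + g) ` I"
    using ideal_mpolyD(2)[OF I] unfolding coset_mpoly by blast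
  then show "f - g \<in> I" by auto
next
  assume fg: "f - g \<in> I"
  have "i + f \<in> (\<lambda>i. i + g) ` I" if "i \<in> I" for i
    using ideal_mpolyD(3)[OF I that fg] by (intro image_eqI[of _ _ "i + (f - g)"]) auto
  moreover have "i + g \<in> (\<lambda>i. i + f) ` I" if "i \<in> I" for i
    using ideal_mpolyD(7)[OF I that fg] by (intro image_eqI[of _ _ "i - (f - g)"]) auto
  ultimately show "I +>\<^bsub>mpoly_ring V\<^esub> f = I +>\<^bsub>mpoly_ring V\<^esub> g"
    unfolding coset_mpoly by blast
qed

lemma const_simps:
  "const (a + b) = const a + const b" "const (a * b) = const a * const b" "const 1 = 1" "const 0 = 0"
  "const (- a) = - const (a :: 'k::comm_ring_1)"
  by (auto simp: const_def mult_single single_add single_uminus)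

lemma subfield_const: "subfield (range const) (mpoly_ring V :: 'k::field mpoly ring)"
proof -
  let ?R = "mpoly_ring V :: 'k mpoly ring"
  interpret cring ?R by (rule cring_mpoly_ring)
  have inj: "const a = (0 :: 'k mpoly) \<longleftrightarrow> a = 0" for a
    by (metis const_def lookup_single_eq lookup_zero single_zero)
  show ?thesis
  proof (rule subfieldI)
    show "subcring (range const) ?R"
    proof (intro subcringI' subringI)
      fix h :: "'k mpoly" assume "h \<in> range const"
      then obtain c where c: "h = const c" by blast
      have "\<ominus>\<^bsub>?R\<^esub> h = - h"
        by (rule minus_equality)
          (use polys_const[of c V] polys_uminus[OF polys_const[of c V]] c in \<open>auto simp: mpoly_ring_def\<close>)
      then show "\<ominus>\<^bsub>?R\<^esub> h \<in> range const"
        using c const_simps(5)[of c] by (metis rangeI)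
    next
      show "range const \<subseteq> carrier ?R" using polys_const by auto
      show "\<one>\<^bsub>?R\<^esub> \<in> range const"
        using const_simps(3) by (auto simp: mpoly_ring_def intro: range_eqI[of _ _ 1])
    qed (auto simp: mpoly_ring_def simp flip: const_simps)
    show "Units (?R\<lparr>carrier := range const\<rparr>) = range const - {\<zero>\<^bsub>?R\<^esub>}"
    proof safe
      fix x :: "'k mpoly" assume "x \<in> Units (?R\<lparr>carrier := range const\<rparr>)"
      then show "x \<in> range const" by (auto simp: Units_def)
    next
      assume "\<zero>\<^bsub>?R\<^esub> \<in> Units (?R\<lparr>carrier := range const\<rparr>)"
      then show False by (auto simp: Units_def mpoly_ring_def)
    next
      fix c :: 'k assume "const c \<notin> Units (?R\<lparr>carrier := range const\<rparr>)"
      moreover have "const c \<in> Units (?R\<lparr>carrier := range const\<rparr>)" if "c \<noteq> 0"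
        using that unfolding Units_def mpoly_ring_def
        by (auto intro!: exI[of _ "inverse c"] simp: const_simps(3) simp flip: const_simps(2))
      ultimately show "const c = \<zero>\<^bsub>?R\<^esub>"
        using inj[of c] by (auto simp: mpoly_ring_def)
    qed
  qed
qed

text \<open>Properness makes the image of the constants a subfield of the quotient, and hence the
  dimension over it unique. The inductive notion of dimension is then met by adjoining the monomials
  of a monomial basis one at a time.\<close>

lemma hilbert_function_eq_hf:
  fixes I :: "'k::field mpoly set"
  assumes V: "finite V" and I: "ideal I (mpoly_ring V)" and proper: "I \<noteq> polys V"
  shows "hilbert_function V I t = hf V I t"
proof -
  let ?R = "mpoly_ring V :: 'k mpoly ring"
  let ?Q = "?R Quot I" and ?h = "\<lambda>f. I +>\<^bsub>?R\<^esub> f"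
  let ?K = "?h ` range const"
  interpret h: ring_hom_ring ?R ?Q ?h
    by (rule ideal.rcos_ring_hom_ring[OF I])
  have hadd: "?h f \<oplus>\<^bsub>?Q\<^esub> ?h g = ?h (f + g)" if "f \<in> polys V" "g \<in> polys V" for f g
    using h.hom_add[OF that] by (simp add: mpoly_ring_def)
  have hmult: "?h f \<otimes>\<^bsub>?Q\<^esub> ?h g = ?h (f * g)" if "f \<in> polys V" "g \<in> polys V" for f g
    using h.hom_mult[OF that] by (simp add: mpoly_ring_def)
  have h0: "\<zero>\<^bsub>?Q\<^esub> = ?h 0"
    using h.hom_zero by (simp add: mpoly_ring_def)
  have "\<one>\<^bsub>?Q\<^esub> \<noteq> \<zero>\<^bsub>?Q\<^esub>"
  proof
    assume "\<one>\<^bsub>?Q\<^esub> = \<zero>\<^bsub>?Q\<^esub>"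
    moreover have "\<one>\<^bsub>?Q\<^esub> = ?h 1"
      using h.hom_one by (simp add: mpoly_ring_def)
    ultimately have "1 - 0 \<in> I"
      unfolding h0 using coset_eq_iff[OF I] by metis
    then show False using proper ideal_eq_polys_iff[OF I] by simp
  qed
  then have K: "subfield ?K ?Q"
    by (rule h.img_is_subfield(2)[OF subfield_const])
  obtain S where S: "mon_basis V I t S"
    using ex_mon_basis[OF V I] by blast
  have finS: "finite S"
    using mon_basisD(1)[OF S] finite_degree_monomials[OF V] finite_subset by blast
  have SV: "Poly_Mapping.single m c \<in> polys V" if "m \<in> S" for m and c :: 'k
    using mon_basisD(1)[OF S] that by (intro polys_single) (auto simp: degree_monomials_def monomials_def)
  let ?E = "\<lambda>T. {f :: 'k mpoly. Poly_Mapping.keys f \<subseteq> T}"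
  have EV: "?E T \<subseteq> polys V" if "T \<subseteq> S" for T
  proof
    fix f :: "'k mpoly" assume "f \<in> ?E T"
    then have "f \<in> graded_piece V t"
      using that mon_basisD(1)[OF S] unfolding graded_piece_iff by auto
    then show "f \<in> polys V" by (simp add: graded_piece_def)
  qed
  have "h.S.dimension (card T) ?K (?h ` ?E T)" if "T \<subseteq> S" for T
    using finite_subset[OF that finS] that
  proof (induction T rule: finite_induct)
    case empty
    have "?E {} = {0}"
      by (simp only: subset_empty keys_eq_empty) simp
    then have "?h ` ?E {} = {\<zero>\<^bsub>?Q\<^esub>}"
      by (simp only: image_insert image_empty h0)
    then show ?case using h.S.dimension.zero_dim[of ?K] by (simp only: card.empty)
  next
    case (insert m T)
    let ?s = "Poly_Mapping.single m (1::'k)"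
    have m: "m \<in> S" "T \<subseteq> S" using insert by auto
    \<comment> \<open>The next monomial is independent of the earlier ones: a congruence would be an
      equation between polynomials supported on \<open>S\<close>, with different coefficients at
      \<open>m\<close>.\<close>
    have "?h ?s \<notin> ?h ` ?E T"
    proof
      assume "?h ?s \<in> ?h ` ?E T"
      then obtain f where f: "Poly_Mapping.keys f \<subseteq> T" "?s - f \<in> I"
        using coset_eq_iff[OF I, of ?s] by auto
      have "?s - f = 0"
        using f(1) m by (intro mon_basisD(2)[OF S f(2)] keys_diff_subset) auto
      then have "Poly_Mapping.lookup f m = 1"
        by (metis eq_iff_diff_eq_0 lookup_single_eq)
      then have "m \<in> Poly_Mapping.keys f"
        by (simp add: in_keys_iff)
      then show False using f(1) insert by blast
    qed
    then have "h.S.dimension (Suc (card T)) ?K (h.S.line_extension ?K (?h ?s) (?h ` ?E T))"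
      using insert SV[OF m(1)] by (intro h.S.dimension.Suc_dim) auto
    also have "h.S.line_extension ?K (?h ?s) (?h ` ?E T) = ?h ` ?E (insert m T)"
    proof -
      have "h.S.line_extension ?K (?h ?s) (?h ` ?E T) =
          {?h (const c) \<otimes>\<^bsub>?Q\<^esub> ?h ?s \<oplus>\<^bsub>?Q\<^esub> ?h f | c f. Poly_Mapping.keys f \<subseteq> T}"
        unfolding h.S.line_extension_def set_add_def' r_coset_def by blast
      also have "\<dots> = {?h (Poly_Mapping.single m c + f) | c f. Poly_Mapping.keys f \<subseteq> T}"
      proof -
        have *: "?h (const c) \<otimes>\<^bsub>?Q\<^esub> ?h ?s \<oplus>\<^bsub>?Q\<^esub> ?h f = ?h (Poly_Mapping.single m c + f)"
          if "Poly_Mapping.keys f \<subseteq> T" for c f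
        proof -
          have "f \<in> polys V" using that EV[OF m(2)] by blast
          then show ?thesis
            using SV[OF m(1)] polys_const[of c V] hmult[of "const c" ?s] hadd[of "Poly_Mapping.single m c" f]
            by (simp flip: single_eq_const_mult)
        qed
        show ?thesis
        proof (intro Collect_cong ex_cong1)
          fix x c and f :: "'k mpoly"
          show "(x = ?h (const c) \<otimes>\<^bsub>?Q\<^esub> ?h ?s \<oplus>\<^bsub>?Q\<^esub> ?h f \<and> Poly_Mapping.keys f \<subseteq> T) \<longleftrightarrow>
              (x = ?h (Poly_Mapping.single m c + f) \<and> Poly_Mapping.keys f \<subseteq> T)"
            using *[of f c] by (cases "Poly_Mapping.keys f \<subseteq> T") (simp_all only: simp_thms)
        qed
      qed
      also have "\<dots> = ?h ` ?E (insert m T)"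
      proof safe
        fix c :: 'k and f :: "'k mpoly" assume f: "Poly_Mapping.keys f \<subseteq> T"
        have "Poly_Mapping.keys (Poly_Mapping.single m c + f) \<subseteq> insert m T"
          using f keys_add[of "Poly_Mapping.single m c" f] by (auto split: if_splits)
        then show "?h (Poly_Mapping.single m c + f) \<in> ?h ` ?E (insert m T)" by blast
      next
        fix f :: "'k mpoly" assume f: "Poly_Mapping.keys f \<subseteq> insert m T"
        let ?c = "Poly_Mapping.lookup f m"
        have "Poly_Mapping.keys (f - Poly_Mapping.single m ?c) \<subseteq> T"
        proof
          fix x assume "x \<in> Poly_Mapping.keys (f - Poly_Mapping.single m ?c)"
          then have "x \<noteq> m" "x \<in> Poly_Mapping.keys f"
            by (auto simp: in_keys_iff lookup_minus lookup_single when_def split: if_splits)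
          then show "x \<in> T" using f by blast
        qed
        moreover have "f = Poly_Mapping.single m ?c + (f - Poly_Mapping.single m ?c)" by simp
        ultimately show "\<exists>c g. ?h f = ?h (Poly_Mapping.single m c + g) \<and> Poly_Mapping.keys g \<subseteq> T"
          by (intro exI[of _ ?c] exI[of _ "f - Poly_Mapping.single m ?c"] conjI arg_cong[of _ _ ?h])
      qed
      finally show ?thesis .
    qed
    finally show ?case
      using insert by simp
  qed
  then have dim: "h.S.dimension (card S) ?K (?h ` ?E S)"
    by blast
  have "?h ` ?E S = ?h ` graded_piece V t"
  proof safe
    fix f :: "'k mpoly" assume "Poly_Mapping.keys f \<subseteq> S"
    then have "f \<in> graded_piece V t"
      using mon_basisD(1)[OF S] by (auto simp: graded_piece_iff)
    then show "?h f \<in> ?h ` graded_piece V t" by blast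
  next
    fix f :: "'k mpoly" assume "f \<in> graded_piece V t"
    then obtain g where "Poly_Mapping.keys g \<subseteq> S" "f - g \<in> I"
      using mon_basisD(3)[OF S] by blast
    then show "?h f \<in> ?h ` ?E S"
      using coset_eq_iff[OF I, of f g] by blast
  qed
  with dim have dim': "h.S.dimension (card S) ?K (?h ` graded_piece V t)"
    by simp
  have "h.S.dim ?K (?h ` graded_piece V t) = card S"
    unfolding h.S.dim_def
    using dim' h.S.dimension_is_inj[OF K _ dim'] by (intro the_equality)
  then show ?thesis
    unfolding hilbert_function_def using hf_eq_card[OF V I S] by (simp add: image_image)
qed

section \<open>Hilbert functions of C-saturated geometrically vertex decomposable ideals\<close>

text \<open>The coefficients are natural numbers, not integers, so that no summand can cancel
  another: each one is a lower bound for the whole sum.\<close>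

definition binomial_form :: "(nat \<Rightarrow> nat) \<Rightarrow> bool" where
  "binomial_form f \<longleftrightarrow> (\<exists>a e. \<forall>t. f t = (\<Sum>k<e. a k * (t choose k)))"

lemma binomial_form_add:
  assumes "binomial_form f" "binomial_form g"
  shows "binomial_form (\<lambda>t. f t + g t)"
proof -
  obtain a d b e where f: "\<And>t. f t = (\<Sum>k<d. a k * (t choose k))" and g: "\<And>t. g t = (\<Sum>k<e. b k * (t choose k))"
    using assms unfolding binomial_form_def by blast
  have pad: "(\<Sum>k<max d e. (if k < n then c k else 0) * (t choose k)) = (\<Sum>k<n. c k * (t choose k))"
    if "n \<le> max d e" for n t and c :: "nat \<Rightarrow> nat"
    using that by (intro sum.mono_neutral_cong_right) auto
  have "f t + g t = (\<Sum>k<max d e. ((if k < d then a k else 0) + (if k < e then b k else 0)) * (t choose k))" for t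
    by (simp add: f g pad add_mult_distrib sum.distrib)
  then show ?thesis
    unfolding binomial_form_def by (intro exI allI)
qed

text \<open>The hockey-stick identity, with the strict bound under which the contribution of
  \<open>C\<close> appears.\<close>

lemma sum_lessThan_choose: "(\<Sum>i<t. i choose k) = t choose Suc k"
  by (induction t) auto

lemma binomial_form_sum:
  assumes "binomial_form f"
  shows "binomial_form (\<lambda>t. \<Sum>i<t. f i)"
proof -
  obtain a d where f: "\<And>t. f t = (\<Sum>k<d. a k * (t choose k))"
    using assms unfolding binomial_form_def by blast
  have "(\<Sum>i<t. f i) = (\<Sum>k<Suc d. (case k of 0 \<Rightarrow> 0 | Suc k \<Rightarrow> a k) * (t choose k))" for t
  proof -
    have "(\<Sum>i<t. f i) = (\<Sum>k<d. \<Sum>i<t. a k * (i choose k))"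
      unfolding f by (rule sum.swap)
    also have "\<dots> = (\<Sum>k<d. a k * (t choose Suc k))"
      by (simp add: sum_lessThan_choose flip: sum_distrib_left)
    also have "\<dots> = (\<Sum>k<Suc d. (case k of 0 \<Rightarrow> 0 | Suc k \<Rightarrow> a k) * (t choose k))"
      unfolding sum.lessThan_Suc_shift by simp
    finally show ?thesis .
  qed
  then show ?thesis
    unfolding binomial_form_def by blast
qed

lemma binomial_form_const: "binomial_form (\<lambda>_. c)"
  unfolding binomial_form_def by (intro exI[of _ "\<lambda>_. c"] exI[of _ 1]) simp

section \<open>The zero ideal and ideals generated by variables\<close>

lemma homogeneous_ideal_zero: "homogeneous_ideal V {0 :: 'k::comm_ring_1 mpoly}"
  unfolding homogeneous_ideal_def by (auto intro!: ideal_mpolyI simp: polys_zero)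

lemma hf_zero_ideal:
  assumes "finite V"
  shows "hf V {0 :: 'k::field mpoly} t = card (degree_monomials V t)"
proof (rule hf_eq_card[OF assms])
  show "ideal {0 :: 'k mpoly} (mpoly_ring V)"
    using homogeneous_ideal_zero by (auto simp: homogeneous_ideal_def)
  show "mon_basis V {0 :: 'k mpoly} t (degree_monomials V t)"
    by (auto simp: mon_basis_def graded_piece_iff)
qed

lemma y_leading_zero: "y_leading j {0} i = {0}"
  by (auto simp: y_leading_def)

lemma sum_atMost_rev: "(\<Sum>i\<le>t. f (t - i)) = (\<Sum>i\<le>t. f i)" for f :: "nat \<Rightarrow> nat"
  by (rule sum.reindex_bij_witness[of _ "\<lambda>i. t - i" "\<lambda>i. t - i"]) auto

text \<open>All leading coefficient ideals of the zero ideal are zero, so a new variable adds the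
  sum of the earlier values. Without variables the values would be 1, 0, 0, and so on, which is no
  binomial form; the induction therefore starts with one variable, where the function is constantly
  1.\<close>

lemma binomial_form_monomials:
  assumes "finite V" "V \<noteq> {}"
  shows "binomial_form (hf V {0 :: 'k::field mpoly})"
  using assms
proof (induction V rule: finite_ne_induct)
  case (singleton j)
  have "degree_monomials {} t = (if t = 0 then {0} else {})" for t
    by (auto simp: degree_monomials_def monomials_def)
  then have "hf {} {0 :: 'k mpoly} t = (if t = 0 then 1 else 0)" for t
    by (subst hf_zero_ideal) auto
  then have "hf {j} {0 :: 'k mpoly} t = 1" for t
    using hf_y_leading[of "{j}" "{0 :: 'k mpoly}" j t]
    by (simp add: homogeneous_ideal_zero y_leading_zero sum_atMost_rev[of "\<lambda>i. if i = 0 then 1 else 0"])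
  then show ?case
    using binomial_form_const[of 1] by presburger
next
  case (insert j V)
  have "hf (insert j V) {0 :: 'k mpoly} t = hf V {0 :: 'k mpoly} t + (\<Sum>i<t. hf V {0 :: 'k mpoly} i)" for t
    using hf_y_leading[of "insert j V" "{0 :: 'k mpoly}" j t] insert
    by (simp add: homogeneous_ideal_zero y_leading_zero sum_atMost_rev) (simp flip: lessThan_Suc_atMost)
  then show ?case
    using binomial_form_add[OF insert.IH binomial_form_sum[OF insert.IH]] by presburger
qed

lemma variable_ideal_eq:
  assumes "S \<subseteq> V"
  shows "Idl\<^bsub>mpoly_ring V\<^esub> (var ` S) =
    {f :: 'k::comm_ring_1 mpoly. f \<in> polys V \<and> (\<forall>m\<in>Poly_Mapping.keys f. Poly_Mapping.keys m \<inter> S \<noteq> {})}"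
    (is "?I = ?J")
proof
  have J: "ideal ?J (mpoly_ring V)"
  proof (rule ideal_mpolyI)
    fix a b assume "a \<in> ?J" "b \<in> ?J"
    then show "a + b \<in> ?J" using keys_add[of a b] by (auto intro: polys_add)
  next
    fix p a :: "'k mpoly" assume p: "p \<in> polys V" and a: "a \<in> ?J"
    have "Poly_Mapping.keys m \<inter> S \<noteq> {}" if m: "m \<in> Poly_Mapping.keys (p * a)" for m
    proof -
      obtain x y where "y \<in> Poly_Mapping.keys a" "m = x + y"
        using keys_mult[of p a] m by blast
      moreover have "Poly_Mapping.keys y \<subseteq> Poly_Mapping.keys (x + y)"
        by (auto simp: in_keys_iff lookup_add)
      ultimately show ?thesis using a by blast
    qed
    then show "p * a \<in> ?J" using p a by (simp add: polys_mult)
  qed (auto intro: polys_zero)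
  have "var ` S \<subseteq> ?J"
    using assms by (auto simp: polys_var subset_iff) (auto simp: var_def split: if_splits)
  then show "?I \<subseteq> ?J"
    by (rule genideal_mpoly_subset[OF J])
  have gen: "var ` S \<subseteq> polys V"
    using assms polys_var by blast
  note I = genideal_mpoly[OF gen]
  show "?J \<subseteq> ?I"
  proof
    fix f assume f: "f \<in> ?J"
    have "Poly_Mapping.single m (Poly_Mapping.lookup f m) \<in> ?I" if m: "m \<in> Poly_Mapping.keys f" for m
    proof -
      obtain s where s: "s \<in> Poly_Mapping.keys m" "s \<in> S" using f m by blast
      let ?m = "m - Poly_Mapping.single s 1"
      have eq: "m = ?m + Poly_Mapping.single s 1"
        using s by (intro poly_mapping_eqI) (auto simp: lookup_add lookup_minus lookup_single when_def in_keys_iff)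
      have "Poly_Mapping.keys ?m \<subseteq> Poly_Mapping.keys m"
        by (auto simp: in_keys_iff lookup_minus)
      then have "Poly_Mapping.keys ?m \<subseteq> V" using f m by (auto simp: polys_iff)
      moreover have "var s \<in> ?I" using I(2) s(2) by blast
      ultimately have "Poly_Mapping.single ?m (Poly_Mapping.lookup f m) * var s \<in> ?I"
        by (intro ideal_mpolyD(4)[OF I(1)] polys_single)
      also have "Poly_Mapping.single ?m (Poly_Mapping.lookup f m) * var s = Poly_Mapping.single m (Poly_Mapping.lookup f m)"
        by (subst (3) eq) (simp add: var_def mult_single)
      finally show ?thesis .
    qed
    then have "(\<Sum>m\<in>Poly_Mapping.keys f. Poly_Mapping.single m (Poly_Mapping.lookup f m)) \<in> ?I"
      by (rule ideal_mpolyD(8)[OF I(1)])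
    then show "f \<in> ?I"
      using poly_mapping_sum_single[of "Poly_Mapping.keys f" f] by simp
  qed
qed

text \<open>The terms of \<open>f\<close> free of the variables in \<open>S\<close> represent its
  class; together with the next lemma, this identifies the quotient with the polynomial ring in the
  remaining variables.\<close>

lemma variable_ideal_split:
  fixes f :: "'k::comm_ring_1 mpoly"
  assumes "f \<in> polys V" "S \<subseteq> V"
  obtains g where "g \<in> polys (V - S)" "Poly_Mapping.keys g \<subseteq> Poly_Mapping.keys f"
    "f - g \<in> Idl\<^bsub>mpoly_ring V\<^esub> (var ` S)"
proof -
  let ?K = "{m \<in> Poly_Mapping.keys f. Poly_Mapping.keys m \<inter> S = {}}"
  define g where "g = (\<Sum>m\<in>?K. Poly_Mapping.single m (Poly_Mapping.lookup f m))"
  have l: "Poly_Mapping.lookup g x = (if x \<in> ?K then Poly_Mapping.lookup f x else 0)" for x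
    by (auto simp: g_def lookup_sum lookup_single when_def sum.delta')
  have keys: "Poly_Mapping.keys g \<subseteq> ?K"
  proof
    fix x assume "x \<in> Poly_Mapping.keys g"
    then have "Poly_Mapping.lookup g x \<noteq> 0" by (simp add: in_keys_iff)
    then show "x \<in> ?K" unfolding l by presburger
  qed
  have g: "g \<in> polys (V - S)"
    unfolding polys_iff
  proof
    fix m assume "m \<in> Poly_Mapping.keys g"
    then have "m \<in> ?K" using keys by blast
    then show "Poly_Mapping.keys m \<subseteq> V - S"
      using assms(1) by (auto simp: polys_iff)
  qed
  then have "f - g \<in> polys V"
    using assms(1) polys_mono[of "V - S" V] by (intro polys_diff) auto
  moreover have "Poly_Mapping.keys m \<inter> S \<noteq> {}" if "m \<in> Poly_Mapping.keys (f - g)" for m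
  proof -
    have *: "Poly_Mapping.lookup f m - Poly_Mapping.lookup g m \<noteq> 0"
      using that by (simp add: in_keys_iff lookup_minus)
    then have "m \<notin> ?K"
      using l[of m] by (metis right_minus_eq)
    moreover from this have "m \<in> Poly_Mapping.keys f"
      using l[of m] * unfolding in_keys_iff by (metis right_minus_eq)
    ultimately show ?thesis by blast
  qed
  ultimately have "f - g \<in> Idl\<^bsub>mpoly_ring V\<^esub> (var ` S)"
    unfolding variable_ideal_eq[OF assms(2)] by blast
  then show ?thesis using that g keys by blast
qed

lemma variable_ideal_trivial:
  assumes "S \<subseteq> V" "g \<in> polys (V - S)" "g \<in> Idl\<^bsub>mpoly_ring V\<^esub> (var ` S)"
  shows "g = (0 :: 'k::comm_ring_1 mpoly)"
proof -
  have "m \<notin> Poly_Mapping.keys g" for m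
    using assms(2,3) unfolding variable_ideal_eq[OF assms(1)] polys_iff by blast
  then show ?thesis by (intro poly_mapping_eqI) (simp add: in_keys_iff)
qed

text \<open>The quotient is a polynomial ring over a field, which has no nilpotent elements.\<close>

lemma radical_variable_ideal:
  fixes I :: "'k::field mpoly set"
  assumes "S \<subseteq> V" and I: "I = Idl\<^bsub>mpoly_ring V\<^esub> (var ` S)"
  shows "radical_ideal V I"
  unfolding radical_ideal_def
proof safe
  fix f :: "'k mpoly" and k assume f: "f \<in> polys V" "f ^ k \<in> I"
  have "var ` S \<subseteq> polys V" using assms(1) polys_var by blast
  then have I': "ideal I (mpoly_ring V)"
    unfolding I by (rule genideal_mpoly(1))
  obtain g where g: "g \<in> polys (V - S)" "f - g \<in> I"
    using variable_ideal_split[OF f(1) assms(1)] unfolding I by metis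
  have "(f - (f - g)) ^ k - f ^ k \<in> I"
    by (rule diff_power_mem_ideal[OF I' f(1) g(2)])
  then have "g ^ k \<in> I"
    using ideal_mpolyD(3)[OF I' _ f(2), of "g ^ k - f ^ k"] by simp
  then have "g ^ k = 0"
    using variable_ideal_trivial[OF assms(1) polys_power[OF g(1)]] I by blast
  then show "f \<in> I" using g(2) by simp
qed

lemma hf_variable_ideal:
  fixes I :: "'k::field mpoly set"
  assumes "finite V" "S \<subseteq> V" and I: "I = Idl\<^bsub>mpoly_ring V\<^esub> (var ` S)"
  shows "hf V I t = hf (V - S) {0 :: 'k mpoly} t"
proof -
  have "var ` S \<subseteq> polys V" using assms(2) polys_var by blast
  then have I': "ideal I (mpoly_ring V)"
    unfolding I by (rule genideal_mpoly(1))
  let ?D = "degree_monomials (V - S) t"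
  have D: "g \<in> polys (V - S)" if "Poly_Mapping.keys g \<subseteq> ?D" for g :: "'k mpoly"
    using that by (simp add: graded_piece_def flip: graded_piece_iff)
  have "mon_basis V I t ?D"
    unfolding mon_basis_def
  proof (intro conjI ballI impI)
    show "?D \<subseteq> degree_monomials V t"
      by (auto simp: degree_monomials_def monomials_def)
    show "f = 0" if "f \<in> I" "Poly_Mapping.keys f \<subseteq> ?D" for f
      using variable_ideal_trivial[OF assms(2) D[OF that(2)]] that(1) I by blast
    fix f :: "'k mpoly" assume f: "f \<in> graded_piece V t"
    then have "f \<in> polys V" by (simp add: graded_piece_def)
    from variable_ideal_split[OF this assms(2)] obtain g
      where g: "g \<in> polys (V - S)" "Poly_Mapping.keys g \<subseteq> Poly_Mapping.keys f" "f - g \<in> I"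
      unfolding I by metis
    have "g \<in> graded_piece (V - S) t"
      using f g(1,2) by (auto simp: graded_piece_def)
    then show "\<exists>g. Poly_Mapping.keys g \<subseteq> ?D \<and> f - g \<in> I"
      using g(3) by (auto simp: graded_piece_iff)
  qed
  then show ?thesis
    using hf_eq_card[OF assms(1) I'] hf_zero_ideal[of "V - S", where 'k = 'k] assms(1) by simp
qed

text \<open>Every polynomial multiplies the irrelevant ideal into itself, so exponent 1 already puts
  the whole ring into the saturation. The case of no variables is included.\<close>

lemma not_saturated_irrelevant:
  fixes I :: "'k::comm_ring_1 mpoly set"
  assumes "I = irrelevant_ideal V" "saturated V I"
  shows "I = polys V"
proof -
  let ?R = "mpoly_ring V :: 'k mpoly ring"
  interpret cring ?R by (rule cring_mpoly_ring)
  have "var ` V \<subseteq> polys V" using polys_var by blast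
  then have I: "ideal I ?R"
    unfolding assms(1) irrelevant_ideal_def by (rule genideal_mpoly(1))
  \<comment> \<open>The first power in the monoid of ideals unfolds to the product of the whole ring
    with \<open>I\<close>.\<close>
  have "I [^]\<^bsub>ideals_set ?R\<^esub> (1::nat) = ideal_prod ?R (polys V) I"
    by (simp add: nat_pow_def ideals_set_def)
  also have "\<dots> \<subseteq> I"
    using ideal_prod_inter[OF oneideal I] by blast
  finally have "\<forall>g\<in>I [^]\<^bsub>ideals_set ?R\<^esub> (1::nat). f \<otimes>\<^bsub>?R\<^esub> g \<in> I" if "f \<in> polys V" for f
    using ideal_mpolyD(4)[OF I that] by (auto simp: mpoly_ring_def)
  then have "polys V \<subseteq> saturation ?R I I"
    unfolding saturation_def by blast
  then show ?thesis
    using assms ideal_mpolyD(1)[OF I] unfolding saturated_def by auto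
qed

lemma hf_gvd:
  fixes I :: "'k::field mpoly set"
  assumes V: "finite V" and I: "homogeneous_ideal V I" and gvd: "geometric_vertex_decomposition V j r G I"
  shows "hf V I t = hf (V - {j}) (contraction V j (N_ideal V j G)) t +
    (\<Sum>i<t. hf (V - {j}) (contraction V j (C_ideal V j G)) i)"
proof -
  have I': "ideal I (mpoly_ring V)" using I by (simp add: homogeneous_ideal_def)
  have j: "j \<in> V" using gvd by (simp add: geometric_vertex_decomposition_def)
  note L = gvd_y_leading[OF I' gvd]
  let ?C = "contraction V j (C_ideal V j G)"
  have "hf V I t = (\<Sum>i\<le>t. hf (V - {j}) (y_leading j I i) (t - i))"
    by (rule hf_y_leading[OF V I j])
  also have "\<dots> = hf (V - {j}) (y_leading j I 0) t + (\<Sum>i\<in>{1..t}. hf (V - {j}) (y_leading j I i) (t - i))"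
  proof -
    have "{..t} = insert 0 {1..t}" by auto
    then show ?thesis by simp
  qed
  also have "(\<Sum>i\<in>{1..t}. hf (V - {j}) (y_leading j I i) (t - i)) = (\<Sum>i\<in>{1..t}. hf (V - {j}) ?C (t - i))"
    using L(5) by (intro sum.cong) auto
  also have "\<dots> = (\<Sum>i<t. hf (V - {j}) ?C i)"
    by (rule sum.reindex_bij_witness[of _ "\<lambda>i. t - i" "\<lambda>i. t - i"]) auto
  finally show ?thesis by (simp add: L(4))
qed

text \<open>The two claims are proved together because the Hilbert function in the degenerate case
  needs the radicality of \<open>N\<close> to determine \<open>C\<close>.\<close>

lemma csat_gvd_radical_binomial_form:
  fixes I :: "'k::field mpoly set"
  assumes "csat_gvd V I" "finite V"
  shows "radical_ideal V I \<and> binomial_form (hf V I)"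
  using assms
proof (induction rule: csat_gvd.induct)
  case (variables V I)
  then obtain S where S: "S \<subseteq> V" "I = Idl\<^bsub>mpoly_ring V\<^esub> (var ` S)"
    by (auto simp: variable_ideal_def)
  \<comment> \<open>Otherwise \<open>I\<close> would be irrelevant and saturated, hence the whole
    ring.\<close>
  have "S \<noteq> V"
    using variables(1) S not_saturated_irrelevant[of I V]
    by (auto simp: csat_base_def irrelevant_ideal_def)
  then have "binomial_form (hf (V - S) {0 :: 'k mpoly})"
    using S variables by (intro binomial_form_monomials) auto
  then show ?case
    using radical_variable_ideal[OF S] hf_variable_ideal[OF variables.prems S] by presburger
next
  case (degenerate V I j r G)
  let ?C = "contraction V j (C_ideal V j G)" and ?N = "contraction V j (N_ideal V j G)"
  have I: "homogeneous_ideal V I" "ideal I (mpoly_ring V)"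
    using degenerate(1) by (auto simp: csat_base_def homogeneous_ideal_def)
  note L = gvd_y_leading[OF I(2) degenerate(2)]
  have V': "finite (V - {j})" using degenerate.prems by simp
  then have N: "radical_ideal (V - {j}) ?N" "binomial_form (hf (V - {j}) ?N)"
    using degenerate by auto
  have VV: "polys (V - {j}) \<subseteq> polys V" by (rule polys_mono) auto
  have hf: "hf V I t = hf (V - {j}) ?N t + (\<Sum>i<t. hf (V - {j}) ?C i)" for t
    by (rule hf_gvd[OF degenerate.prems I(1) degenerate(2)])
  consider "ideal_radical (mpoly_ring V) (C_ideal V j G) = ideal_radical (mpoly_ring V) (N_ideal V j G)" |
      "C_ideal V j G = polys V"
    using degenerate(3) by (auto simp: degenerate_def)
  \<comment> \<open>In the second case \<open>C\<close> contributes nothing to the Hilbert function,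
    and the values for \<open>I\<close> are those for \<open>N\<close>.\<close>
  then have C: "?C = ?N \<or> ?C = polys (V - {j})"
  proof cases
    case 1
    have "?C \<subseteq> ?N"
    proof
      fix f assume f: "f \<in> ?C"
      then have "f ^ 1 \<in> C_ideal V j G" "f \<in> polys (V - {j})" by (auto simp: contraction_def)
      then have "f \<in> ideal_radical (mpoly_ring V) (C_ideal V j G)"
        using VV unfolding ideal_radical_def mpoly_ring_pow by blast
      then have "f \<in> ideal_radical (mpoly_ring V) (N_ideal V j G)"
        using 1 by simp
      then obtain k where "f ^ k \<in> N_ideal V j G"
        unfolding ideal_radical_def mpoly_ring_pow by blast
      then have "f ^ k \<in> ?N"
        using \<open>f \<in> polys (V - {j})\<close> by (auto simp: contraction_def polys_power)
      then show "f \<in> ?N"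
        using N(1) \<open>f \<in> polys (V - {j})\<close> by (auto simp: radical_ideal_def)
    qed
    then show ?thesis using L(3) by auto
  next
    case 2
    then show ?thesis using VV by (auto simp: contraction_def)
  qed
  have Crad: "radical_ideal (V - {j}) ?C"
    using C N(1) by (auto simp: radical_ideal_def)
  have "radical_ideal V I"
    by (rule radical_ideal_y_leading[OF I(2), where j = j]) (use L(4,5) N(1) Crad in \<open>metis neq0_conv\<close>, use L(5) in auto)
  moreover have "binomial_form (hf V I)"
    using C
  proof
    assume "?C = ?N"
    then show ?thesis
      using binomial_form_add[OF N(2) binomial_form_sum[OF N(2)]] by (simp add: hf[abs_def])
  next
    assume "?C = polys (V - {j})"
    then show ?thesis
      using N(2) by (simp add: hf[abs_def] hf_polys[OF V'])
  qed
  ultimately show ?case ..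
next
  case (nondegenerate V I j r G)
  let ?C = "contraction V j (C_ideal V j G)" and ?N = "contraction V j (N_ideal V j G)"
  have I: "homogeneous_ideal V I" "ideal I (mpoly_ring V)"
    using nondegenerate(1) by (auto simp: csat_base_def homogeneous_ideal_def)
  note L = gvd_y_leading[OF I(2) nondegenerate(2)]
  have N: "radical_ideal (V - {j}) ?N" "binomial_form (hf (V - {j}) ?N)"
    and C: "radical_ideal (V - {j}) ?C" "binomial_form (hf (V - {j}) ?C)"
    using nondegenerate by auto
  have "radical_ideal V I"
    by (rule radical_ideal_y_leading[OF I(2), where j = j]) (use L(4,5) N(1) C(1) in \<open>metis neq0_conv\<close>, use L(5) in auto)
  moreover have "binomial_form (hf V I)"
    using binomial_form_add[OF N(2) binomial_form_sum[OF C(2)]]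
      hf_gvd[OF nondegenerate.prems I(1) nondegenerate(2)] by (simp add: hf_gvd[OF nondegenerate.prems I(1) nondegenerate(2), abs_def])
  ultimately show ?case ..
qed

section \<open>Chains of prime ideals from the growth of the Hilbert function\<close>

lemma polys_empty_eq_const: "f \<in> polys {} \<Longrightarrow> f = const (Poly_Mapping.lookup f 0)"
  by (rule poly_mapping_eqI) (auto simp: polys_iff const_def lookup_single when_def in_keys_iff)

lemma ideal_const_unit:
  fixes I :: "'k::field mpoly set"
  assumes I: "ideal I (mpoly_ring V)" and "const c \<in> I" "c \<noteq> 0"
  shows "I = polys V"
proof -
  have "const (inverse c) * const c \<in> I"
    by (rule ideal_mpolyD(4)[OF I polys_const assms(2)])
  then show ?thesis
    using assms(3) ideal_eq_polys_iff[OF I] by (simp add: const_simps(3) flip: const_simps(2))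
qed

text \<open>Hilbert's basis theorem by induction on the variables. The ideals \<open>?L k i\<close>
  increase in both indices, so the diagonal stabilises, which controls all large \<open>i\<close> at
  once; the finitely many remaining rows stabilise separately.\<close>

lemma ideal_acc:
  fixes I :: "nat \<Rightarrow> 'k::field mpoly set"
  assumes "finite V" "\<And>k. ideal (I k) (mpoly_ring V)" "\<And>k. I k \<subseteq> I (Suc k)"
  shows "\<exists>n. \<forall>k\<ge>n. I k = I n"
  using assms
proof (induction V arbitrary: I rule: finite_induct)
  case empty
  have mono: "I a \<subseteq> I b" if "a \<le> b" for a b
    using that empty(2) by (rule lift_Suc_mono_le[rotated])
  show ?case
  proof (cases "\<exists>n. I n \<noteq> {0}")
    case True
    then obtain n where "I n \<noteq> {0}" by blast
    then obtain f where f: "f \<in> I n" "f \<noteq> 0"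
      using ideal_mpolyD(2)[OF empty(1)] by blast
    have full: "I k = polys {}" if "k \<ge> n" for k
    proof -
      have "f \<in> I k" using f mono[OF that] by blast
      moreover from this have eq: "f = const (Poly_Mapping.lookup f 0)"
        using ideal_mpolyD(1)[OF empty(1)] polys_empty_eq_const by blast
      moreover from eq f(2) have "Poly_Mapping.lookup f 0 \<noteq> 0"
        by (metis const_simps(4))
      ultimately show ?thesis
        using ideal_const_unit[OF empty(1)] by metis
    qed
    have "\<forall>k\<ge>n. I k = I n"
      using full by simp
    then show ?thesis by blast
  qed simp
next
  case (insert j V)
  have V: "insert j V - {j} = V" using insert by simp
  have mono: "I a \<subseteq> I b" if "a \<le> b" for a b
    using that insert.prems(2) by (rule lift_Suc_mono_le[rotated])
  let ?L = "\<lambda>k i. y_leading j (I k) i"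
  have L: "ideal (?L k i) (mpoly_ring V)" for k i
    using ideal_y_leading[OF insert.prems(1), of j k i] unfolding V .
  have L_mono: "?L a i \<subseteq> ?L b l" if "a \<le> b" "i \<le> l" for a b i l
    using y_leading_mono[OF mono[OF that(1)], of j i]
      y_leading_mono_index[OF insert.prems(1) insertI1 that(2), of b] by blast
  obtain d where d: "\<And>k. k \<ge> d \<Longrightarrow> ?L k k = ?L d d"
    using insert.IH[of "\<lambda>k. ?L k k"] L L_mono by (meson le_SucI order_refl)
  have "\<exists>n. \<forall>k\<ge>n. ?L k i = ?L n i" for i
    using insert.IH[of "\<lambda>k. ?L k i"] L L_mono[of _ _ i i] by simp
  then obtain \<nu> where \<nu>: "\<And>i k. k \<ge> \<nu> i \<Longrightarrow> ?L k i = ?L (\<nu> i) i"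
    by metis
  \<comment> \<open>The sum dominates every \<open>\<nu> i\<close> with \<open>i < d\<close>, so
    \<open>n\<close> lies beyond all stabilisation points that matter.\<close>
  define n where "n = d + (\<Sum>i<d. \<nu> i)"
  have "I k = I n" if k: "k \<ge> n" for k
  proof (rule ideal_eqI_y_leading[symmetric, OF insert.prems(1) insert.prems(1)])
    show "I n \<subseteq> I k" by (rule mono[OF k])
    show "?L k i \<subseteq> ?L n i" for i
    proof (cases "i < d")
      case True
      have "\<nu> i \<le> (\<Sum>i<d. \<nu> i)"
        using True by (intro member_le_sum) auto
      then have "\<nu> i \<le> n" by (simp add: n_def)
      then show ?thesis using \<nu>[of i k] \<nu>[of i n] k by simp
    next
      case False
      have "?L k i \<subseteq> ?L (max k i) (max k i)" by (rule L_mono) auto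
      also have "\<dots> = ?L d d" using False by (intro d) simp
      also have "\<dots> \<subseteq> ?L n i" using False by (intro L_mono) (auto simp: n_def)
      finally show ?thesis .
    qed
  qed
  then show ?case by blast
qed

lemma ex_maximal_ideal_in:
  fixes F :: "'k::field mpoly set set"
  assumes V: "finite V" and F: "\<And>J. J \<in> F \<Longrightarrow> ideal J (mpoly_ring V)" and "J0 \<in> F"
  obtains M where "M \<in> F" "\<And>J. J \<in> F \<Longrightarrow> M \<subseteq> J \<Longrightarrow> J = M"
proof (rule ccontr)
  assume no: "\<not> thesis"
  note witness = that
  have "\<exists>J'. J' \<in> F \<and> J \<subset> J'" if "J \<in> F" for J
    using no witness[OF that] by blast
  then obtain I where I: "\<And>n. I n \<in> F" "\<And>n. I n \<subset> I (Suc n)"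
    using dependent_nat_choice[of "\<lambda>_ J. J \<in> F" "\<lambda>_ J J'. J \<subset> J'"] \<open>J0 \<in> F\<close> by metis
  obtain n where "\<forall>k\<ge>n. I k = I n"
    using ideal_acc[OF V, of I] F I by blast
  then show False using I(2)[of n] by (metis le_SucI order_refl psubset_eq)
qed

section \<open>Primality tested on homogeneous elements\<close>

lemma ex_hom_component_notin:
  assumes P: "ideal P (mpoly_ring V)" and "f \<notin> P"
  shows "\<exists>t. hom_component t f \<notin> P"
proof (rule ccontr)
  assume "\<nexists>t. hom_component t f \<notin> P"
  then have "(\<Sum>t\<le>N. hom_component t f) \<in> P" for N
    by (intro ideal_mpolyD(8)[OF P]) simp
  moreover obtain N where "\<And>m. m \<in> Poly_Mapping.keys f \<Longrightarrow> mon_degree m \<le> N"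
    using exists_degree_bound[of f] by blast
  ultimately show False
    using sum_hom_components[of f N] \<open>f \<notin> P\<close> by metis
qed

text \<open>For \<open>f\<close> and \<open>g\<close> outside \<open>P\<close>, take their
  components of lowest degree outside \<open>P\<close>. Modulo \<open>P\<close>, the component of
  \<open>f * g\<close> in the sum of these degrees is the product of the two.\<close>

lemma homogeneous_primeI:
  fixes P :: "'k::comm_ring_1 mpoly set"
  assumes hom: "homogeneous_ideal V P" and "P \<noteq> polys V"
    and prime: "\<And>s u a b. a \<in> graded_piece V s \<Longrightarrow> b \<in> graded_piece V u \<Longrightarrow> a * b \<in> P \<Longrightarrow> a \<in> P \<or> b \<in> P"
  shows "primeideal P (mpoly_ring V)"
proof (rule primeidealI)
  show P: "ideal P (mpoly_ring V)" using hom by (simp add: homogeneous_ideal_def)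
  show "cring (mpoly_ring V :: 'k mpoly ring)" by (rule cring_mpoly_ring)
  show "polys V \<noteq> P" using assms(2) by simp
  fix f g :: "'k mpoly" assume fg: "f \<in> polys V" "g \<in> polys V" "f \<otimes>\<^bsub>mpoly_ring V\<^esub> g \<in> P"
  show "f \<in> P \<or> g \<in> P"
  proof (rule ccontr)
    assume "\<not> ?thesis"
    then have ex: "\<exists>t. hom_component t f \<notin> P" "\<exists>t. hom_component t g \<notin> P"
      using ex_hom_component_notin[OF P] by auto
    define s where "s = (LEAST t. hom_component t f \<notin> P)"
    define u where "u = (LEAST t. hom_component t g \<notin> P)"
    have s: "hom_component s f \<notin> P" "\<And>t. t < s \<Longrightarrow> hom_component t f \<in> P"
      unfolding s_def using LeastI_ex[OF ex(1)] not_less_Least by blast+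
    have u: "hom_component u g \<notin> P" "\<And>t. t < u \<Longrightarrow> hom_component t g \<in> P"
      unfolding u_def using LeastI_ex[OF ex(2)] not_less_Least by blast+
    let ?A = "{..s + u} - {s}"
    have "hom_component (s + u) (f * g) \<in> P"
      using fg(3) hom by (simp add: homogeneous_ideal_def mpoly_ring_def)
    then have "hom_component s f * hom_component u g +
        (\<Sum>a\<in>?A. hom_component a f * hom_component (s + u - a) g) \<in> P"
      unfolding hom_component_mult by (subst (asm) sum.remove[of _ s]) auto
    moreover have "(\<Sum>a\<in>?A. hom_component a f * hom_component (s + u - a) g) \<in> P"
    proof (rule ideal_mpolyD(8)[OF P])
      fix a assume "a \<in> ?A"
      \<comment> \<open>Away from \<open>a = s\<close>, one of the two factors has a degree below
        its minimal one and hence lies in \<open>P\<close>.\<close>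
      then consider "a < s" | "s + u - a < u" by fastforce
      then show "hom_component a f * hom_component (s + u - a) g \<in> P"
        using s(2)[of a] u(2)[of "s + u - a"] ideal_mpolyD(4,5)[OF P] fg(1,2) hom_component_in_polys
        by cases blast+
    qed
    ultimately have "hom_component s f * hom_component u g \<in> P"
      using ideal_mpolyD(7)[OF P] by fastforce
    then show False
      using prime[of "hom_component s f" s "hom_component u g" u] s(1) u(1) fg(1,2)
        hom_component_in_graded_piece by blast
  qed
qed

section \<open>Colon ideals, adjoined elements and growth\<close>

definition colon :: "nat set \<Rightarrow> 'k::comm_ring_1 mpoly set \<Rightarrow> 'k mpoly \<Rightarrow> 'k mpoly set" where
  "colon V J a = {f \<in> polys V. a * f \<in> J}"

definition add_gen :: "nat set \<Rightarrow> 'k::comm_ring_1 mpoly set \<Rightarrow> 'k mpoly \<Rightarrow> 'k mpoly set" where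
  "add_gen V J a = {j + a * r | j r. j \<in> J \<and> r \<in> polys V}"

lemma homogeneous_colon:
  fixes J :: "'k::comm_ring_1 mpoly set"
  assumes J: "homogeneous_ideal V J" and a: "a \<in> graded_piece V d"
  shows "homogeneous_ideal V (colon V J a)"
  unfolding homogeneous_ideal_def
proof (intro conjI ballI allI)
  have J': "ideal J (mpoly_ring V)" using J by (simp add: homogeneous_ideal_def)
  show "ideal (colon V J a) (mpoly_ring V)"
  proof (rule ideal_mpolyI)
    fix p f :: "'k mpoly" assume "p \<in> polys V" "f \<in> colon V J a"
    then show "p * f \<in> colon V J a"
      using ideal_mpolyD(4)[OF J', of p "a * f"] by (auto simp: colon_def polys_mult mult_ac)
  qed (auto simp: colon_def polys_zero polys_add distrib_left intro: ideal_mpolyD(2,3)[OF J'])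
  fix f t assume f: "f \<in> colon V J a"
  have "hom_component (t + d) (a * f) = a * hom_component t f"
    using hom_component_mult_graded[OF a, of "t + d" f] by simp
  then show "hom_component t f \<in> colon V J a"
    using f J unfolding colon_def homogeneous_ideal_def by (metis (lifting) hom_component_in_polys mem_Collect_eq)
qed

lemma hom_component_mult_graded_below:
  assumes "a \<in> graded_piece V d" "t < d"
  shows "hom_component t (a * r) = 0"
  unfolding hom_component_mult using assms(2)
  by (intro sum.neutral) (auto simp: hom_component_graded_piece[OF assms(1)])

lemma homogeneous_add_gen:
  fixes J :: "'k::comm_ring_1 mpoly set"
  assumes J: "homogeneous_ideal V J" and a: "a \<in> graded_piece V d"
  shows "homogeneous_ideal V (add_gen V J a)"
  unfolding homogeneous_ideal_def
proof (intro conjI ballI allI)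
  have J': "ideal J (mpoly_ring V)" using J by (simp add: homogeneous_ideal_def)
  have aV: "a \<in> polys V" using a by (simp add: graded_piece_def)
  show "ideal (add_gen V J a) (mpoly_ring V)"
    unfolding add_gen_def by (rule ideal_add_principal[OF J' aV])
  fix f t assume "f \<in> add_gen V J a"
  then obtain j r where f: "f = j + a * r" "j \<in> J" "r \<in> polys V"
    unfolding add_gen_def by blast
  have "hom_component t f = hom_component t j + a * (if d \<le> t then hom_component (t - d) r else 0)"
    using hom_component_mult_graded[OF a, of t r] hom_component_mult_graded_below[OF a, of t r]
    by (simp add: f(1) hom_component_add)
  moreover have "hom_component t j \<in> J"
    using J f(2) by (simp add: homogeneous_ideal_def)
  moreover have "(if d \<le> t then hom_component (t - d) r else 0) \<in> polys V"
    using f(3) by (simp add: hom_component_in_polys polys_zero)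
  ultimately show "hom_component t f \<in> add_gen V J a"
    unfolding add_gen_def by blast
qed

lemma subset_colon:
  assumes "ideal J (mpoly_ring V)" "a \<in> polys V"
  shows "J \<subseteq> colon V J a"
  using ideal_mpolyD(1,4)[OF assms(1)] assms(2) by (auto simp: colon_def)

lemma subset_add_gen:
  assumes "ideal J (mpoly_ring V)"
  shows "J \<subseteq> add_gen V J a" "a \<in> add_gen V J a"
proof -
  have "j = j + a * 0" "a = 0 + a * 1" for j by simp_all
  then show "J \<subseteq> add_gen V J a" "a \<in> add_gen V J a"
    unfolding add_gen_def using ideal_mpolyD(2)[OF assms] polys_zero[of V] polys_one[of V] by blast+
qed

lemma hf_le_span:
  fixes I :: "'k::field mpoly set"
  assumes "finite V" "ideal I (mpoly_ring V)" "finite B" "B \<subseteq> graded_piece V t"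
    and "\<And>f. f \<in> graded_piece V t \<Longrightarrow> \<exists>x\<in>mpoly_vs.span B. f - x \<in> I"
  shows "hf V I t \<le> card B"
proof (rule hf_le[OF assms(1-4)])
  fix f :: "'k mpoly" assume "f \<in> graded_piece V t"
  then show "\<exists>c. f - (\<Sum>b\<in>B. const (c b) * b) \<in> I"
    using assms(5) unfolding mpoly_vs.span_finite[OF assms(3)] by blast
qed

text \<open>The factor \<open>a\<close> allows for multiples of a monomial basis;
  \<open>a = 1\<close> gives the plain monomial span, which explains the factors \<open>1 *\<close>
  in later uses.\<close>

lemma mult_mem_span:
  fixes g :: "'k::field mpoly"
  assumes "finite S" "Poly_Mapping.keys g \<subseteq> S"
  shows "a * g \<in> mpoly_vs.span ((\<lambda>m. a * Poly_Mapping.single m 1) ` S)"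
proof -
  have "g = (\<Sum>m\<in>S. Poly_Mapping.single m (Poly_Mapping.lookup g m))"
    by (rule poly_mapping_sum_single[OF assms])
  also have "\<dots> = (\<Sum>m\<in>S. const (Poly_Mapping.lookup g m) * Poly_Mapping.single m 1)"
    by (simp flip: single_eq_const_mult)
  finally have "a * g = a * (\<Sum>m\<in>S. const (Poly_Mapping.lookup g m) * Poly_Mapping.single m 1)"
    by (rule arg_cong)
  also have "\<dots> = (\<Sum>m\<in>S. const (Poly_Mapping.lookup g m) * (a * Poly_Mapping.single m 1))"
    by (simp add: sum_distrib_left mult_ac)
  also have "\<dots> \<in> mpoly_vs.span ((\<lambda>m. a * Poly_Mapping.single m 1) ` S)"
    by (intro mpoly_vs.span_sum mpoly_vs.span_scale mpoly_vs.span_base imageI)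
  finally show ?thesis .
qed

text \<open>Multiplication by \<open>a\<close> on the quotient by \<open>J\<close> factors through
  the quotient by the colon ideal, and its cokernel is the quotient by \<open>add_gen V J a\<close>.
  A basis of the former multiplied by \<open>a\<close>, joined to a basis of the latter,
  spans.\<close>

lemma hf_subadditive:
  fixes J :: "'k::field mpoly set"
  assumes V: "finite V" and J: "homogeneous_ideal V J" and a: "a \<in> graded_piece V d"
  shows "hf V J (t + d) \<le> hf V (colon V J a) t + hf V (add_gen V J a) (t + d)"
proof -
  have J': "ideal J (mpoly_ring V)" using J by (simp add: homogeneous_ideal_def)
  have C: "ideal (colon V J a) (mpoly_ring V)" and A: "ideal (add_gen V J a) (mpoly_ring V)"
    using homogeneous_colon[OF J a] homogeneous_add_gen[OF J a] by (auto simp: homogeneous_ideal_def)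
  obtain S where S: "mon_basis V (colon V J a) t S"
    using ex_mon_basis[OF V C] by blast
  obtain T where T: "mon_basis V (add_gen V J a) (t + d) T"
    using ex_mon_basis[OF V A] by blast
  have fin: "finite S" "finite T"
    using mon_basisD(1)[OF S] mon_basisD(1)[OF T] finite_degree_monomials[OF V] finite_subset by blast+
  let ?A = "(\<lambda>m. a * Poly_Mapping.single m 1) ` S" and ?B = "(\<lambda>m. 1 * Poly_Mapping.single m (1::'k)) ` T"
  have "hf V J (t + d) \<le> card (?A \<union> ?B)"
  proof (rule hf_le_span[OF V J'])
    have "a * Poly_Mapping.single m (1::'k) \<in> graded_piece V (t + d)" if "m \<in> S" for m
    proof -
      have "Poly_Mapping.single m (1::'k) \<in> graded_piece V t"
        using that mon_basisD(1)[OF S] by (auto simp: graded_piece_iff)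
      from graded_piece_mult[OF a this] show ?thesis by (simp only: add.commute)
    qed
    then have "?A \<subseteq> graded_piece V (t + d)"
      by blast
    moreover have "?B \<subseteq> graded_piece V (t + d)"
      using mon_basisD(1)[OF T] by (auto simp: graded_piece_iff)
    ultimately show "?A \<union> ?B \<subseteq> graded_piece V (t + d)" by blast
    fix f :: "'k mpoly" assume f: "f \<in> graded_piece V (t + d)"
    obtain g where g: "Poly_Mapping.keys g \<subseteq> T" "f - g \<in> add_gen V J a"
      using mon_basisD(3)[OF T f] by blast
    obtain j r where jr: "f - g = j + a * r" "j \<in> J" "r \<in> polys V"
      using g(2) unfolding add_gen_def by blast
    have "g \<in> graded_piece V (t + d)"
      using g(1) mon_basisD(1)[OF T] by (auto simp: graded_piece_iff)
    then have "f - g = hom_component (t + d) (f - g)"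
      using graded_piece_closed(2)[OF f] hom_component_graded_piece by metis
    also have "\<dots> = hom_component (t + d) j + a * hom_component t r"
      unfolding jr(1) using hom_component_mult_graded[OF a, of "t + d" r] by (simp add: hom_component_add)
    finally have fg: "f - g = hom_component (t + d) j + a * hom_component t r" .
    obtain s where s: "Poly_Mapping.keys s \<subseteq> S" "hom_component t r - s \<in> colon V J a"
      using mon_basisD(3)[OF S hom_component_in_graded_piece[OF jr(3)]] by blast
    have "f - (a * s + 1 * g) = hom_component (t + d) j + a * (hom_component t r - s)"
      using fg by (simp add: algebra_simps)
    also have "\<dots> \<in> J"
      using s(2) jr(2) J by (intro ideal_mpolyD(3)[OF J']) (auto simp: colon_def homogeneous_ideal_def)
    finally have "f - (a * s + 1 * g) \<in> J" .
    moreover have "a * s + 1 * g \<in> mpoly_vs.span (?A \<union> ?B)"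
      using subsetD[OF mpoly_vs.span_mono[OF Un_upper1] mult_mem_span[OF fin(1) s(1), of a]]
        subsetD[OF mpoly_vs.span_mono[OF Un_upper2] mult_mem_span[OF fin(2) g(1), of 1]]
      by (rule mpoly_vs.span_add)
    ultimately show "\<exists>x\<in>mpoly_vs.span (?A \<union> ?B). f - x \<in> J" by blast
  qed (use fin in auto)
  also have "\<dots> \<le> card S + card T"
    by (rule order_trans[OF card_Un_le]) (intro add_mono card_image_le fin)
  finally show ?thesis
    using hf_eq_card[OF V C S] hf_eq_card[OF V A T] by simp
qed

text \<open>\<open>small V J d\<close> expresses that the quotient by \<open>J\<close> has dimension at most \<open>d\<close>, in terms of the growth
  of the cumulative Hilbert function.\<close>

definition small :: "nat set \<Rightarrow> 'k::field mpoly set \<Rightarrow> nat \<Rightarrow> bool" where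
  "small V J d \<longleftrightarrow> (\<exists>c. \<forall>t. (\<Sum>u\<le>t. hf V J u) \<le> c * (t + 1) ^ d)"

lemma small_if_eventually_zero:
  assumes "\<And>t. t > 0 \<Longrightarrow> hf V J t = 0"
  shows "small V J d"
proof -
  have "(\<Sum>u\<le>t. hf V J u) \<le> hf V J 0 * (t + 1) ^ d" for t
  proof -
    have "(\<Sum>u\<le>t. hf V J u) = (\<Sum>u\<in>{0}. hf V J u)"
      using assms by (intro sum.mono_neutral_right) auto
    then show ?thesis by simp
  qed
  then show ?thesis unfolding small_def by blast
qed

lemma small_polys: "finite V \<Longrightarrow> small V (polys V) d"
  by (rule small_if_eventually_zero) (rule hf_polys)

text \<open>Subadditivity is summed over all degrees; the degree shift by \<open>d\<close> changes
  the constant but not the exponent.\<close>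

lemma small_of_colon_add_gen:
  fixes J :: "'k::field mpoly set"
  assumes V: "finite V" and J: "homogeneous_ideal V J" and a: "a \<in> graded_piece V d"
    and "small V (colon V J a) e" "small V (add_gen V J a) e"
  shows "small V J e"
proof -
  obtain c1 c2 where c1: "\<And>t. (\<Sum>u\<le>t. hf V (colon V J a) u) \<le> c1 * (t + 1) ^ e"
    and c2: "\<And>t. (\<Sum>u\<le>t. hf V (add_gen V J a) u) \<le> c2 * (t + 1) ^ e"
    using assms(4,5) unfolding small_def by blast
  \<comment> \<open>Accounts for the degrees below \<open>d\<close>, which subadditivity does not
    reach.\<close>
  let ?c0 = "\<Sum>u<d. hf V J u"
  have "(\<Sum>u\<le>t. hf V J u) \<le> (?c0 + c1 + c2 * (d + 1) ^ e) * (t + 1) ^ e" for t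
  proof -
    have shift: "(\<Sum>u\<le>t. f (u + d)) = (\<Sum>u\<in>{d..t + d}. f u)" for f :: "nat \<Rightarrow> nat"
      by (rule sum.reindex_bij_witness[of _ "\<lambda>u. u - d" "\<lambda>u. u + d"]) auto
    have "(\<Sum>u\<le>t. hf V J u) \<le> (\<Sum>u\<in>{..<d} \<union> {d..t + d}. hf V J u)"
      by (intro sum_mono2) auto
    also have "\<dots> = ?c0 + (\<Sum>u\<le>t. hf V J (u + d))"
      unfolding shift by (intro sum.union_disjoint) auto
    also have "(\<Sum>u\<le>t. hf V J (u + d)) \<le> (\<Sum>u\<le>t. hf V (colon V J a) u + hf V (add_gen V J a) (u + d))"
      by (intro sum_mono hf_subadditive[OF V J a])
    also have "\<dots> = (\<Sum>u\<le>t. hf V (colon V J a) u) + (\<Sum>u\<in>{d..t + d}. hf V (add_gen V J a) u)"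
      by (simp add: sum.distrib shift)
    also have "(\<Sum>u\<in>{d..t + d}. hf V (add_gen V J a) u) \<le> (\<Sum>u\<le>t + d. hf V (add_gen V J a) u)"
      by (intro sum_mono2) auto
    also have "\<dots> \<le> c2 * (t + d + 1) ^ e"
      by (rule c2)
    also have "\<dots> \<le> c2 * ((d + 1) * (t + 1)) ^ e"
      by (intro mult_left_mono power_mono) auto
    finally have "(\<Sum>u\<le>t. hf V J u) \<le>
        ?c0 + ((\<Sum>u\<le>t. hf V (colon V J a) u) + c2 * ((d + 1) * (t + 1)) ^ e)"
      by simp
    also have "\<dots> \<le> ?c0 * (t + 1) ^ e + (c1 * (t + 1) ^ e + c2 * ((d + 1) * (t + 1)) ^ e)"
      using c1[of t] by (intro add_mono) auto
    also have "\<dots> = (?c0 + c1 + c2 * (d + 1) ^ e) * (t + 1) ^ e"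
      unfolding power_mult_distrib by (simp only: distrib_right mult.assoc add.assoc)
    finally show ?thesis .
  qed
  then show ?thesis unfolding small_def by blast
qed

text \<open>Let \<open>P\<close> be maximal among homogeneous ideals above \<open>J\<close> that are
  not small. If \<open>a * b\<close> lies in \<open>P\<close> with homogeneous \<open>a\<close> and
  \<open>b\<close> outside \<open>P\<close>, then the colon ideal by \<open>a\<close>, which
  contains \<open>b\<close>, and the ideal with \<open>a\<close> adjoined are both strictly larger.
  So both are small, and then so is \<open>P\<close>.\<close>

lemma ex_prime_not_small:
  fixes J :: "'k::field mpoly set"
  assumes V: "finite V" and J: "homogeneous_ideal V J" and ns: "\<not> small V J d"
  obtains P where "homogeneous_ideal V P" "primeideal P (mpoly_ring V)" "J \<subseteq> P" "\<not> small V P d"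
proof -
  let ?F = "{P. homogeneous_ideal V P \<and> J \<subseteq> P \<and> \<not> small V P d}"
  obtain P where P: "P \<in> ?F" and max: "\<And>Q. Q \<in> ?F \<Longrightarrow> P \<subseteq> Q \<Longrightarrow> Q = P"
  proof (rule ex_maximal_ideal_in[OF V, of ?F J])
    show "J \<in> ?F" using J ns by simp
  qed (auto simp: homogeneous_ideal_def)
  have P': "homogeneous_ideal V P" "ideal P (mpoly_ring V)" "J \<subseteq> P" "\<not> small V P d"
    using P by (auto simp: homogeneous_ideal_def)
  have "primeideal P (mpoly_ring V)"
  proof (rule homogeneous_primeI[OF P'(1)])
    show "P \<noteq> polys V" using P'(4) small_polys[OF V] by blast
    fix s u a b assume a: "a \<in> graded_piece V s" and b: "b \<in> graded_piece V u" and ab: "a * b \<in> P"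
    have aV: "a \<in> polys V" and bV: "b \<in> polys V" using a b by (auto simp: graded_piece_def)
    show "a \<in> P \<or> b \<in> P"
    proof (rule ccontr)
      assume "\<not> ?thesis"
      then have "colon V P a \<noteq> P" "add_gen V P a \<noteq> P"
        using ab bV subset_add_gen(2)[OF P'(2), of a] by (auto simp: colon_def)
      then have "small V (colon V P a) d" "small V (add_gen V P a) d"
        using max[of "colon V P a"] max[of "add_gen V P a"] homogeneous_colon[OF P'(1) a]
          homogeneous_add_gen[OF P'(1) a] subset_colon[OF P'(2) aV] subset_add_gen(1)[OF P'(2), of a] P'(3)
        by auto
      then show False
        using small_of_colon_add_gen[OF V P'(1) a] P'(4) by blast
    qed
  qed
  then show ?thesis using that P' by blast
qed

text \<open>This is the irrelevant ideal, described by vanishing constant terms so that its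
  primality is immediate.\<close>

definition augmentation_ideal :: "nat set \<Rightarrow> 'k::comm_ring_1 mpoly set" where
  "augmentation_ideal V = {f \<in> polys V. hom_component 0 f = 0}"

lemma primeideal_augmentation: "primeideal (augmentation_ideal V :: 'k::field mpoly set) (mpoly_ring V)"
proof (rule primeidealI)
  show "ideal (augmentation_ideal V :: 'k mpoly set) (mpoly_ring V)"
    by (rule ideal_mpolyI)
      (auto simp: augmentation_ideal_def polys_zero polys_add polys_mult hom_component_add hom_component_mult)
  have "hom_component 0 (1 :: 'k mpoly) = 1"
    using hom_component_single[of 0 0 "1::'k"] by simp
  then have "(1 :: 'k mpoly) \<notin> augmentation_ideal V"
    by (simp add: augmentation_ideal_def)
  then show "polys V \<noteq> (augmentation_ideal V :: 'k mpoly set)"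
    using polys_one[of V] by blast
qed (auto simp: augmentation_ideal_def hom_component_mult cring_mpoly_ring, auto simp: mpoly_ring_def hom_component_mult)

lemma homogeneous_subset_augmentation:
  fixes P :: "'k::field mpoly set"
  assumes P: "homogeneous_ideal V P" "P \<noteq> polys V"
  shows "P \<subseteq> augmentation_ideal V"
proof
  fix f assume f: "f \<in> P"
  have P': "ideal P (mpoly_ring V)" using P by (simp add: homogeneous_ideal_def)
  have "hom_component 0 f = const (Poly_Mapping.lookup f 0)"
    by (rule poly_mapping_eqI)
      (auto simp: lookup_hom_component const_def lookup_single when_def mon_degree_eq_0_iff)
  moreover have "hom_component 0 f \<in> P"
    using P(1) f by (simp add: homogeneous_ideal_def)
  ultimately have "hom_component 0 f = 0"
    using ideal_const_unit[OF P'] P(2) const_simps(4) by metis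
  then show "f \<in> augmentation_ideal V"
    using f ideal_mpolyD(1)[OF P'] by (auto simp: augmentation_ideal_def)
qed

lemma hf_eq_0:
  fixes J :: "'k::field mpoly set"
  assumes "finite V" "ideal J (mpoly_ring V)" "graded_piece V t \<subseteq> J"
  shows "hf V J t = 0"
proof -
  have "mon_basis V J t {}"
    using assms(3) by (auto simp: mon_basis_def intro!: exI[of _ 0])
  then show ?thesis using hf_eq_card[OF assms(1,2)] by fastforce
qed

lemma small_augmentation: "finite V \<Longrightarrow> small V (augmentation_ideal V) d"
proof (intro small_if_eventually_zero hf_eq_0)
  fix t :: nat assume "t > 0"
  then show "graded_piece V t \<subseteq> augmentation_ideal V"
    using hom_component_graded_piece[of _ V t 0] by (auto simp: augmentation_ideal_def graded_piece_def)
qed (auto intro: primeideal.axioms(1)[OF primeideal_augmentation])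

lemma ex_var_notin:
  fixes P :: "'k::field mpoly set"
  assumes V: "finite V" and P: "ideal P (mpoly_ring V)" and "\<not> small V P d"
  obtains v where "v \<in> V" "var v \<notin> P"
proof (rule ccontr)
  assume no: "\<not> thesis"
  then have "var ` V \<subseteq> P" using that by blast
  then have sub: "Idl\<^bsub>mpoly_ring V\<^esub> (var ` V) \<subseteq> P"
    by (rule genideal_mpoly_subset[OF P])
  have "small V P d"
  proof (intro small_if_eventually_zero hf_eq_0[OF V P])
    fix t :: nat assume t: "t > 0"
    show "graded_piece V t \<subseteq> P"
    proof
      fix f :: "'k mpoly" assume f: "f \<in> graded_piece V t"
      have "Poly_Mapping.keys m \<inter> V \<noteq> {}" if "m \<in> Poly_Mapping.keys f" for m
      proof -
        have "mon_degree m = t" "Poly_Mapping.keys m \<subseteq> V"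
          using f that by (auto simp: graded_piece_def polys_iff)
        moreover from this t have "m \<noteq> 0" using mon_degree_eq_0_iff[of m] by auto
        then have "Poly_Mapping.keys m \<noteq> {}" by simp
        ultimately show ?thesis by blast
      qed
      then have "f \<in> Idl\<^bsub>mpoly_ring V\<^esub> (var ` V)"
        unfolding variable_ideal_eq[OF order_refl] using f by (simp add: graded_piece_def)
      then show "f \<in> P" using sub by blast
    qed
  qed
  then show False using assms(3) by blast
qed

text \<open>Each step replaces the ideal by a prime \<open>P\<close> above it that is not small,
  then adjoins a variable outside \<open>P\<close>, which lowers the growth exponent by at most one.
  At exponent 0, the prime lies strictly below the augmentation ideal, as the latter is small; this
  contributes the last inclusion.\<close>

lemma prime_chain_not_small:
  fixes J :: "'k::field mpoly set"
  assumes V: "finite V" and "homogeneous_ideal V J" "\<not> small V J d"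
  shows "\<exists>Q. (\<forall>i\<le>Suc d. primeideal (Q i) (mpoly_ring V) \<and> J \<subseteq> Q i) \<and> (\<forall>i<Suc d. Q i \<subset> Q (Suc i))"
  using assms(2,3)
proof (induction d arbitrary: J)
  case 0
  obtain P where P: "homogeneous_ideal V P" "primeideal P (mpoly_ring V)" "J \<subseteq> P" "\<not> small V P 0"
    using ex_prime_not_small[OF V 0] .
  have "P \<noteq> polys V" using P(4) small_polys[OF V] by blast
  then have "P \<subseteq> augmentation_ideal V"
    by (rule homogeneous_subset_augmentation[OF P(1)])
  moreover have "P \<noteq> augmentation_ideal V"
    using P(4) small_augmentation[OF V] by blast
  ultimately show ?case
    using P(2,3) primeideal_augmentation[of V, where 'k = 'k]
    by (intro exI[of _ "\<lambda>i. if i = 0 then P else augmentation_ideal V"]) auto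
next
  case (Suc d)
  obtain P where P: "homogeneous_ideal V P" "primeideal P (mpoly_ring V)" "J \<subseteq> P" "\<not> small V P (Suc d)"
    using ex_prime_not_small[OF V Suc.prems] .
  have P': "ideal P (mpoly_ring V)" using P(1) by (simp add: homogeneous_ideal_def)
  obtain v where v: "v \<in> V" "var v \<notin> P"
    using ex_var_notin[OF V P' P(4)] .
  have vg: "var v \<in> graded_piece V 1"
    unfolding var_def graded_piece_iff degree_monomials_def monomials_def using v(1) by auto
  have vV: "var v \<in> polys V" by (rule polys_var[OF v(1)])
  \<comment> \<open>As \<open>P\<close> is prime, \<open>var v\<close> is a nonzerodivisor modulo
    \<open>P\<close>.\<close>
  have colon: "colon V P (var v) = P"
  proof (rule antisym)
    show "colon V P (var v) \<subseteq> P"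
      using primeideal.I_prime[OF P(2) vV] v(2) by (auto simp: colon_def mpoly_ring_def)
  qed (rule subset_colon[OF P' vV])
  let ?Q = "add_gen V P (var v)"
  have "\<not> small V ?Q d"
  proof
    assume "small V ?Q d"
    then obtain c where c: "\<And>t. (\<Sum>u\<le>t. hf V ?Q u) \<le> c * (t + 1) ^ d"
      unfolding small_def by blast
    \<comment> \<open>With the colon ideal equal to \<open>P\<close>, subadditivity bounds the
      increase from \<open>t\<close> to \<open>t + 1\<close> by one value for \<open>?Q\<close>, so
      it telescopes; one more summation raises the exponent from \<open>d\<close> to
      \<open>Suc d\<close>.\<close>
    have bound: "hf V P t \<le> hf V P 0 + (\<Sum>u\<le>t. hf V ?Q u)" for t
    proof (induction t)
      case (Suc t)
      then show ?case using hf_subadditive[OF V P(1) vg, of t] colon by simp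
    qed simp
    have "(\<Sum>u\<le>t. hf V P u) \<le> (hf V P 0 + c) * (t + 1) ^ Suc d" for t
    proof -
      have "hf V P u \<le> (hf V P 0 + c) * (t + 1) ^ d" if "u \<le> t" for u
      proof -
        have "hf V P u \<le> hf V P 0 + c * (u + 1) ^ d"
          using bound[of u] c[of u] by simp
        also have "\<dots> \<le> hf V P 0 * (t + 1) ^ d + c * (t + 1) ^ d"
          using that by (intro add_mono mult_left_mono power_mono) auto
        finally show ?thesis by (simp add: algebra_simps)
      qed
      then have "(\<Sum>u\<le>t. hf V P u) \<le> (\<Sum>u\<le>t. (hf V P 0 + c) * (t + 1) ^ d)"
        by (intro sum_mono) simp
      then show ?thesis by (simp add: algebra_simps)
    qed
    then show False using P(4) unfolding small_def by blast
  qed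
  from Suc.IH[OF homogeneous_add_gen[OF P(1) vg] this] obtain Q where
    Q: "\<And>i. i \<le> Suc d \<Longrightarrow> primeideal (Q i) (mpoly_ring V) \<and> ?Q \<subseteq> Q i" "\<And>i. i < Suc d \<Longrightarrow> Q i \<subset> Q (Suc i)"
    by blast
  have PQ: "P \<subset> ?Q"
    using subset_add_gen[OF P', of "var v"] v(2) by blast
  let ?R = "\<lambda>i. case i of 0 \<Rightarrow> P | Suc i \<Rightarrow> Q i"
  have "primeideal (?R i) (mpoly_ring V) \<and> J \<subseteq> ?R i" if "i \<le> Suc (Suc d)" for i
    using that P(2,3) Q(1)[of "i - 1"] PQ by (cases i) auto
  moreover have "?R i \<subset> ?R (Suc i)" if "i < Suc (Suc d)" for i
    using that Q(1)[of 0] Q(2)[of "i - 1"] PQ by (cases i) auto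
  ultimately show ?case by blast
qed

section \<open>Finiteness of the Krull dimension\<close>

fun list_monomial :: "'a::comm_monoid_mult list \<Rightarrow> nat list \<Rightarrow> 'a" where
  "list_monomial (f # fs) (a # as) = f ^ a * list_monomial fs as"
| "list_monomial _ _ = 1"

lemma list_monomial_in_polys:
  "set fs \<subseteq> polys V \<Longrightarrow> list_monomial fs as \<in> polys V"
  by (induction fs as rule: list_monomial.induct) (auto intro: polys_mult polys_power polys_one)

lemma primeideal_power_mult:
  fixes P :: "'k::comm_ring_1 mpoly set"
  assumes P: "primeideal P (mpoly_ring V)" and f: "f \<in> polys V" "f \<notin> P" and g: "g \<in> polys V"
  shows "f ^ m * g \<in> P \<Longrightarrow> g \<in> P"
proof (induction m)
  case (Suc m)
  then have "f \<in> P \<or> f ^ m * g \<in> P"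
    using primeideal.I_prime[OF P f(1) polys_mult[OF polys_power[OF f(1)] g], of m]
    by (simp add: mpoly_ring_def mult.assoc)
  then show ?case using f(2) Suc.IH by blast
qed simp

text \<open>Dividing a relation by the smallest power of the first element that occurs in it, the remaining
  terms free of that element form a relation modulo the next prime of the chain.\<close>

lemma prime_chain_independent:
  fixes Q :: "nat \<Rightarrow> 'k::field mpoly set"
  assumes "\<And>i. i \<le> length fs \<Longrightarrow> primeideal (Q i) (mpoly_ring V)"
    and "\<And>i. i < length fs \<Longrightarrow> Q i \<subseteq> Q (Suc i) \<and> fs ! i \<in> Q (Suc i) \<and> fs ! i \<notin> Q i"
    and "finite E" "E \<noteq> {}" "\<And>a. a \<in> E \<Longrightarrow> length a = length fs" "\<And>a. a \<in> E \<Longrightarrow> c a \<noteq> 0"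
  shows "(\<Sum>a\<in>E. const (c a) * list_monomial fs a) \<notin> Q 0"
  using assms
proof (induction fs arbitrary: Q E c)
  case Nil
  then have E: "E = {[]}" by fastforce
  have Q: "primeideal (Q 0) (mpoly_ring V)" using Nil(1)[of 0] by simp
  \<comment> \<open>With no element left, the relation is a nonzero constant, which no proper ideal
    contains.\<close>
  have "const (c []) \<notin> Q 0"
    using ideal_const_unit[OF primeideal.axioms(1)[OF Q]] Nil(6) E primeideal.I_notcarr[OF Q] by blast
  then show ?case by (simp add: E)
next
  case (Cons f fs)
  have Q0: "primeideal (Q 0) (mpoly_ring V)" and Q1: "primeideal (Q (Suc 0)) (mpoly_ring V)"
    using Cons.prems(1)[of 0] Cons.prems(1)[of 1] by auto
  note I1 = primeideal.axioms(1)[OF Q1]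
  have f: "f \<in> Q (Suc 0)" "f \<notin> Q 0" "Q 0 \<subseteq> Q (Suc 0)"
    using Cons.prems(2)[of 0] by auto
  have "set (f # fs) \<subseteq> polys V"
  proof
    fix g assume "g \<in> set (f # fs)"
    then obtain i where i: "i < length (f # fs)" "g = (f # fs) ! i"
      by (metis in_set_conv_nth)
    then have "primeideal (Q (Suc i)) (mpoly_ring V)" "g \<in> Q (Suc i)"
      using Cons.prems(1)[of "Suc i"] Cons.prems(2)[of i] by simp_all
    then show "g \<in> polys V"
      using ideal_mpolyD(1)[OF primeideal.axioms(1), of "Q (Suc i)" V] by blast
  qed
  then have fV: "f \<in> polys V" and fsV: "set fs \<subseteq> polys V" by auto
  define m where "m = Min (hd ` E)"
  define E1 where "E1 = {a \<in> E. hd a = m}"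
  have m_le: "m \<le> hd a" if "a \<in> E" for a
    unfolding m_def using that Cons.prems(3) by (intro Min_le) auto
  have "m \<in> hd ` E"
    unfolding m_def using Cons.prems(3,4) by (intro Min_in) auto
  then have E1: "E1 \<noteq> {}" "finite E1" "E1 \<subseteq> E"
    using Cons.prems(3) by (auto simp: E1_def)
  have dest: "a = hd a # tl a" if "a \<in> E" for a
    using Cons.prems(5)[OF that] by (cases a) auto
  have lm: "list_monomial (f # fs) a = f ^ hd a * list_monomial fs (tl a)" if "a \<in> E" for a
    by (subst dest[OF that]) (simp only: list_monomial.simps)
  define X where "X = (\<Sum>a\<in>E1. const (c a) * list_monomial fs (tl a))"
  \<comment> \<open>One more factor \<open>f\<close> is split off from the terms with exponent above
    \<open>m\<close>, so that they contribute \<open>f * Y\<close>, which vanishes modulo the next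
    prime.\<close>
  define Y where "Y = (\<Sum>a\<in>E - E1. const (c a) * (f ^ (hd a - m - 1) * list_monomial fs (tl a)))"
  have XV: "X \<in> polys V"
    unfolding X_def by (rule polys_sum, rule polys_mult[OF polys_const list_monomial_in_polys[OF fsV]])
  have YV: "Y \<in> polys V"
    unfolding Y_def
    by (rule polys_sum, rule polys_mult[OF polys_const
          polys_mult[OF polys_power[OF fV] list_monomial_in_polys[OF fsV]]])
  have "(\<Sum>a\<in>E. const (c a) * list_monomial (f # fs) a) =
      (\<Sum>a\<in>E1. const (c a) * list_monomial (f # fs) a) + (\<Sum>a\<in>E - E1. const (c a) * list_monomial (f # fs) a)"
    by (subst sum.subset_diff[OF E1(3) Cons.prems(3)]) (rule add.commute)
  also have "(\<Sum>a\<in>E1. const (c a) * list_monomial (f # fs) a) = f ^ m * X"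
    unfolding X_def sum_distrib_left
    by (intro sum.cong refl) (use lm in \<open>auto simp: E1_def mult_ac\<close>)
  also have "(\<Sum>a\<in>E - E1. const (c a) * list_monomial (f # fs) a) = f ^ m * (f * Y)"
    unfolding Y_def sum_distrib_left
  proof (intro sum.cong refl)
    fix a assume a: "a \<in> E - E1"
    then have "m < hd a" using m_le[of a] by (auto simp: E1_def)
    then have "f ^ hd a = f ^ m * (f * f ^ (hd a - m - 1))"
      by (simp flip: power_Suc power_add)
    then show "const (c a) * list_monomial (f # fs) a =
        f ^ m * (f * (const (c a) * (f ^ (hd a - m - 1) * list_monomial fs (tl a))))"
      using lm[of a] a by (simp add: mult_ac)
  qed
  finally have split: "(\<Sum>a\<in>E. const (c a) * list_monomial (f # fs) a) = f ^ m * (X + f * Y)"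
    by (simp add: algebra_simps)
  show ?case
  proof
    assume "(\<Sum>a\<in>E. const (c a) * list_monomial (f # fs) a) \<in> Q 0"
    then have "X + f * Y \<in> Q 0"
      unfolding split using primeideal_power_mult[OF Q0 fV f(2)] XV YV fV by (blast intro: polys_add polys_mult)
    then have "X + f * Y - f * Y \<in> Q (Suc 0)"
      using f(1,3) YV by (intro ideal_mpolyD(7)[OF I1] ideal_mpolyD(5)[OF I1]) auto
    then have "X \<in> Q (Suc 0)" by simp
    \<comment> \<open>All lists in \<open>E1\<close> have the same head \<open>m\<close>, so
      removing it merges no terms and their coefficients stay nonzero.\<close>
    have inj: "inj_on tl E1"
    proof (rule inj_onI)
      fix a b assume "a \<in> E1" "b \<in> E1" "tl a = tl b"
      then show "a = b" using dest[of a] dest[of b] by (auto simp: E1_def)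
    qed
    have "X = (\<Sum>b\<in>tl ` E1. const (c (m # b)) * list_monomial fs b)"
      unfolding X_def sum.reindex[OF inj] o_def
      by (intro sum.cong refl) (use dest in \<open>auto simp: E1_def\<close>)
    also have "\<dots> \<notin> Q (Suc 0)"
    proof (rule Cons.IH[of "\<lambda>i. Q (Suc i)"])
      fix b assume "b \<in> tl ` E1"
      then obtain a where a: "a \<in> E1" "b = tl a" by blast
      then show "length b = length fs" "c (m # b) \<noteq> 0"
        using Cons.prems(5,6)[of a] dest[of a] by (auto simp: E1_def)
    qed (use E1 Cons.prems(1,2) in force)+
    finally show False using \<open>X \<in> Q (Suc 0)\<close> by simp
  qed
qed

section \<open>Counting monomials to bound the length of prime chains\<close>

definition exponents_le :: "nat \<Rightarrow> 'k::comm_ring_1 mpoly \<Rightarrow> bool" where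
  "exponents_le M p \<longleftrightarrow> (\<forall>m\<in>Poly_Mapping.keys p. \<forall>i. Poly_Mapping.lookup m i \<le> M)"

lemma exponents_le_mult: "exponents_le M p \<Longrightarrow> exponents_le N q \<Longrightarrow> exponents_le (M + N) (p * q)"
  unfolding exponents_le_def
proof (intro ballI allI)
  fix m i assume *: "\<forall>m\<in>Poly_Mapping.keys p. \<forall>i. Poly_Mapping.lookup m i \<le> M"
    "\<forall>m\<in>Poly_Mapping.keys q. \<forall>i. Poly_Mapping.lookup m i \<le> N" "m \<in> Poly_Mapping.keys (p * q)"
  then obtain a b where "a \<in> Poly_Mapping.keys p" "b \<in> Poly_Mapping.keys q" "m = a + b"
    using keys_mult[of p q] by blast
  then show "Poly_Mapping.lookup m i \<le> M + N"
    using * by (auto simp: lookup_add intro: add_mono)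
qed

lemma exponents_le_one: "exponents_le M 1"
  by (simp add: exponents_le_def)

lemma exponents_le_power: "exponents_le M p \<Longrightarrow> exponents_le (k * M) (p ^ k)"
  by (induction k) (auto intro: exponents_le_one exponents_le_mult)

lemma exponents_le_mono: "exponents_le M p \<Longrightarrow> M \<le> N \<Longrightarrow> exponents_le N p"
  by (auto simp: exponents_le_def intro: order_trans)

lemma exponents_le_list_monomial:
  assumes "\<And>f. f \<in> set fs \<Longrightarrow> exponents_le D f" "\<And>a. a \<in> set as \<Longrightarrow> a \<le> N"
  shows "exponents_le (length fs * (N * D)) (list_monomial fs as)"
  using assms
proof (induction fs as rule: list_monomial.induct)
  case (1 f fs a as)
  have "exponents_le (a * D) (f ^ a)"
    using 1 by (intro exponents_le_power) auto
  then have "exponents_le (N * D) (f ^ a)"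
    by (rule exponents_le_mono) (use 1 in auto)
  then have "exponents_le (N * D + length fs * (N * D)) (f ^ a * list_monomial fs as)"
    using 1 by (intro exponents_le_mult) auto
  then show ?case by simp
qed (auto intro: exponents_le_one)

lemma ex_exponents_le: "\<exists>D. exponents_le D p"
  unfolding exponents_le_def
  using exists_degree_bound[of p] lookup_le_mon_degree order_trans by blast

lemma ex_common_exponents_le:
  "\<exists>D. \<forall>f\<in>set fs. exponents_le D f"
proof (induction fs)
  case (Cons f fs)
  then obtain D D' where "\<forall>f\<in>set fs. exponents_le D f" "exponents_le D' f"
    using ex_exponents_le by blast
  then have "\<forall>g\<in>set (f # fs). exponents_le (max D D') g"
    using exponents_le_mono max.cobounded1 max.cobounded2 by (metis set_ConsD)
  then show ?case by blast
qed simp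

text \<open>Choosing an element of each prime outside its predecessor gives algebraically
  independent polynomials. If there were \<open>card V + 1\<close> of them, their power products
  would be independent and would eventually outnumber the monomials available in their span.\<close>

lemma prime_chain_length:
  fixes Q :: "nat \<Rightarrow> 'k::field mpoly set"
  assumes V: "finite V" and Q: "\<And>i. i \<le> k \<Longrightarrow> primeideal (Q i) (mpoly_ring V)"
    and strict: "\<And>i. i < k \<Longrightarrow> Q i \<subset> Q (Suc i)"
  shows "k \<le> card V"
proof (rule ccontr)
  assume "\<not> ?thesis"
  then have k: "Suc (card V) \<le> k" by simp
  let ?n = "card V"
  have "\<exists>f. f \<in> Q (Suc i) \<and> f \<notin> Q i" if "i < k" for i
    using strict[OF that] by blast
  then obtain F where F: "\<And>i. i < k \<Longrightarrow> F i \<in> Q (Suc i) \<and> F i \<notin> Q i"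
    by metis
  define fs where "fs = map F [0..<Suc ?n]"
  have len: "length fs = Suc ?n" by (simp add: fs_def)
  have fs: "fs ! i = F i" if "i < Suc ?n" for i
    unfolding fs_def using that by (metis add_0 diff_zero length_upt nth_map nth_upt)
  have fsV: "set fs \<subseteq> polys V"
  proof
    fix f assume "f \<in> set fs"
    then obtain i where "i < Suc ?n" "f = F i"
      using fs len by (metis in_set_conv_nth)
    then show "f \<in> polys V"
      using F[of i] k ideal_mpolyD(1)[OF primeideal.axioms(1)[OF Q[of "Suc i"]]] by auto
  qed
  obtain D where D: "\<And>f. f \<in> set fs \<Longrightarrow> exponents_le D f"
    using ex_common_exponents_le by blast
  \<comment> \<open>\<open>D\<close> bounds the exponents in the chosen polynomials, hence
    \<open>M\<close> strictly bounds those in power products with exponents below \<open>N\<close>.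
    As \<open>M \<le> N * B\<close>, at most \<open>N ^ ?n * B ^ ?n\<close> monomials occur, fewer
    than the \<open>N ^ Suc ?n\<close> products because \<open>N > B ^ ?n\<close>.\<close>
  define B where "B = Suc ?n * D + 1"
  define N where "N = B ^ ?n + 1"
  define M where "M = Suc ?n * (N * D) + 1"
  let ?\<phi> = "list_monomial fs"
  let ?E = "{a. set a \<subseteq> {..<N} \<and> length a = Suc ?n}"
  have indep: "(\<Sum>a\<in>E. const (c a) * ?\<phi> a) \<noteq> 0"
    if E: "E \<subseteq> ?E" "finite E" "E \<noteq> {}" "\<And>a. a \<in> E \<Longrightarrow> c a \<noteq> 0" for E and c :: "nat list \<Rightarrow> 'k"
  proof -
    have "(\<Sum>a\<in>E. const (c a) * ?\<phi> a) \<notin> Q 0"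
    proof (rule prime_chain_independent[of fs Q V])
      show "primeideal (Q i) (mpoly_ring V)" if "i \<le> length fs" for i
        using that len k Q by simp
      show "Q i \<subseteq> Q (Suc i) \<and> fs ! i \<in> Q (Suc i) \<and> fs ! i \<notin> Q i" if "i < length fs" for i
        using that len k F[of i] strict[of i] fs[of i] by auto
    qed (use E len in auto)
    moreover have "0 \<in> Q 0"
      by (rule ideal_mpolyD(2)[OF primeideal.axioms(1)[OF Q]]) simp
    ultimately show ?thesis by metis
  qed
  have finE: "finite ?E" by (rule finite_lists_length_eq) simp
  have inj: "inj_on ?\<phi> ?E"
  proof (rule inj_onI, rule ccontr)
    fix a b assume ab: "a \<in> ?E" "b \<in> ?E" "?\<phi> a = ?\<phi> b" "a \<noteq> b"
    \<comment> \<open>Two equal products would give a relation with coefficients 1 and -1.\<close>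
    have "(\<Sum>x\<in>{a, b}. const (if x = a then 1 else - 1 :: 'k) * ?\<phi> x) \<noteq> 0"
      by (rule indep) (use ab in auto)
    then show False using ab by (simp add: const_simps)
  qed
  have "mpoly_vs.independent (?\<phi> ` ?E)"
    unfolding mpoly_vs.independent_explicit_module
  proof (intro allI impI, rule ccontr)
    fix T u v assume T: "finite T" "T \<subseteq> ?\<phi> ` ?E" "(\<Sum>v\<in>T. const (u v) * v) = 0" "v \<in> T" "u v \<noteq> 0"
    \<comment> \<open>The support of the relation, pulled back to exponent lists; zero coefficients
      are discarded as \<open>indep\<close> requires.\<close>
    let ?X = "{a \<in> ?E. ?\<phi> a \<in> T \<and> u (?\<phi> a) \<noteq> 0}"
    have img: "?\<phi> ` ?X = {w \<in> T. u w \<noteq> 0}"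
      using T(2) by blast
    have "(\<Sum>a\<in>?X. const (u (?\<phi> a)) * ?\<phi> a) = (\<Sum>w\<in>?\<phi> ` ?X. const (u w) * w)"
      by (subst sum.reindex[OF inj_on_subset[OF inj]]) auto
    also have "\<dots> = (\<Sum>w\<in>T. const (u w) * w)"
      unfolding img using T(1) by (intro sum.mono_neutral_left) (auto simp: const_simps)
    finally have "(\<Sum>a\<in>?X. const (u (?\<phi> a)) * ?\<phi> a) = 0"
      using T(3) by simp
    moreover have "(\<Sum>a\<in>?X. const (u (?\<phi> a)) * ?\<phi> a) \<noteq> 0"
    proof (rule indep)
      show "?X \<noteq> {}" using img T(4,5) by blast
      show "finite ?X" using finE by (rule rev_finite_subset) blast
    qed blast+
    ultimately show False by simp
  qed
  moreover
  let ?T = "{m \<in> monomials V. \<forall>i\<in>V. Poly_Mapping.lookup m i < M}"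
  let ?S = "(\<lambda>m. 1 * Poly_Mapping.single m (1::'k)) ` ?T"
  have finT: "finite ?T" by (rule bounded_monomials(1)[OF V])
  have "?\<phi> ` ?E \<subseteq> mpoly_vs.span ?S"
  proof safe
    fix a assume a: "set a \<subseteq> {..<N}" "length a = Suc ?n"
    have "exponents_le (length fs * (N * D)) (?\<phi> a)"
      using a(1) by (intro exponents_le_list_monomial D) auto
    then have "Poly_Mapping.keys (?\<phi> a) \<subseteq> ?T"
      using list_monomial_in_polys[OF fsV, of a] unfolding len
      by (auto simp: exponents_le_def M_def mpoly_ring_def less_Suc_eq_le)
    then have "1 * ?\<phi> a \<in> mpoly_vs.span ?S"
      by (rule mult_mem_span[OF finT])
    then show "?\<phi> a \<in> mpoly_vs.span ?S" by simp
  qed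
  ultimately have "card (?\<phi> ` ?E) \<le> card ?S"
    using mpoly_vs.independent_span_bound[of ?S "?\<phi> ` ?E"] finT by blast
  also have "\<dots> \<le> card ?T"
    by (rule card_image_le[OF finT])
  also have "\<dots> \<le> M ^ ?n"
    by (rule bounded_monomials(2)[OF V])
  also have "\<dots> \<le> (N * B) ^ ?n"
  proof (rule power_mono)
    have "1 \<le> N" by (simp add: N_def)
    then show "M \<le> N * B" by (simp add: M_def B_def algebra_simps)
  qed simp
  also have "\<dots> = N ^ ?n * B ^ ?n" by (rule power_mult_distrib)
  also have "\<dots> < N ^ ?n * N" by (simp add: N_def)
  also have "\<dots> = card ?E"
    by (simp add: card_lists_length_eq)
  also have "\<dots> = card (?\<phi> ` ?E)"
    by (rule card_image[OF inj, symmetric])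
  finally show False by simp
qed

section \<open>Transfer of prime chains to the quotient ring\<close>

lemma quotient_prime_chain:
  fixes I :: "'k::field mpoly set"
  assumes I: "ideal I (mpoly_ring V)" and P: "primeideal P (mpoly_ring V)" and sub: "I \<subseteq> P"
  shows "primeideal ((\<lambda>f. I +>\<^bsub>mpoly_ring V\<^esub> f) ` P) (mpoly_ring V Quot I)"
    and "r \<in> polys V \<Longrightarrow> I +>\<^bsub>mpoly_ring V\<^esub> r \<in> (\<lambda>f. I +>\<^bsub>mpoly_ring V\<^esub> f) ` P \<longleftrightarrow> r \<in> P"
proof -
  let ?R = "mpoly_ring V :: 'k mpoly ring"
  let ?h = "\<lambda>f. I +>\<^bsub>?R\<^esub> f"
  interpret h: ring_hom_ring ?R "?R Quot I" ?h
    by (rule ideal.rcos_ring_hom_ring[OF I])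
  note IP = primeideal.axioms(1)[OF P]
  have mem: "?h r \<in> ?h ` P \<longleftrightarrow> r \<in> P" if r: "r \<in> polys V" for r
  proof
    assume "?h r \<in> ?h ` P"
    then obtain p where p: "p \<in> P" "?h r = ?h p" by blast
    then have "r - p \<in> P" using coset_eq_iff[OF I, of r p] sub by auto
    then have "r - p + p \<in> P" using p(1) by (rule ideal_mpolyD(3)[OF IP])
    then show "r \<in> P" by simp
  qed blast
  then show "r \<in> polys V \<Longrightarrow> ?h r \<in> ?h ` P \<longleftrightarrow> r \<in> P" .
  have carr: "carrier (?R Quot I) = ?h ` polys V"
    unfolding FactRing_def A_RCOSETS_def' by auto
  show "primeideal (?h ` P) (?R Quot I)"
  proof (rule primeidealI)
    show "ideal (?h ` P) (?R Quot I)"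
      by (rule h.R.ring_ideal_imp_quot_ideal[OF I IP])
    show "cring (?R Quot I)"
      by (rule ideal.quotient_is_cring[OF I cring_mpoly_ring])
    have "1 \<notin> P"
      using primeideal.I_notcarr[OF P] ideal_eq_polys_iff[OF IP] by blast
    then have "?h 1 \<notin> ?h ` P" using mem[OF polys_one] by blast
    then show "carrier (?R Quot I) \<noteq> ?h ` P"
      unfolding carr using polys_one[of V] by blast
    fix x y assume "x \<in> carrier (?R Quot I)" "y \<in> carrier (?R Quot I)" and xy: "x \<otimes>\<^bsub>?R Quot I\<^esub> y \<in> ?h ` P"
    then obtain a b where ab: "a \<in> polys V" "b \<in> polys V" "x = ?h a" "y = ?h b"
      unfolding carr by blast
    have "x \<otimes>\<^bsub>?R Quot I\<^esub> y = ?h (a \<otimes>\<^bsub>?R\<^esub> b)"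
      using h.hom_mult[OF ab(1,2)] ab(3,4) by simp
    then have "a \<otimes>\<^bsub>?R\<^esub> b \<in> P"
      using mem[of "a \<otimes>\<^bsub>?R\<^esub> b"] h.R.m_closed[OF ab(1,2)] xy by simp
    then show "x \<in> ?h ` P \<or> y \<in> ?h ` P"
      using primeideal.I_prime[OF P ab(1,2)] ab(3,4) by blast
  qed
qed

text \<open>Pulling prime chains back from the quotient bounds the supremum by
  \<open>card V\<close>, so it is finite and \<open>the_enat\<close> recovers it. The given chain is
  then pushed down to the quotient.\<close>

lemma chain_length_le_quotient_dim:
  fixes I :: "'k::field mpoly set"
  assumes V: "finite V" and I: "ideal I (mpoly_ring V)"
    and Q: "\<And>i. i \<le> k \<Longrightarrow> primeideal (Q i) (mpoly_ring V) \<and> I \<subseteq> Q i" "\<And>i. i < k \<Longrightarrow> Q i \<subset> Q (Suc i)"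
  shows "k \<le> quotient_dim V I"
proof -
  let ?R = "mpoly_ring V :: 'k mpoly ring"
  let ?h = "\<lambda>f. I +>\<^bsub>?R\<^esub> f"
  interpret h: ring_hom_ring ?R "?R Quot I" ?h
    by (rule ideal.rcos_ring_hom_ring[OF I])
  let ?chain = "\<lambda>k P. (\<forall>i\<le>k. primeideal (P i) (?R Quot I)) \<and> (\<forall>i<k. P i \<subset> P (Suc i))"
  have carr: "carrier (?R Quot I) = ?h ` polys V"
    unfolding FactRing_def A_RCOSETS_def' by auto
  have "krull_dim (?R Quot I) \<le> enat (card V)"
    unfolding krull_dim_def
  proof (rule Sup_least)
    fix x assume "x \<in> {enat l | l. \<exists>P. ?chain l P}"
    then obtain l P where x: "x = enat l" and P: "\<And>i. i \<le> l \<Longrightarrow> primeideal (P i) (?R Quot I)"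
      "\<And>i. i < l \<Longrightarrow> P i \<subset> P (Suc i)"
      by blast
    have "l \<le> card V"
    proof (rule prime_chain_length[OF V, of l "\<lambda>i. {r \<in> polys V. ?h r \<in> P i}"])
      show "primeideal {r \<in> polys V. ?h r \<in> P i} ?R" if "i \<le> l" for i
        by (rule h.primeideal_vimage[OF cring_mpoly_ring P(1)[OF that]])
      show "{r \<in> polys V. ?h r \<in> P i} \<subset> {r \<in> polys V. ?h r \<in> P (Suc i)}" if i: "i < l" for i
      proof -
        obtain y where y: "y \<in> P (Suc i)" "y \<notin> P i" using P(2)[OF i] by blast
        have "P (Suc i) \<subseteq> carrier (?R Quot I)"
          using ideal.axioms(1)[OF primeideal.axioms(1)[OF P(1)[of "Suc i"]]] i
          by (intro additive_subgroup.a_subset) simp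
        then obtain r where "r \<in> polys V" "y = ?h r" using y(1) unfolding carr by blast
        then show ?thesis using y P(2)[OF i] by blast
      qed
    qed
    then show "x \<le> enat (card V)" by (simp add: x)
  qed
  then obtain d where d: "krull_dim (?R Quot I) = enat d"
    using enat_ile by blast
  have "?chain k (\<lambda>i. ?h ` Q i)"
  proof (intro conjI allI impI)
    show "primeideal (?h ` Q i) (?R Quot I)" if "i \<le> k" for i
      using Q(1)[OF that] by (intro quotient_prime_chain(1)[OF I]) auto
    fix i assume i: "i < k"
    obtain r where r: "r \<in> Q (Suc i)" "r \<notin> Q i" using Q(2)[OF i] by blast
    have "r \<in> polys V"
      using r(1) Q(1)[of "Suc i"] i ideal_mpolyD(1)[OF primeideal.axioms(1)] by (meson Suc_leI subsetD)
    then have "?h r \<notin> ?h ` Q i"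
      using quotient_prime_chain(2)[OF I, of "Q i" r] Q(1)[of i] i r(2) by simp
    then show "?h ` Q i \<subset> ?h ` Q (Suc i)"
      using r(1) Q(2)[OF i] by blast
  qed
  then have "\<exists>P. ?chain k P" by (rule exI[where x = "\<lambda>i. ?h ` Q i"])
  then have "enat k \<le> krull_dim (?R Quot I)"
    unfolding krull_dim_def by (intro Sup_upper CollectI exI[of _ k] conjI refl)
  then show ?thesis unfolding quotient_dim_def d by simp
qed

section \<open>Hilbert series and Hilbert polynomials in binomial form\<close>

text \<open>A nonzero natural coefficient makes \<open>t choose k\<close> a lower bound for the
  Hilbert function. The cumulative sums are then at least binomials with lower index
  \<open>k + 1\<close>, which outgrow exponent \<open>d\<close> if \<open>d \<le> k\<close>.\<close>

lemma binomial_coeff_small: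
  fixes J :: "'k::field mpoly set"
  assumes small: "small V J d" and hf: "\<And>t. hf V J t = (\<Sum>k<e. a k * (t choose k))"
    and k: "k < e" "a k \<noteq> 0"
  shows "k < d"
proof (rule ccontr)
  assume "\<not> k < d"
  then have dk: "d \<le> k" by simp
  obtain c where c: "\<And>t. (\<Sum>u\<le>t. hf V J u) \<le> c * (t + 1) ^ d"
    using small unfolding small_def by blast
  have le: "(Suc t choose Suc k) \<le> c * (Suc t) ^ d" for t
  proof -
    have "(u choose k) \<le> hf V J u" for u
    proof -
      have "(u choose k) \<le> a k * (u choose k)" using k(2) by simp
      also have "\<dots> \<le> hf V J u"
        unfolding hf by (rule member_le_sum) (use k(1) in auto)
      finally show ?thesis .
    qed
    then have "(\<Sum>u\<le>t. u choose k) \<le> (\<Sum>u\<le>t. hf V J u)"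
      by (intro sum_mono)
    also have "\<dots> \<le> c * (t + 1) ^ d" by (rule c)
    finally show ?thesis
      using sum_lessThan_choose[of k "Suc t"] by (simp add: lessThan_Suc_atMost)
  qed
  \<comment> \<open>With \<open>t = Suc k * s\<close>, the lower bound for the binomial becomes
    \<open>s ^ Suc k\<close> and the upper bound \<open>B * s ^ d\<close>; since
    \<open>d \<le> k\<close>, the choice \<open>s = B + 1\<close> is contradictory.\<close>
  define B where "B = c * Suc k ^ d"
  define s where "s = B + 1"
  define t where "t = Suc k * s"
  have t: "t > 0" "Suc k \<le> t" by (auto simp: t_def s_def)
  have "real t / real (Suc k) = real s"
    unfolding t_def of_nat_mult by (rule nonzero_mult_div_cancel_left) simp
  then have "real (s ^ Suc k) = (real t / real (Suc k)) ^ Suc k"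
    by simp
  also have "\<dots> \<le> real (t choose Suc k)"
    by (rule binomial_ge_n_over_k_pow_k[OF t(2)])
  finally have "s ^ Suc k \<le> (t choose Suc k)"
    by (simp only: of_nat_le_iff)
  also have "\<dots> \<le> c * t ^ d"
    using le[of "t - 1"] t(1) by simp
  also have "\<dots> = B * s ^ d"
    by (simp only: t_def B_def power_mult_distrib mult.assoc)
  also have "\<dots> \<le> B * s ^ k"
    using dk by (intro mult_left_mono power_increasing) (auto simp: s_def)
  finally have "s * s ^ k \<le> B * s ^ k" by simp
  then show False by (simp add: s_def)
qed

lemma fps_binomial: "Abs_fps (\<lambda>t. int (t choose k)) * (1 - fps_X) ^ Suc k = fps_X ^ k"
proof (induction k)
  case 0
  show ?case
    by (rule fps_ext) (auto simp: right_diff_distrib fps_mult_fps_X_commute)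
next
  case (Suc k)
  have "Abs_fps (\<lambda>t. int (t choose Suc k)) * (1 - fps_X) = fps_X * Abs_fps (\<lambda>t. int (t choose k))"
  proof (rule fps_ext)
    fix n
    show "fps_nth (Abs_fps (\<lambda>t. int (t choose Suc k)) * (1 - fps_X)) n =
        fps_nth (fps_X * Abs_fps (\<lambda>t. int (t choose k))) n"
      by (cases n) (simp_all add: right_diff_distrib)
  qed
  then have "Abs_fps (\<lambda>t. int (t choose Suc k)) * (1 - fps_X) * (1 - fps_X) ^ Suc k =
      fps_X * Abs_fps (\<lambda>t. int (t choose k)) * (1 - fps_X) ^ Suc k"
    by (rule arg_cong)
  then show ?case
    unfolding power_Suc[of _ "Suc k"] mult.assoc Suc.IH by simp
qed

text \<open>A summand \<open>a k * (t choose k)\<close> contributes \<open>a k\<close> times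
  \<open>X ^ k * (1 - X) ^ (d - 1 - k)\<close> to the numerator, of degree at most
  \<open>d - 1\<close>.\<close>

lemma binomial_series_numerator:
  assumes f: "\<And>t. f t = (\<Sum>k<e. a k * (t choose k))" and a: "\<And>k. k < e \<Longrightarrow> a k \<noteq> 0 \<Longrightarrow> k < d"
    and "d > 0"
  obtains h :: "int poly" where
    "Abs_fps (\<lambda>t. int (f t)) * (1 - fps_X) ^ d = fps_of_poly h" "Polynomial.degree h < d"
proof
  let ?A = "\<lambda>k. Abs_fps (\<lambda>t. int (t choose k))"
  \<comment> \<open>Indices with zero coefficient are dropped, because for them \<open>k < d\<close>
    may fail and \<open>d - Suc k\<close> would be truncated.\<close>
  let ?K = "{k. k < e \<and> a k \<noteq> 0}"
  define h where "h = (\<Sum>k\<in>?K. Polynomial.smult (int (a k)) (Polynomial.monom 1 k * [:1, -1:] ^ (d - Suc k)))"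
  have fps: "Abs_fps (\<lambda>t. int (f t)) = (\<Sum>k\<in>?K. fps_const (int (a k)) * ?A k)"
  proof (rule fps_ext)
    fix n
    have "int (f n) = (\<Sum>k<e. int (a k) * int (n choose k))"
      by (simp add: f)
    also have "\<dots> = (\<Sum>k\<in>?K. int (a k) * int (n choose k))"
      by (intro sum.mono_neutral_right) auto
    finally show "fps_nth (Abs_fps (\<lambda>t. int (f t))) n = fps_nth (\<Sum>k\<in>?K. fps_const (int (a k)) * ?A k) n"
      by (simp add: fps_sum_nth)
  qed
  have "?A k * (1 - fps_X) ^ d = fps_of_poly (Polynomial.monom 1 k * [:1, -1:] ^ (d - Suc k))" if "k \<in> ?K" for k
  proof -
    have "k < d" using a that by blast
    then have "d = Suc k + (d - Suc k)" by simp
    then have "?A k * (1 - fps_X) ^ d = ?A k * (1 - fps_X) ^ Suc k * (1 - fps_X) ^ (d - Suc k)"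
      by (metis mult.assoc power_add)
    also have "\<dots> = fps_X ^ k * (1 - fps_X) ^ (d - Suc k)"
      by (simp only: fps_binomial)
    also have "\<dots> = fps_of_poly (Polynomial.monom 1 k * [:1, -1:] ^ (d - Suc k))"
      by (simp add: fps_of_poly_mult fps_of_poly_power fps_of_poly_pCons fps_of_poly_monom')
    finally show ?thesis .
  qed
  then show "Abs_fps (\<lambda>t. int (f t)) * (1 - fps_X) ^ d = fps_of_poly h"
    unfolding fps h_def sum_distrib_right fps_of_poly_sum
    by (intro sum.cong refl) (simp add: fps_of_poly_smult mult.assoc)
  have "Polynomial.degree h \<le> d - 1"
    unfolding h_def
  proof (rule degree_sum_le)
    fix k assume k: "k \<in> ?K"
    then have "k < d" using a by blast
    have "Polynomial.degree (Polynomial.monom (1::int) k * [:1, -1:] ^ (d - Suc k)) \<le> k + (d - Suc k)"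
      by (rule order_trans[OF degree_mult_le])
        (intro add_mono degree_monom_le order_trans[OF degree_power_le], simp)
    then show "Polynomial.degree (Polynomial.smult (int (a k)) (Polynomial.monom 1 k * [:1, -1:] ^ (d - Suc k))) \<le> d - 1"
      using \<open>k < d\<close> by (intro order_trans[OF degree_smult_le]) simp
  qed simp
  then show "Polynomial.degree h < d" using \<open>d > 0\<close> by simp
qed

text \<open>The binomial coefficient \<open>t choose k\<close> is the product of
  \<open>t - i\<close> over \<open>i < k\<close>, divided by \<open>fact k\<close>.\<close>

lemma binomial_sum_poly:
  obtains p :: "rat poly" where "\<And>t::nat. poly p (of_nat t) = of_nat (\<Sum>k<e. a k * (t choose k))"
proof
  let ?p = "\<Sum>k<e. Polynomial.smult (of_nat (a k) / fact k) (\<Prod>i = 0..<k. [:- of_nat i, 1:]) :: rat poly"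
  fix t :: nat
  have choose: "rat_of_nat (t choose k) = (\<Prod>i = 0..<k. - of_nat i + of_nat t) / fact k" for k
    by (simp only: binomial_gbinomial gbinomial_prod_rev uminus_add_conv_diff)
  have "poly (\<Prod>i = 0..<k. [:- of_nat i, 1:]) (rat_of_nat t) = (\<Prod>i = 0..<k. - of_nat i + of_nat t)" for k
    by (simp add: poly_prod)
  then show "poly ?p (of_nat t) = of_nat (\<Sum>k<e. a k * (t choose k))"
    unfolding poly_sum of_nat_sum of_nat_mult choose
    by (simp only: poly_smult times_divide_eq_left times_divide_eq_right)
qed

lemma eventually_eq_poly_unique:
  fixes p q :: "rat poly"
  assumes "\<forall>\<^sub>F t in sequentially. poly p (of_nat t) = poly q (of_nat t)"
  shows "p = q"
proof (rule ccontr)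
  assume "p \<noteq> q"
  then have "finite {x. poly (p - q) x = 0}"
    by (intro poly_roots_finite) simp
  moreover obtain N where "\<And>t. t \<ge> N \<Longrightarrow> poly p (of_nat t) = poly q (of_nat t)"
    using assms unfolding eventually_sequentially by blast
  then have "of_nat ` {N..} \<subseteq> {x. poly (p - q) x = 0}"
    by auto
  ultimately have "finite (of_nat ` {N..} :: rat set)"
    by (rule rev_finite_subset)
  then have "finite {N..}"
    by (rule finite_imageD) (simp add: inj_on_def)
  then show False by (simp add: infinite_Ici)
qed

theorem proposition5p12:
  fixes n :: nat
    and I :: "'k::{alg_closed_field, field_char_0} mpoly set"
  assumes "n \<ge> 1"
    and "homogeneous_ideal {1..n} I"
    and "I \<noteq> carrier (mpoly_ring {1..n})"
    and "gvd {1..n} I"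
    and "csat_gvd {1..n} I"
  shows "a_invariant {1..n} I < 0 \<and> hilbertian {1..n} I"
proof -
  let ?V = "{1..n}"
  have I: "ideal I (mpoly_ring ?V)"
    using assms(2) by (simp add: homogeneous_ideal_def)
  have HF: "hilbert_function ?V I t = hf ?V I t" for t
    by (rule hilbert_function_eq_hf[OF _ I assms(3)]) simp
  obtain a e where hf: "\<And>t. hf ?V I t = (\<Sum>k<e. a k * (t choose k))"
    using csat_gvd_radical_binomial_form[OF assms(5)] unfolding binomial_form_def by auto
  define d where "d = quotient_dim ?V I"
  have small: "small ?V I d"
  proof (rule ccontr)
    assume "\<not> small ?V I d"
    from prime_chain_not_small[OF _ assms(2) this] obtain Q where
      Q: "\<And>i. i \<le> Suc d \<Longrightarrow> primeideal (Q i) (mpoly_ring ?V) \<and> I \<subseteq> Q i"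
        "\<And>i. i < Suc d \<Longrightarrow> Q i \<subset> Q (Suc i)"
      by auto
    have "Suc d \<le> quotient_dim ?V I"
      by (rule chain_length_le_quotient_dim[OF _ I, of "Suc d" Q]) (use Q in auto)
    then show False by (simp add: d_def)
  qed
  have a: "k < d" if "k < e" "a k \<noteq> 0" for k
    by (rule binomial_coeff_small[OF small hf that])
  \<comment> \<open>Properness keeps 1 outside \<open>I\<close>, so some coefficient is nonzero and
    \<open>d\<close> is positive. This matters because even a constant numerator has degree 0, which
    must be less than \<open>d\<close>.\<close>
  have "hf ?V I 0 \<noteq> 0"
  proof -
    obtain S where S: "mon_basis ?V I 0 S"
      using ex_mon_basis[OF _ I] by blast
    have "S \<noteq> {}"
    proof
      assume "S = {}"
      have "1 \<in> graded_piece ?V 0"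
        by (simp add: graded_piece_def polys_one)
      then obtain g where "Poly_Mapping.keys g \<subseteq> {}" "1 - g \<in> I"
        using mon_basisD(3)[OF S] \<open>S = {}\<close> by blast
      then show False using assms(3) ideal_eq_polys_iff[OF I] by simp
    qed
    moreover have "finite S"
      using mon_basisD(1)[OF S] finite_degree_monomials finite_subset by blast
    ultimately show ?thesis using hf_eq_card[OF _ I S] by simp
  qed
  then obtain k where "k < e" "a k \<noteq> 0"
    unfolding hf by (metis (no_types, lifting) lessThan_iff mult_is_0 sum.neutral)
  then have "d > 0" using a[of k] by simp
  have "a_invariant ?V I < 0"
  proof -
    obtain h where h: "Abs_fps (\<lambda>t. int (hf ?V I t)) * (1 - fps_X) ^ d = fps_of_poly h" "Polynomial.degree h < d"
      using binomial_series_numerator[OF hf a \<open>d > 0\<close>] by blast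
    \<comment> \<open>The description determines the numerator, as a polynomial is determined by its
      power series.\<close>
    have "h_polynomial ?V I = h"
      unfolding h_polynomial_def hilbert_series_def HF
      using h(1) unfolding d_def by (intro the_equality) (simp_all add: fps_of_poly_eq_iff)
    then show ?thesis
      using h(2) by (simp add: a_invariant_def d_def)
  qed
  moreover have "hilbertian ?V I"
  proof -
    obtain p :: "rat poly" where p: "\<And>t::nat. poly p (of_nat t) = of_nat (hf ?V I t)"
      unfolding hf using binomial_sum_poly by blast
    \<comment> \<open>The binomial form is a polynomial at every \<open>t\<close>, so once
      \<open>p\<close> is recognised as the Hilbert polynomial the equality holds from
      \<open>t = 0\<close> on.\<close>
    have "hilbert_polynomial ?V I = p"
      unfolding hilbert_polynomial_def
    proof (rule the_equality)
      show "\<forall>\<^sub>F t in sequentially. poly p (of_nat t) = of_nat (hilbert_function ?V I t)"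
        unfolding HF p by simp
      fix q :: "rat poly" assume "\<forall>\<^sub>F t in sequentially. poly q (of_nat t) = of_nat (hilbert_function ?V I t)"
      then show "q = p"
        unfolding HF p[symmetric] by (rule eventually_eq_poly_unique)
    qed
    then show ?thesis
      unfolding hilbertian_def HF by (simp only: assms(2) p simp_thms)
  qed
  ultimately show ?thesis ..
qed

end
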